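(* Let $s,t\ge 2$ be integers and let $k\in\{3,4\}$. Then, as $n\to\infty$ (with $s,t,k$ fixed), $$\mathrm{ex}(n,K_{s,t}^k)=O\left(n^{1+\frac1k-\frac1{sk}}\right).$$
   Context: Graphs are finite and simple. For a graph $H$, $\mathrm{ex}(n,H)$ is the largest number of edges in an $n$-vertex graph that does not contain $H$ as a (not necessarily induced) subgraph. $K_{s,t}^k$ is the graph obtained from the complete bipartite graph $K_{s,t}$ by replacing each edge $uv$ with a path of length $k$ (i.e. with $k$ edges) between $u$ and $v$ so that the $st$ replacing paths are internally vertex-disjoint. *)

theory Defs
  imports Complex_Main "HOL-Library.Landau_Symbols"
begin

text \<open>A graph is a pair of a vertex set and a set of edges, each edge being a two-element
  set of vertices.\<close>

type_synonym 'a graph = "'a set \<times> 'a set set"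

definition verts :: "'a graph \<Rightarrow> 'a set" where
  "verts G = fst G"

definition edges :: "'a graph \<Rightarrow> 'a set set" where
  "edges G = snd G"

definition simple_graph :: "'a graph \<Rightarrow> bool" where
  "simple_graph G \<longleftrightarrow> finite (verts G) \<and> (\<forall>e\<in>edges G. e \<subseteq> verts G \<and> card e = 2)"

text \<open>Not necessarily induced: nothing is required of the non-edges of \<open>H\<close>.\<close>

definition contains_copy :: "'a graph \<Rightarrow> 'b graph \<Rightarrow> bool" where
  "contains_copy G H \<longleftrightarrow>
     (\<exists>f. inj_on f (verts H) \<and> f ` verts H \<subseteq> verts G \<and> (\<forall>e\<in>edges H. f ` e \<in> edges G))"

text \<open>Every finite graph is isomorphic to one whose vertices are natural numbers, so it is no
  restriction to let the host graphs range over those. If \<open>H\<close> has an edge, then the set under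
  \<^const>\<open>Max\<close> is nonempty, as the edgeless graphs do not contain \<open>H\<close>; finiteness is shown below.\<close>

definition extremal_number :: "nat \<Rightarrow> 'b graph \<Rightarrow> nat" where
  "extremal_number n H =
     Max {card (edges G) | G :: nat graph.
            simple_graph G \<and> card (verts G) = n \<and> \<not> contains_copy G H}"

text \<open>\<open>Inner i j m\<close> is the \<open>m\<close>-th vertex (\<open>0 < m < k\<close>) on the path that replaces the edge between
  \<open>Left i\<close> and \<open>Right j\<close>; giving each pair \<open>(i, j)\<close> its own inner vertices makes the paths
  internally disjoint.\<close>

datatype sub_vertex = Left nat | Right nat | Inner nat nat nat

definition path_vertex :: "nat \<Rightarrow> nat \<Rightarrow> nat \<Rightarrow> nat \<Rightarrow> sub_vertex" where
  "path_vertex k i j m = (if m = 0 then Left i else if m = k then Right j else Inner i j m)"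

text \<open>The graph $K_{s,t}^k$, for \<open>k \<ge> 1\<close>.\<close>

definition subdivided_K :: "nat \<Rightarrow> nat \<Rightarrow> nat \<Rightarrow> sub_vertex graph" where
  "subdivided_K s t k =
     (Left ` {..<s} \<union> Right ` {..<t} \<union> {Inner i j m | i j m. i < s \<and> j < t \<and> 0 < m \<and> m < k},
      {{path_vertex k i j m, path_vertex k i j (Suc m)} | i j m. i < s \<and> j < t \<and> m < k})"

lemma finite_edge_counts:
  "finite {card (edges G) | G :: nat graph.
             simple_graph G \<and> card (verts G) = n \<and> \<not> contains_copy G H}"
proof (rule finite_subset)
  show "{card (edges G) | G :: nat graph.
           simple_graph G \<and> card (verts G) = n \<and> \<not> contains_copy G H} \<subseteq> {..2 ^ n}"
  proof
    fix c
    assume "c \<in> {card (edges G) | G :: nat graph.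
                 simple_graph G \<and> card (verts G) = n \<and> \<not> contains_copy G H}"
    then obtain G :: "nat graph"
      where G: "simple_graph G" "card (verts G) = n" and c: "c = card (edges G)"
      by blast
    have "edges G \<subseteq> Pow (verts G)" and fin: "finite (verts G)"
      using G by (auto simp: simple_graph_def)
    then have "card (edges G) \<le> card (Pow (verts G))"
      by (intro card_mono) auto
    then show "c \<in> {..2 ^ n}"
      using fin G c by (simp add: card_Pow)
  qed
qed simp

lemma simple_graph_subdivided_K:
  assumes "k \<ge> 1"
  shows "simple_graph (subdivided_K s t k)"
proof -
  have "{Inner i j m | i j m. i < s \<and> j < t \<and> 0 < m \<and> m < k}
          \<subseteq> (\<lambda>(i, j, m). Inner i j m) ` ({..<s} \<times> {..<t} \<times> {..<k})"
    by force
  then have "finite {Inner i j m | i j m. i < s \<and> j < t \<and> 0 < m \<and> m < k}"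
    by (rule finite_subset) simp
  then show ?thesis
    using assms
    by (auto simp: simple_graph_def subdivided_K_def verts_def edges_def path_vertex_def)
qed

end

(*
  Passing to a subgraph, all degrees may be taken within a constant factor of some delta, with
  delta^(s k) much larger than n^(s - 1). Hence there are many more spiders (a centre with s disjoint
  legs of length k) than s-tuples of leaves. A pair of vertices is called robust if no bounded set of
  vertices destroys all paths of a given length between them, and similarly for the leaves of a
  spider; t disjoint spiders on a robust tuple form the required subdivision, so assume that there is
  no robust tuple for legs of length k. If few paths and few spiders with shorter legs have robust
  ends, then the hitting sets at non-robust ends bound the number of the remaining spiders on given
  leaves by a constant, which contradicts the count. So the point is that dense robust paths or
  dense robust spiders with shorter legs produce a robust tuple for legs of length k.

  For robust paths one fixes the second vertex of such a path; the ends then form a dense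
  bipartite graph, which contains complete bipartite pieces. For robust spiders with legs l_i
  one may assume l_i + l_j > k. If all l_i >= k/2, one fixes the initial segments of length 2 l_i - k
  of the legs, takes their ends as the new leaves, and detours over the varying remainders. Since
  k <= 4, the only other case is one leg of length 1 and all others of length k; there the adjacent
  pairs (centre, short leaf) form a bipartite graph of large minimum degree, in which the missing part
  of the leg is found greedily.
*)
theory Submission
  imports Defs "HOL-Library.FuncSet"
begin

section \<open>Averaging, greedy selection and walks\<close>

section \<open>Counting\<close>

text \<open>A set that destroys all spiders on given leaves may hit a leg in its interior. Cutting
  there leaves a spider with one shorter leg and a path, and the count can be repeated only if
  neither contains a robust configuration. Hence robustness is considered for every vector of leg
  lengths and for every segment of a leg, and each of these configurations has to be shown to be
  rare. Two legs of a spider with robust leaves form a path with robust ends, so vectors with l_i +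
  l_j \<le> k are settled by paths.

  Rare means at most a proportion \<epsilon> of \<open>card V * D ^ m\<close>, where
  \<open>D\<close> bounds the maximum degree; almost regularity makes this comparable with powers of
  the minimum degree. The constants are fixed in this order: the tolerance \<open>L0\<close>, from
  the size of the subdivision; \<epsilon>, from the number of rare classes; the tolerance for paths;
  the tolerance for spiders, which may depend on that for paths; finally a lower bound for the
  degrees. Composing robust pairs loses tolerance, which is why the later tolerances are
  large.\<close>

lemma real_card_Collect_eq_sum:
  assumes "finite A"
  shows "real (card {x\<in>A. P x}) = (\<Sum>x\<in>A. of_bool (P x))"
  using assms by (simp add: sum_of_bool_eq Int_def)

lemma double_count:
  assumes "finite A" "finite B"
  shows "(\<Sum>b\<in>B. real (card {a\<in>A. R a b})) = (\<Sum>a\<in>A. real (card {b\<in>B. R a b}))"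
  unfolding real_card_Collect_eq_sum[OF assms(1)] real_card_Collect_eq_sum[OF assms(2)]
  by (rule sum.swap)

lemma card_le_fibers:
  assumes "finite A" "finite B" "f ` A \<subseteq> B"
    and "\<And>b. b \<in> B \<Longrightarrow> real (card {a\<in>A. f a = b}) \<le> c"
  shows "real (card A) \<le> c * real (card B)"
proof -
  have "real (card A) = (\<Sum>b\<in>B. real (card {a\<in>A. f a = b}))"
    using sum.group[OF assms(1-3), of "\<lambda>_. 1::real"] by simp
  also have "\<dots> \<le> (\<Sum>b\<in>B. c)"
    by (intro sum_mono assms(4))
  finally show ?thesis
    by (simp add: mult.commute)
qed

lemma exists_large_fiber:
  assumes "finite B" "B \<noteq> {}" "(\<Sum>b\<in>B. f b) \<ge> c * real (card B)"
  shows "\<exists>b\<in>B. f b \<ge> c"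
proof (rule ccontr)
  assume "\<not> ?thesis"
  then have "(\<Sum>b\<in>B. f b) < (\<Sum>b\<in>B. c)"
    using assms by (intro sum_strict_mono) auto
  with assms(3) show False by (simp add: mult.commute)
qed

text \<open>Values below \<epsilon> / 2 * a add up to at most half of the required sum, so the other
  half comes from arguments whose values are at most \<open>a\<close>. Both \<open>a\<close> and
  \<open>b\<close> are only upper bounds, which lets powers of \<open>D\<close> stand for numbers of
  walks.\<close>

lemma many_large_values:
  fixes a b \<epsilon> :: real
  assumes fin: "finite B" and f: "\<And>y. y \<in> B \<Longrightarrow> f y \<le> a" and a: "a > 0"
    and b: "real (card B) \<le> b" and e: "\<epsilon> \<ge> 0" and sum: "(\<Sum>y\<in>B. f y) \<ge> \<epsilon> * a * b"
  shows "real (card {y\<in>B. f y \<ge> \<epsilon> / 2 * a}) \<ge> \<epsilon> / 2 * b"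
proof -
  define G where "G = {y\<in>B. f y \<ge> \<epsilon> / 2 * a}"
  have "(\<Sum>y\<in>B. f y) \<le> (\<Sum>y\<in>B. \<epsilon> / 2 * a + a * of_bool (y \<in> G))"
  proof (rule sum_mono)
    fix y assume "y \<in> B"
    moreover have "\<epsilon> * a \<ge> 0"
      using a e by simp
    ultimately show "f y \<le> \<epsilon> / 2 * a + a * of_bool (y \<in> G)"
      using f[of y] by (auto simp: G_def)
  qed
  also have "\<dots> = \<epsilon> / 2 * a * real (card B) + a * real (card G)"
  proof -
    have "{y\<in>B. y \<in> G} = G" by (auto simp: G_def)
    then have "(\<Sum>y\<in>B. of_bool (y \<in> G)) = real (card G)"
      using real_card_Collect_eq_sum[OF fin, of "\<lambda>y. y \<in> G"] by simp
    then show ?thesis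
      unfolding sum.distrib sum_distrib_left[symmetric] by simp
  qed
  also have "\<dots> \<le> \<epsilon> / 2 * a * b + a * real (card G)"
    using a b e by (intro add_right_mono mult_left_mono) auto
  finally have "a * (\<epsilon> / 2 * b) \<le> a * real (card G)"
    using sum by (simp add: algebra_simps)
  then show ?thesis
    using a by (simp add: G_def)
qed

text \<open>One side of a complete bipartite subgraph is chosen vertex by vertex: averaging over the
  vertices not yet chosen finds one that keeps a proportion \<eta> of the surviving elements of
  \<open>Q\<close>. The surplus \<open>r\<close> in the degrees makes up for the vertices already
  chosen.\<close>

lemma common_neighbours:
  fixes a \<eta> :: real
  assumes fin: "finite A" "finite Q" "Q \<noteq> {}" and a: "real (card A) \<le> a" "\<eta> > 0" "a > 0"
    and deg: "\<And>q. q \<in> Q \<Longrightarrow> real (card {x\<in>A. R x q}) \<ge> \<eta> * a + real r"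
  shows "\<exists>X. inj_on X {..<r} \<and> X ` {..<r} \<subseteq> A \<and>
           real (card {q\<in>Q. \<forall>i<r. R (X i) q}) \<ge> \<eta> ^ r * real (card Q)"
  using deg
proof (induction r)
  case 0
  then show ?case by auto
next
  case (Suc r)
  have "\<exists>X. inj_on X {..<r} \<and> X ` {..<r} \<subseteq> A \<and>
           real (card {q\<in>Q. \<forall>i<r. R (X i) q}) \<ge> \<eta> ^ r * real (card Q)"
  proof (rule Suc.IH)
    fix q assume "q \<in> Q"
    with Suc.prems[of q] show "real (card {x\<in>A. R x q}) \<ge> \<eta> * a + real r" by simp
  qed
  then obtain X where X: "inj_on X {..<r}" "X ` {..<r} \<subseteq> A"
    and big: "real (card {q\<in>Q. \<forall>i<r. R (X i) q}) \<ge> \<eta> ^ r * real (card Q)"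
    by blast
  define Q' where "Q' = {q\<in>Q. \<forall>i<r. R (X i) q}"
  have finQ': "finite Q'" using fin by (simp add: Q'_def)
  have pos: "card Q' > 0"
  proof -
    have "\<eta> ^ r * real (card Q) > 0" using fin a by (simp add: card_gt_0_iff)
    with big show ?thesis by (auto simp: Q'_def intro: gr0I)
  qed
  define A' where "A' = A - X ` {..<r}"
  have finA': "finite A'" using fin by (simp add: A'_def)
  have "(\<Sum>q\<in>Q'. \<eta> * a) \<le> (\<Sum>q\<in>Q'. real (card {x\<in>A'. R x q}))"
  proof (rule sum_mono)
    fix q assume "q \<in> Q'"
    then have "q \<in> Q" by (simp add: Q'_def)
    have "card {x\<in>A. R x q} \<le> card ({x\<in>A'. R x q} \<union> X ` {..<r})"
      using fin finA' by (intro card_mono) (auto simp: A'_def)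
    also have "\<dots> \<le> card {x\<in>A'. R x q} + card (X ` {..<r})"
      by (rule card_Un_le)
    also have "card (X ` {..<r}) \<le> r"
      using card_image_le[of "{..<r}" X] by simp
    finally have "real (card {x\<in>A. R x q}) \<le> real (card {x\<in>A'. R x q}) + real r"
      by linarith
    with Suc.prems[OF \<open>q \<in> Q\<close>] show "\<eta> * a \<le> real (card {x\<in>A'. R x q})" by simp
  qed
  also have "\<dots> = (\<Sum>x\<in>A'. real (card {q\<in>Q'. R x q}))"
    using finA' finQ' by (rule double_count)
  finally have sum: "\<eta> * a * real (card Q') \<le> (\<Sum>x\<in>A'. real (card {q\<in>Q'. R x q}))"
    by (simp add: mult.commute)
  have "A' \<noteq> {}"
  proof
    assume "A' = {}"
    with sum a pos show False by (simp add: mult_le_0_iff)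
  qed
  moreover have "\<eta> * real (card Q') * real (card A') \<le> \<eta> * real (card Q') * a"
  proof (rule mult_left_mono)
    have "card A' \<le> card A" using fin by (intro card_mono) (auto simp: A'_def)
    then show "real (card A') \<le> a" using a by linarith
  qed (use a in auto)
  ultimately obtain x where x: "x \<in> A'" "real (card {q\<in>Q'. R x q}) \<ge> \<eta> * real (card Q')"
    using exists_large_fiber[OF finA', of "\<eta> * real (card Q')" "\<lambda>x. real (card {q\<in>Q'. R x q})"] sum
    by (auto simp: mult_ac)
  have "{q\<in>Q. \<forall>i<Suc r. R ((X(r := x)) i) q} = {q\<in>Q'. R x q}"
    by (auto simp: Q'_def less_Suc_eq)
  moreover have "\<eta> * (\<eta> ^ r * real (card Q)) \<le> \<eta> * real (card Q')"
    using a big unfolding Q'_def by (intro mult_left_mono) auto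
  ultimately have "real (card {q\<in>Q. \<forall>i<Suc r. R ((X(r := x)) i) q}) \<ge> \<eta> ^ Suc r * real (card Q)"
    using x by simp
  moreover have "inj_on (X(r := x)) {..<Suc r}" "(X(r := x)) ` {..<Suc r} \<subseteq> A"
    using X x by (auto simp: A'_def lessThan_Suc inj_on_def)
  ultimately show ?case by blast
qed

text \<open>At every stage \<open>S\<close> and the cores already chosen have at most
  \<open>card S + r * c\<close> elements, a set which the next object can avoid. Only the cores
  become disjoint: for legs these are the inner vertices, for spiders the centre and the inner
  vertices of the legs, so that leaves can be shared.\<close>

lemma greedy_disjoint:
  fixes core :: "'b \<Rightarrow> 'a set"
  assumes ex: "\<And>i T. i < r \<Longrightarrow> finite T \<Longrightarrow> card T \<le> B \<Longrightarrow> \<exists>p. P i p \<and> core p \<inter> T = {}"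
    and core: "\<And>i p. i < r \<Longrightarrow> P i p \<Longrightarrow> finite (core p) \<and> card (core p) \<le> c"
    and S: "finite S" "card S + r * c \<le> B"
  shows "\<exists>g. (\<forall>i<r. P i (g i) \<and> core (g i) \<inter> S = {}) \<and>
             (\<forall>i<r. \<forall>j<r. i \<noteq> j \<longrightarrow> core (g i) \<inter> core (g j) = {})"
  using assms
proof (induction r)
  case 0
  then show ?case by simp
next
  case (Suc r)
  have "\<exists>g. (\<forall>i<r. P i (g i) \<and> core (g i) \<inter> S = {}) \<and>
             (\<forall>i<r. \<forall>j<r. i \<noteq> j \<longrightarrow> core (g i) \<inter> core (g j) = {})"
  proof (rule Suc.IH)
    show "finite (core p) \<and> card (core p) \<le> c" if "i < r" "P i p" for i p
      using Suc.prems(2)[of i p] that by simp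
  qed (use Suc.prems(1,3,4) in auto)
  then obtain g where g: "\<forall>i<r. P i (g i) \<and> core (g i) \<inter> S = {}"
     "\<forall>i<r. \<forall>j<r. i \<noteq> j \<longrightarrow> core (g i) \<inter> core (g j) = {}" by blast
  have c: "finite (core (g i)) \<and> card (core (g i)) \<le> c" if "i < r" for i
    using g Suc.prems(2)[of i "g i"] that by simp
  define T where "T = S \<union> (\<Union>i<r. core (g i))"
  have "card (\<Union>i<r. core (g i)) \<le> (\<Sum>i<r. card (core (g i)))"
    by (rule card_UN_le) simp
  also have "\<dots> \<le> (\<Sum>i<r. c)"
    using c by (intro sum_mono) auto
  finally have "card T \<le> card S + r * c"
    unfolding T_def using card_Un_le[of S "\<Union>i<r. core (g i)"] by simp
  moreover have "finite T"
    unfolding T_def using c Suc.prems(3) by auto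
  ultimately obtain p where p: "P r p" "core p \<inter> T = {}"
    using Suc.prems(1)[of r T] Suc.prems(4) by auto
  show ?case
    by (rule exI[of _ "g(r := p)"]) (use p g in \<open>auto simp: less_Suc_eq T_def\<close>)
qed

text \<open>The start vertex is kept outside the list. So the list has as many entries as the walk
  has edges, and consecutive walks concatenate without a repeated joint.\<close>

primrec walk_from :: "('a \<Rightarrow> 'a \<Rightarrow> bool) \<Rightarrow> 'a \<Rightarrow> 'a list \<Rightarrow> bool" where
  "walk_from E x [] = True"
| "walk_from E x (y # p) = (E x y \<and> walk_from E y p)"

lemma walk_from_append:
  "walk_from E x (p @ q) \<longleftrightarrow> walk_from E x p \<and> walk_from E (last (x # p)) q"
  by (induction p arbitrary: x) auto

lemma walk_from_nth:
  "walk_from E x p \<longleftrightarrow> (\<forall>i<length p. E ((x # p) ! i) (p ! i))"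
proof (induction p arbitrary: x)
  case (Cons a p)
  show ?case
    by (auto simp: Cons.IH less_Suc_eq_0_disj nth_Cons split: nat.splits)
qed simp

lemma last_Cons_take: "j \<le> length p \<Longrightarrow> last (x # take j p) = (x # p) ! j"
  by (cases j) (auto simp: take_Suc_conv_app_nth last_conv_nth nth_Cons' min_def)

lemma walk_from_rev:
  assumes "\<And>u v. E u v \<Longrightarrow> E v u"
  shows "walk_from E x p \<Longrightarrow> walk_from E (last (x # p)) (rev (butlast (x # p)))"
proof (induction p arbitrary: x)
  case (Cons a p)
  then have *: "walk_from E (last (a # p)) (rev (butlast (a # p)))" "E x a" by auto
  have "last (last (a # p) # rev (butlast (a # p))) = a"
    by (cases p) auto
  with * show ?case
    using assms by (auto simp: walk_from_append)
qed simp

section \<open>Boundedly many good paths and good spiders on given ends\<close>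

section \<open>Paths and spiders\<close>

text \<open>The product counts the position of a hit, the hitting vertex and two shorter good paths;
  the first summand makes the sequence monotone.\<close>

primrec path_bound :: "nat \<Rightarrow> nat \<Rightarrow> nat" where
  "path_bound L 0 = 1"
| "path_bound L (Suc m) = path_bound L m + Suc m * L * (path_bound L m)\<^sup>2"

lemma path_bound_mono: "m \<le> n \<Longrightarrow> path_bound L m \<le> path_bound L n"
  by (rule lift_Suc_mono_le[of "path_bound L"]) auto

text \<open>The last argument is the total length of the legs. After the summand for monotonicity
  come the spiders with a hit centre and those with a hit leg: leg, position, hitting vertex,
  shortened spider, rest of the leg.\<close>

primrec spider_bound :: "nat \<Rightarrow> nat \<Rightarrow> nat \<Rightarrow> nat \<Rightarrow> nat \<Rightarrow> nat" where
  "spider_bound L' L s k 0 = 1"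
| "spider_bound L' L s k (Suc N) = spider_bound L' L s k N + L * path_bound L' k ^ s
     + s * k * L * spider_bound L' L s k N * path_bound L' k"

lemma spider_bound_mono: "m \<le> n \<Longrightarrow> spider_bound L' L s k m \<le> spider_bound L' L s k n"
  by (rule lift_Suc_mono_le[of "spider_bound L' L s k"]) auto

lemma Cons_nth_drop: "j \<le> length p \<Longrightarrow> (x # p) ! j # drop j p = drop j (x # p)"
  using Cons_nth_drop_Suc[of j "x # p"] by simp

text \<open>\<open>s\<close> is the number of legs of a spider. \<open>D\<close> is a real number
  because it will be a constant multiple of a real lower bound for the degrees.\<close>

locale bounded_graph =
  fixes V :: "'a set" and adj :: "'a \<Rightarrow> 'a \<Rightarrow> bool" and D :: real and s :: nat
  assumes finite_V: "finite V"
    and adj_sym: "adj u v \<Longrightarrow> adj v u"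
    and adj_irrefl: "\<not> adj v v"
    and adj_V: "adj u v \<Longrightarrow> u \<in> V"
    and degree_le: "real (card {u. adj v u}) \<le> D"
    and D_ge_1: "D \<ge> 1"
begin

definition nb :: "'a \<Rightarrow> 'a set" where
  "nb v = {u. adj v u}"

definition walks :: "'a \<Rightarrow> nat \<Rightarrow> 'a list set" where
  "walks x m = {p. length p = m \<and> walk_from adj x p}"

definition is_path :: "nat \<Rightarrow> 'a \<Rightarrow> 'a \<Rightarrow> 'a list \<Rightarrow> bool" where
  "is_path m x z p \<longleftrightarrow> length p = m \<and> walk_from adj x p \<and> distinct (x # p) \<and> last (x # p) = z"

text \<open>\<open>butlast p\<close> lists exactly the inner vertices, as the start is not in the
  list; so \<open>S\<close> may contain the ends, and an edge is robust for every
  \<open>L\<close>.\<close>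

definition robust :: "nat \<Rightarrow> nat \<Rightarrow> 'a \<Rightarrow> 'a \<Rightarrow> bool" where
  "robust L m x z \<longleftrightarrow>
     (\<forall>S. finite S \<longrightarrow> card S \<le> L \<longrightarrow> (\<exists>p. is_path m x z p \<and> set (butlast p) \<inter> S = {}))"

text \<open>Segments of length 1 are left out because edges are always robust.\<close>

definition good_path :: "nat \<Rightarrow> 'a \<Rightarrow> 'a list \<Rightarrow> bool" where
  "good_path L x p \<longleftrightarrow>
     (\<forall>a b. a + 2 \<le> b \<longrightarrow> b \<le> length p \<longrightarrow> \<not> robust L (b - a) ((x # p) ! a) ((x # p) ! b))"

definition good_paths :: "nat \<Rightarrow> nat \<Rightarrow> 'a \<Rightarrow> 'a \<Rightarrow> 'a list set" where
  "good_paths L m x z = {p. is_path m x z p \<and> good_path L x p}"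

text \<open>Extensionality makes a spider determined by its centre and its \<open>s\<close> legs, so
  that spiders can be counted.\<close>

definition is_spider :: "(nat \<Rightarrow> nat) \<Rightarrow> 'a \<Rightarrow> (nat \<Rightarrow> 'a list) \<Rightarrow> bool" where
  "is_spider l y g \<longleftrightarrow> y \<in> V \<and> g \<in> extensional {..<s} \<and>
     (\<forall>i<s. is_path (l i) y (last (y # g i)) (g i)) \<and>
     (\<forall>i<s. \<forall>j<s. i \<noteq> j \<longrightarrow> set (g i) \<inter> set (g j) = {})"

text \<open>The centre and the inner vertices avoid \<open>S\<close>, while the leaves may lie in
  it: in a subdivision the leaves are shared by all the spiders.\<close>

definition robust_spider :: "nat \<Rightarrow> (nat \<Rightarrow> nat) \<Rightarrow> (nat \<Rightarrow> 'a) \<Rightarrow> bool" where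
  "robust_spider L l X \<longleftrightarrow>
     (\<forall>S. finite S \<longrightarrow> card S \<le> L \<longrightarrow>
       (\<exists>y g. is_spider l y g \<and> (\<forall>i<s. last (y # g i) = X i) \<and> y \<notin> S \<and>
              (\<forall>i<s. set (butlast (g i)) \<inter> S = {})))"

text \<open>\<open>(y # g i) ! l' i\<close> is the end of leg \<open>i\<close> after truncation to
  length \<open>l' i\<close>. All truncations are included so that cutting a leg yields a good
  spider again.\<close>

definition good_spiders :: "nat \<Rightarrow> nat \<Rightarrow> (nat \<Rightarrow> nat) \<Rightarrow> (nat \<Rightarrow> 'a) \<Rightarrow> ('a \<times> (nat \<Rightarrow> 'a list)) set" where
  "good_spiders L' L l X = {(y, g). is_spider l y g \<and> (\<forall>i<s. last (y # g i) = X i) \<and>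
     (\<forall>i<s. good_path L' y (g i)) \<and>
     (\<forall>l'. (\<forall>i<s. 1 \<le> l' i \<and> l' i \<le> l i) \<longrightarrow> \<not> robust_spider L l' (\<lambda>i. (y # g i) ! l' i))}"

lemma finite_nb: "finite (nb v)"
  by (rule finite_subset[OF _ finite_V]) (auto simp: nb_def intro: adj_V adj_sym)

lemma nb_subset_V: "nb v \<subseteq> V"
  by (auto simp: nb_def intro: adj_V adj_sym)

lemma card_nb: "real (card (nb v)) \<le> D"
  using degree_le by (simp add: nb_def)

lemma D_pos: "D > 0" and D_nonneg: "D \<ge> 0"
  using D_ge_1 by auto

lemma walks_0: "walks x 0 = {[]}"
  by (auto simp: walks_def)

lemma walks_Suc: "walks x (Suc m) = (\<Union>u\<in>nb x. (#) u ` walks u m)"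
  by (auto simp: walks_def nb_def length_Suc_conv)

lemma finite_walks: "finite (walks x m)"
  by (induction m arbitrary: x) (auto simp: walks_0 walks_Suc finite_nb)

lemma card_walks: "real (card (walks x m)) \<le> D ^ m"
proof (induction m arbitrary: x)
  case (Suc m)
  have "real (card (walks x (Suc m))) \<le> real (\<Sum>u\<in>nb x. card ((#) u ` walks u m))"
    unfolding walks_Suc using card_UN_le[OF finite_nb] by (simp only: of_nat_le_iff)
  also have "\<dots> = (\<Sum>u\<in>nb x. real (card (walks u m)))"
    by (simp add: card_image)
  also have "\<dots> \<le> (\<Sum>u\<in>nb x. D ^ m)"
    by (intro sum_mono Suc)
  also have "\<dots> \<le> D * D ^ m"
    using card_nb D_nonneg by (simp add: mult_right_mono)
  finally show ?case by simp
qed (simp add: walks_0)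

lemma walks_subset_V: "p \<in> walks x m \<Longrightarrow> set p \<subseteq> V"
proof (induction m arbitrary: x p)
  case (Suc m)
  then obtain u q where "p = u # q" "u \<in> nb x" "q \<in> walks u m"
    by (auto simp: walks_Suc)
  then show ?case using Suc.IH[of q u] nb_subset_V[of x] by auto
qed (simp add: walks_0)

lemma is_path_walks: "is_path m x z p \<Longrightarrow> p \<in> walks x m"
  by (simp add: is_path_def walks_def)

lemma walks_take_drop:
  assumes "p \<in> walks x m" "j \<le> m"
  shows "take j p \<in> walks x j" "drop j p \<in> walks ((x # p) ! j) (m - j)"
proof -
  have "walk_from adj x (take j p @ drop j p)"
    using assms by (simp add: walks_def)
  moreover have "last (x # take j p) = (x # p) ! j"
    using assms by (intro last_Cons_take) (simp add: walks_def)
  ultimately have "walk_from adj x (take j p)" "walk_from adj ((x # p) ! j) (drop j p)"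
    unfolding walk_from_append by simp_all
  then show "take j p \<in> walks x j" "drop j p \<in> walks ((x # p) ! j) (m - j)"
    using assms by (simp_all add: walks_def)
qed

lemma card_walks_through:
  assumes "j < m"
  shows "real (card {p\<in>walks x m. p ! j = u}) \<le> D ^ (m - 1)"
proof -
  let ?f = "\<lambda>p. (take j p, drop (Suc j) p)"
  have "card {p\<in>walks x m. p ! j = u} \<le> card (walks x j \<times> walks u (m - Suc j))"
  proof (rule card_inj_on_le[of ?f])
    show "inj_on ?f {p\<in>walks x m. p ! j = u}"
    proof (rule inj_onI)
      fix p q assume pq: "p \<in> {p\<in>walks x m. p ! j = u}" "q \<in> {p\<in>walks x m. p ! j = u}" "?f p = ?f q"
      then have "p = take j p @ u # drop (Suc j) p" "q = take j q @ u # drop (Suc j) q"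
        using assms id_take_nth_drop[of j p] id_take_nth_drop[of j q] by (auto simp: walks_def)
      then show "p = q" using pq by (metis prod.inject)
    qed
    show "?f ` {p\<in>walks x m. p ! j = u} \<subseteq> walks x j \<times> walks u (m - Suc j)"
    proof
      fix r assume "r \<in> ?f ` {p\<in>walks x m. p ! j = u}"
      then obtain p where p: "r = ?f p" "p \<in> walks x m" "p ! j = u"
        by blast
      then show "r \<in> walks x j \<times> walks u (m - Suc j)"
        using walks_take_drop[OF p(2), of j] walks_take_drop[OF p(2), of "Suc j"] assms by simp
    qed
  qed (simp add: finite_walks)
  then have "real (card {p\<in>walks x m. p ! j = u}) \<le> real (card (walks x j)) * real (card (walks u (m - Suc j)))"
    by (simp add: card_cartesian_product flip: of_nat_mult)
  also have "\<dots> \<le> D ^ j * D ^ (m - Suc j)"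
    using D_nonneg by (intro mult_mono card_walks) auto
  also have "\<dots> = D ^ (m - 1)"
    using assms by (simp flip: power_add)
  finally show ?thesis .
qed

text \<open>A prescribed entry costs one factor of \<open>D\<close>, so a bounded set meets only O(1
  / D) of the bound \<open>D ^ m\<close> for the number of walks. Hence it cannot meet all members
  of a family of at least \<epsilon> * D ^ m walks once \<open>D\<close> is large.\<close>

lemma card_walks_hitting:
  assumes "finite T"
  shows "real (card {p\<in>walks x m. set p \<inter> T \<noteq> {}}) \<le> real m * real (card T) / D * D ^ m"
proof (cases m)
  case 0
  then show ?thesis by (simp add: walks_0)
next
  case (Suc n)
  have "{p\<in>walks x m. set p \<inter> T \<noteq> {}} \<subseteq> (\<Union>(j, u)\<in>{..<m} \<times> T. {p\<in>walks x m. p ! j = u})"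
  proof
    fix p assume p: "p \<in> {p\<in>walks x m. set p \<inter> T \<noteq> {}}"
    then obtain u where "u \<in> set p" "u \<in> T" by auto
    then obtain j where "j < length p" "p ! j = u" by (auto simp: in_set_conv_nth)
    then show "p \<in> (\<Union>(j, u)\<in>{..<m} \<times> T. {p\<in>walks x m. p ! j = u})"
      using p \<open>u \<in> T\<close> by (auto simp: walks_def)
  qed
  then have "card {p\<in>walks x m. set p \<inter> T \<noteq> {}} \<le> card (\<Union>(j, u)\<in>{..<m} \<times> T. {p\<in>walks x m. p ! j = u})"
    using assms finite_walks by (intro card_mono) auto
  also have "\<dots> \<le> (\<Sum>(j, u)\<in>{..<m} \<times> T. card {p\<in>walks x m. p ! j = u})"
    using card_UN_le[of "{..<m} \<times> T" "\<lambda>(j, u). {p\<in>walks x m. p ! j = u}"] assms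
    by (simp add: case_prod_beta)
  finally have "real (card {p\<in>walks x m. set p \<inter> T \<noteq> {}}) \<le> (\<Sum>(j, u)\<in>{..<m} \<times> T. real (card {p\<in>walks x m. p ! j = u}))"
    by (simp add: case_prod_beta flip: of_nat_sum)
  also have "\<dots> \<le> (\<Sum>(j, u)\<in>{..<m} \<times> T. D ^ (m - 1))"
  proof (rule sum_mono)
    fix w assume "w \<in> {..<m} \<times> T"
    then show "(case w of (j, u) \<Rightarrow> real (card {p \<in> walks x m. p ! j = u}))
        \<le> (case w of (j, u) \<Rightarrow> D ^ (m - 1))"
      using card_walks_through[of "fst w" m x "snd w"] by (auto simp: case_prod_beta)
  qed
  also have "\<dots> = real m * real (card T) * D ^ (m - 1)"
    by (simp add: card_cartesian_product split_def)
  also have "D ^ (m - 1) = D ^ m / D"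
    using D_pos Suc by simp
  also have "real m * real (card T) * (D ^ m / D) = real m * real (card T) / D * D ^ m"
    by simp
  finally show ?thesis .
qed

lemma robust_spider_cong:
  assumes "\<And>i. i < s \<Longrightarrow> l i = l' i" "\<And>i. i < s \<Longrightarrow> X i = X' i"
  shows "robust_spider L l X \<longleftrightarrow> robust_spider L l' X'"
  using assms by (simp add: robust_spider_def is_spider_def)

lemma is_path_take_drop:
  assumes "is_path m x z p" "j \<le> m"
  shows "is_path j x ((x # p) ! j) (take j p)" "is_path (m - j) ((x # p) ! j) z (drop j p)"
proof -
  have p: "p \<in> walks x m" "length p = m" using assms by (auto simp: is_path_def walks_def)
  note walks_take_drop[OF p(1) assms(2)]
  moreover have "distinct (take (Suc j) (x # p))" "distinct (drop j (x # p))"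
    using assms by (auto simp only: is_path_def intro: distinct_take distinct_drop)
  moreover have "last (drop j (x # p)) = z"
    using assms p by (subst last_drop) (auto simp: is_path_def)
  moreover have "last (x # take j p) = (x # p) ! j"
    using assms p by (intro last_Cons_take) simp
  ultimately show "is_path j x ((x # p) ! j) (take j p)" "is_path (m - j) ((x # p) ! j) z (drop j p)"
    using assms p unfolding is_path_def by (simp_all only: walks_def mem_Collect_eq Cons_nth_drop take_Suc_Cons simp_thms)
qed

lemma good_path_take_drop:
  assumes "good_path L x p" "j \<le> length p"
  shows "good_path L x (take j p)" "good_path L ((x # p) ! j) (drop j p)"
proof -
  have nth_take: "(x # take j p) ! a = (x # p) ! a" if "a \<le> j" for a
    using that by (cases a) auto
  show "good_path L x (take j p)"
    using assms by (auto simp: good_path_def nth_take)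
  show "good_path L ((x # p) ! j) (drop j p)"
    unfolding good_path_def Cons_nth_drop[OF assms(2)]
  proof (intro allI impI)
    fix a b assume ab: "a + 2 \<le> b" "b \<le> length (drop j p)"
    then have "\<not> robust L ((j + b) - (j + a)) ((x # p) ! (j + a)) ((x # p) ! (j + b))"
      using assms unfolding good_path_def by (metis add.assoc add_le_cancel_left le_diff_conv2 length_drop add.commute)
    then show "\<not> robust L (b - a) (drop j (x # p) ! a) (drop j (x # p) ! b)"
      using ab assms by (simp add: nth_drop)
  qed
qed

lemma finite_good_paths: "finite (good_paths L m x z)"
  by (rule finite_subset[OF _ finite_walks[of x m]]) (auto simp: good_paths_def intro: is_path_walks)

text \<open>For \<open>m \<ge> 2\<close> a single good path shows that its ends are not robust, so
  at most \<open>L\<close> vertices meet the interiors of all paths of this length between them.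
  Cutting a good path at a hit vertex gives two shorter good paths with known ends.\<close>

lemma card_good_paths: "card (good_paths L m x z) \<le> path_bound L m"
proof (induction m arbitrary: x z rule: less_induct)
  case (less m)
  show ?case
  proof (cases "m \<le> 1 \<or> good_paths L m x z = {}")
    case True
    have "good_paths L m x z \<subseteq> {if m = 0 then [] else [z]}" if "m \<le> 1"
      using that by (auto simp: good_paths_def is_path_def length_Suc_conv le_Suc_eq)
    then have "card (good_paths L m x z) \<le> 1"
      using True card_mono[of "{if m = 0 then [] else [z]}" "good_paths L m x z"] by auto
    also have "1 \<le> path_bound L m"
      using path_bound_mono[of 0 m L] by simp
    finally show ?thesis .
  next
    case False
    then obtain n where m: "m = Suc n" "n \<ge> 1" by (cases m) auto
    from False obtain p0 where p0: "is_path m x z p0" "good_path L x p0"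
      by (auto simp: good_paths_def)
    then have "\<not> robust L (m - 0) ((x # p0) ! 0) ((x # p0) ! m)"
      using m unfolding good_path_def is_path_def by (metis add_0 le_refl numeral_2_eq_2 Suc_le_mono One_nat_def)
    moreover have "(x # p0) ! m = z"
      using p0(1) by (auto simp: is_path_def last_conv_nth)
    ultimately have "\<not> robust L m x z" by simp
    then obtain S where S: "finite S" "card S \<le> L"
      and hit: "\<And>p. is_path m x z p \<Longrightarrow> set (butlast p) \<inter> S \<noteq> {}"
      unfolding robust_def by blast
    define F where "F = (\<lambda>(j, u). {p\<in>good_paths L m x z. p ! j = u})"
    have "good_paths L m x z \<subseteq> (\<Union>w\<in>{..<n} \<times> S. F w)"
    proof
      fix p assume p: "p \<in> good_paths L m x z"
      then have "set (butlast p) \<inter> S \<noteq> {}" "length p = m"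
        using hit by (auto simp: good_paths_def is_path_def)
      then obtain j where "j < n" "p ! j \<in> S"
        using m by (auto simp: in_set_conv_nth nth_butlast disjoint_iff)
      then show "p \<in> (\<Union>w\<in>{..<n} \<times> S. F w)"
        using p by (auto simp: F_def)
    qed
    then have "card (good_paths L m x z) \<le> card (\<Union>w\<in>{..<n} \<times> S. F w)"
      using S finite_good_paths by (intro card_mono) (auto simp: F_def)
    also have "\<dots> \<le> (\<Sum>w\<in>{..<n} \<times> S. card (F w))"
      using S by (intro card_UN_le) auto
    also have "\<dots> \<le> (\<Sum>w\<in>{..<n} \<times> S. path_bound L n * path_bound L n)"
    proof (rule sum_mono)
      fix w assume "w \<in> {..<n} \<times> S"
      then obtain j u where w: "w = (j, u)" "j < n" "u \<in> S" by auto
      let ?f = "\<lambda>p. (take (Suc j) p, drop (Suc j) p)"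
      have "card (F w) \<le> card (good_paths L (Suc j) x u \<times> good_paths L (m - Suc j) u z)"
      proof (rule card_inj_on_le[of ?f])
        show "inj_on ?f (F w)"
          by (rule inj_onI) (metis append_take_drop_id prod.inject)
        show "?f ` F w \<subseteq> good_paths L (Suc j) x u \<times> good_paths L (m - Suc j) u z"
        proof
          fix r assume "r \<in> ?f ` F w"
          then obtain p where p: "r = ?f p" "is_path m x z p" "good_path L x p" "p ! j = u"
            by (auto simp: F_def w good_paths_def)
          then have "length p = m" by (simp add: is_path_def)
          then show "r \<in> good_paths L (Suc j) x u \<times> good_paths L (m - Suc j) u z"
            using is_path_take_drop[OF p(2), of "Suc j"] good_path_take_drop[OF p(3), of "Suc j"] p w m
            by (auto simp: good_paths_def)
        qed
      qed (simp add: finite_good_paths)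
      also have "\<dots> \<le> path_bound L n * path_bound L n"
        unfolding card_cartesian_product
      proof (rule mult_mono)
        show "card (good_paths L (Suc j) x u) \<le> path_bound L n"
          using less.IH[of "Suc j" x u] path_bound_mono[of "Suc j" n L] w m by linarith
        show "card (good_paths L (m - Suc j) u z) \<le> path_bound L n"
          using less.IH[of "m - Suc j" u z] path_bound_mono[of "m - Suc j" n L] w m by linarith
      qed auto
      finally show "card (F w) \<le> path_bound L n * path_bound L n" .
    qed
    also have "\<dots> = n * card S * (path_bound L n)\<^sup>2"
      by (simp add: power2_eq_square card_cartesian_product)
    also have "\<dots> \<le> Suc n * L * (path_bound L n)\<^sup>2"
      using S by (intro mult_mono) auto
    also have "\<dots> \<le> path_bound L m"
      unfolding m by simp
    finally show ?thesis .
  qed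
qed

lemma spider_subset_PiE:
  "is_spider l y g \<Longrightarrow> y \<in> V \<and> g \<in> PiE {..<s} (\<lambda>i. walks y (l i))"
  by (auto simp: is_spider_def PiE_def intro: is_path_walks)

lemma finite_spiders: "finite {(y, g). is_spider l y g}"
proof (rule finite_subset)
  show "{(y, g). is_spider l y g} \<subseteq> Sigma V (\<lambda>y. PiE {..<s} (\<lambda>i. walks y (l i)))"
    using spider_subset_PiE by auto
  show "finite (Sigma V (\<lambda>y. PiE {..<s} (\<lambda>i. walks y (l i))))"
    by (intro finite_SigmaI finite_V finite_PiE finite_walks) auto
qed

lemma finite_good_spiders: "finite (good_spiders L' L l X)"
  by (rule finite_subset[OF _ finite_spiders[of l]]) (auto simp: good_spiders_def)

text \<open>One good spider shows that \<open>X\<close> is not robust, so at most \<open>L\<close>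
  vertices meet the centre or an inner vertex of every spider on \<open>X\<close>. If the centre is
  hit, the legs are good paths between known ends. If leg \<open>i\<close> is hit, it is cut there:
  the spider with the shortened leg is good for its new leaf, and the rest of the leg is a good
  path. The total length of the legs decreases.\<close>

lemma card_good_spiders:
  assumes "s > 0" "\<And>i. i < s \<Longrightarrow> 1 \<le> l i \<and> l i \<le> k"
  shows "card (good_spiders L' L l X) \<le> spider_bound L' L s k (\<Sum>i<s. l i)"
  using assms(2)
proof (induction "\<Sum>i<s. l i" arbitrary: l X rule: less_induct)
  case (less l X)
  show ?case
  proof (cases "good_spiders L' L l X = {}")
    case False
    have "l 0 \<le> (\<Sum>i<s. l i)" using assms(1) by (intro member_le_sum) auto
    then obtain N where N: "(\<Sum>i<s. l i) = Suc N"
      using less.prems[of 0] assms(1) by (cases "\<Sum>i<s. l i") auto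
    define M where "M = spider_bound L' L s k N"
    define W where "W = path_bound L' k"
    have nth: "(y # g i) ! l i = last (y # g i)" if "is_spider l y g" "i < s" for y g i
      using that last_conv_nth[of "y # g i"] by (simp add: is_spider_def is_path_def del: last.simps)
    from False obtain y0 g0 where "(y0, g0) \<in> good_spiders L' L l X" by auto
    then have "\<not> robust_spider L l (\<lambda>i. (y0 # g0 i) ! l i)" "is_spider l y0 g0"
        "\<forall>i<s. last (y0 # g0 i) = X i"
      using less.prems by (auto simp: good_spiders_def)
    \<comment> \<open>The full lengths \<open>l\<close> are themselves an admissible
      truncation.\<close>
    then have "\<not> robust_spider L l X"
      using robust_spider_cong[of l l X "\<lambda>i. (y0 # g0 i) ! l i"] nth by simp
    then obtain S where S: "finite S" "card S \<le> L"
      and hit0: "\<not> (\<exists>y g. is_spider l y g \<and> (\<forall>i<s. last (y # g i) = X i) \<and> y \<notin> S \<and>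
              (\<forall>i<s. set (butlast (g i)) \<inter> S = {}))"
      unfolding robust_spider_def by blast
    have hit: "\<exists>i<s. set (butlast (g i)) \<inter> S \<noteq> {}"
      if "is_spider l y g" "\<forall>i<s. last (y # g i) = X i" "y \<notin> S" for y g
      using hit0 that by blast
    \<comment> \<open>\<open>A u\<close> takes the spiders whose centre is hit,
      \<open>F (i, j, u)\<close> those hit at entry \<open>j\<close> of leg \<open>i\<close>;
      \<open>Suc j < l i\<close> excludes the leaf.\<close>
    define A where "A = (\<lambda>u. {(y, g)\<in>good_spiders L' L l X. y = u})"
    define F where "F = (\<lambda>(i, j, u). {(y, g)\<in>good_spiders L' L l X. Suc j < l i \<and> g i ! j = u})"
    have sub: "good_spiders L' L l X \<subseteq> (\<Union>u\<in>S. A u) \<union> (\<Union>w\<in>{..<s} \<times> {..<k} \<times> S. F w)"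
    proof
      fix z assume z: "z \<in> good_spiders L' L l X"
      obtain y g where yg: "z = (y, g)" by (cases z)
      show "z \<in> (\<Union>u\<in>S. A u) \<union> (\<Union>w\<in>{..<s} \<times> {..<k} \<times> S. F w)"
      proof (cases "y \<in> S")
        case True
        then show ?thesis using z by (auto simp: A_def yg)
      next
        case False
        then obtain i where i: "i < s" "set (butlast (g i)) \<inter> S \<noteq> {}"
          using hit[of y g] z by (auto simp: good_spiders_def yg)
        then obtain j where j: "j < length (g i) - 1" "g i ! j \<in> S"
          by (auto simp: in_set_conv_nth nth_butlast disjoint_iff)
        moreover have "length (g i) = l i"
          using z i by (auto simp: good_spiders_def yg is_spider_def is_path_def)
        ultimately have "z \<in> F (i, j, g i ! j)" "(i, j, g i ! j) \<in> {..<s} \<times> {..<k} \<times> S"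
          using z i less.prems[of i] by (auto simp: F_def yg)
        then show ?thesis by blast
      qed
    qed
    have cA: "card (A u) \<le> W ^ s" for u
    proof -
      have "card (A u) \<le> card (PiE {..<s} (\<lambda>i. good_paths L' (l i) u (X i)))"
      proof (rule card_inj_on_le[of snd])
        show "inj_on snd (A u)" by (auto simp: A_def inj_on_def)
        show "snd ` A u \<subseteq> PiE {..<s} (\<lambda>i. good_paths L' (l i) u (X i))"
        proof
          fix g assume "g \<in> snd ` A u"
          then have g: "is_spider l u g" "\<forall>i<s. last (u # g i) = X i" "\<forall>i<s. good_path L' u (g i)"
            by (auto simp only: A_def good_spiders_def split_beta mem_Collect_eq snd_conv fst_conv)
          then have "is_path (l i) u (X i) (g i)" if "i < s" for i
            using that unfolding is_spider_def by metis
          then show "g \<in> PiE {..<s} (\<lambda>i. good_paths L' (l i) u (X i))"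
            using g by (simp add: PiE_def Pi_def good_paths_def is_spider_def)
        qed
        show "finite (PiE {..<s} (\<lambda>i. good_paths L' (l i) u (X i)))"
          by (intro finite_PiE finite_good_paths finite_lessThan)
      qed
      also have "\<dots> = (\<Prod>i<s. card (good_paths L' (l i) u (X i)))"
        by (simp add: card_PiE)
      also have "\<dots> \<le> (\<Prod>i<s. W)"
      proof (rule prod_mono)
        fix i assume "i \<in> {..<s}"
        then show "0 \<le> card (good_paths L' (l i) u (X i)) \<and> card (good_paths L' (l i) u (X i)) \<le> W"
          using card_good_paths[of L' "l i" u "X i"] path_bound_mono[of "l i" k L'] less.prems[of i]
          by (auto simp: W_def)
      qed
      finally show ?thesis by simp
    qed
    have cF: "card (F w) \<le> M * W" if w0: "w \<in> {..<s} \<times> {..<k} \<times> S" for w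
    proof -
      obtain i j u where w: "w = (i, j, u)" "i < s" using w0 by auto
      show ?thesis
      proof (cases "Suc j < l i")
        case j: True
        let ?f = "\<lambda>(y, g). ((y, g(i := take (Suc j) (g i))), drop (Suc j) (g i))"
        let ?l = "l(i := Suc j)" and ?X = "X(i := u)"
        have sum: "(\<Sum>i<s. ?l i) < (\<Sum>i<s. l i)"
          using j w by (intro sum_strict_mono_ex1) auto
        have "card (F w) \<le> card (good_spiders L' L ?l ?X \<times> good_paths L' (l i - Suc j) u (X i))"
        proof (rule card_inj_on_le[of ?f])
          show "inj_on ?f (F w)"
          proof (rule inj_onI)
            fix a b assume ab: "a \<in> F w" "b \<in> F w" "?f a = ?f b"
            obtain y g y' g' where yg: "a = (y, g)" "b = (y', g')" by (cases a, cases b)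
            have eq: "y = y'" "g(i := take (Suc j) (g i)) = g'(i := take (Suc j) (g' i))"
              "drop (Suc j) (g i) = drop (Suc j) (g' i)"
              using ab(3) by (auto simp: yg)
            have "take (Suc j) (g i) = take (Suc j) (g' i)"
              using fun_cong[OF eq(2), of i] by simp
            then have "g i = g' i" using eq(3) by (metis append_take_drop_id)
            moreover have "g h = g' h" if "h \<noteq> i" for h
              using fun_cong[OF eq(2), of h] that by simp
            ultimately have "g = g'" by (metis ext)
            then show "a = b" using eq by (simp add: yg)
          qed
          show "?f ` F w \<subseteq> good_spiders L' L ?l ?X \<times> good_paths L' (l i - Suc j) u (X i)"
          proof
            fix r assume "r \<in> ?f ` F w"
            then obtain y g where r: "r = ?f (y, g)" and yg: "(y, g) \<in> good_spiders L' L l X" "g i ! j = u"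
              by (auto simp: F_def w)
            have sp: "is_spider l y g" "\<forall>h<s. last (y # g h) = X h" "\<forall>h<s. good_path L' y (g h)"
              and nr: "\<And>l'. (\<forall>h<s. 1 \<le> l' h \<and> l' h \<le> l h) \<Longrightarrow> \<not> robust_spider L l' (\<lambda>h. (y # g h) ! l' h)"
              using yg by (auto simp: good_spiders_def)
            have pi: "is_path (l i) y (X i) (g i)" "length (g i) = l i"
              using sp w by (auto simp: is_spider_def is_path_def)
            note td = is_path_take_drop[OF pi(1), of "Suc j"]
            note gtd = good_path_take_drop[of L' y "g i" "Suc j"]
            define g' where "g' = g(i := take (Suc j) (g i))"
            have lasts: "last (y # g' h) = ?X h" if "h < s" for h
              using td that sp yg(2) j by (auto simp: g'_def is_path_def)
            have "is_spider ?l y g'"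
              unfolding is_spider_def
            proof (intro conjI allI impI)
              show "y \<in> V" using sp by (simp add: is_spider_def)
              show "g' \<in> extensional {..<s}"
                using sp w by (auto simp: is_spider_def g'_def extensional_def)
              show "is_path (?l h) y (last (y # g' h)) (g' h)" if "h < s" for h
                using lasts[OF that] td(1) j yg(2) sp that by (auto simp: g'_def is_spider_def)
              fix h h' assume h: "h < s" "h' < s" "h \<noteq> h'"
              have "set (g' h) \<subseteq> set (g h)" "set (g' h') \<subseteq> set (g h')"
                by (auto simp: g'_def dest: in_set_takeD)
              moreover have "set (g h) \<inter> set (g h') = {}"
                using sp h by (simp add: is_spider_def)
              ultimately show "set (g' h) \<inter> set (g' h') = {}"
                by blast
            qed
            moreover have "\<forall>h<s. good_path L' y (g' h)"
              using gtd sp w j pi by (auto simp: g'_def)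
            moreover have "\<not> robust_spider L l' (\<lambda>h. (y # g' h) ! l' h)"
              if l': "\<forall>h<s. 1 \<le> l' h \<and> l' h \<le> ?l h" for l'
            proof -
              \<comment> \<open>A truncation of the shortened spider is also a truncation of the
                original one, with the same ends.\<close>
              have "1 \<le> l' h \<and> l' h \<le> l h" if "h < s" for h
                using l'[rule_format, OF that] j by (cases "h = i") auto
              then have "\<not> robust_spider L l' (\<lambda>h. (y # g h) ! l' h)"
                using nr by blast
              moreover have "(y # g' h) ! l' h = (y # g h) ! l' h" if "h < s" for h
                using l'[rule_format, OF that] by (cases "l' h") (auto simp: g'_def split: if_splits)
              ultimately show ?thesis
                using robust_spider_cong[of l' l' "\<lambda>h. (y # g' h) ! l' h" "\<lambda>h. (y # g h) ! l' h"] by simp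
            qed
            ultimately have "(y, g') \<in> good_spiders L' L ?l ?X"
              using lasts by (auto simp: good_spiders_def)
            moreover have "drop (Suc j) (g i) \<in> good_paths L' (l i - Suc j) u (X i)"
              using td gtd sp w j pi yg(2) by (auto simp: good_paths_def)
            ultimately show "r \<in> good_spiders L' L ?l ?X \<times> good_paths L' (l i - Suc j) u (X i)"
              by (simp add: r g'_def)
          qed
        qed (simp add: finite_good_paths finite_good_spiders)
        also have "\<dots> \<le> M * W"
          unfolding card_cartesian_product
        proof (rule mult_mono)
          have "card (good_spiders L' L ?l ?X) \<le> spider_bound L' L s k (\<Sum>i<s. ?l i)"
            using less.prems j w by (intro less.hyps[OF sum]) (auto, meson Suc_leI less_trans less_or_eq_imp_le order.trans)
          also have "\<dots> \<le> M"
            unfolding M_def using sum N by (intro spider_bound_mono) simp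
          finally show "card (good_spiders L' L ?l ?X) \<le> M" .
          show "card (good_paths L' (l i - Suc j) u (X i)) \<le> W"
            using card_good_paths[of L' "l i - Suc j" u "X i"] path_bound_mono[of "l i - Suc j" k L']
              less.prems[OF w(2)] unfolding W_def by linarith
        qed auto
        finally show ?thesis .
      qed (simp add: F_def w)
    qed
    have fin: "finite (\<Union>u\<in>S. A u)" "finite (\<Union>w\<in>{..<s} \<times> {..<k} \<times> S. F w)"
      using S by (auto simp: A_def F_def intro: finite_subset[OF _ finite_good_spiders])
    have "card (good_spiders L' L l X) \<le> card ((\<Union>u\<in>S. A u) \<union> (\<Union>w\<in>{..<s} \<times> {..<k} \<times> S. F w))"
      using fin sub by (intro card_mono) auto
    also have "\<dots> \<le> card (\<Union>u\<in>S. A u) + card (\<Union>w\<in>{..<s} \<times> {..<k} \<times> S. F w)"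
      by (rule card_Un_le)
    also have "\<dots> \<le> (\<Sum>u\<in>S. card (A u)) + (\<Sum>w\<in>{..<s} \<times> {..<k} \<times> S. card (F w))"
      using S by (intro add_mono card_UN_le) auto
    also have "\<dots> \<le> (\<Sum>u\<in>S. W ^ s) + (\<Sum>w\<in>{..<s} \<times> {..<k} \<times> S. M * W)"
      by (intro add_mono sum_mono cA cF)
    also have "\<dots> = card S * W ^ s + s * k * card S * (M * W)"
      by (simp add: card_cartesian_product)
    also have "\<dots> \<le> L * W ^ s + s * k * L * (M * W)"
      using S by (intro add_mono mult_mono) auto
    also have "\<dots> \<le> spider_bound L' L s k (\<Sum>i<s. l i)"
      unfolding N by (simp add: M_def W_def mult_ac)
    finally show ?thesis .
  qed simp
qed

end

section \<open>Dense robust paths force a robust leaf tuple\<close>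

section \<open>Robust paths\<close>

context bounded_graph
begin

lemma is_path_append:
  assumes "is_path a x z p" "is_path b z y q" "set (x # p) \<inter> set q = {}"
  shows "is_path (a + b) x y (p @ q)"
  using assms by (auto simp: is_path_def walk_from_append)

lemma is_path_rev:
  assumes "is_path m x y p"
  shows "is_path m y x (rev (butlast (x # p)))"
proof -
  have "y # rev (butlast (x # p)) = rev (x # p)"
    using assms append_butlast_last_id[of "x # p"]
    by (metis is_path_def list.distinct(1) rev_eq_Cons_iff rev_rev_ident)
  moreover have "walk_from adj y (rev (butlast (x # p)))"
    using assms walk_from_rev[of adj x p] adj_sym by (auto simp: is_path_def)
  ultimately show ?thesis
    using assms unfolding is_path_def by (metis distinct_rev last_rev length_butlast length_rev
        list.sel(1) list.size(4) diff_add_inverse2 list.distinct(1))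
qed

lemma robust_sym:
  assumes "robust L m x y" "m \<ge> 1"
  shows "robust L m y x"
  unfolding robust_def
proof (intro allI impI)
  fix S :: "'a set" assume "finite S" "card S \<le> L"
  then obtain p where p: "is_path m x y p" "set (butlast p) \<inter> S = {}"
    using assms by (auto simp: robust_def)
  obtain u r where "p = u # r"
    using p assms by (cases p) (auto simp: is_path_def)
  then have "set (butlast (rev (butlast (x # p)))) \<subseteq> set (butlast p)"
    by (simp add: butlast_append)
  then show "\<exists>p. is_path m y x p \<and> set (butlast p) \<inter> S = {}"
    using is_path_rev[OF p(1)] p(2) by blast
qed

lemma robust_adj: "adj x y \<Longrightarrow> robust L 1 x y"
  unfolding robust_def is_path_def using adj_irrefl by (intro allI impI exI[of _ "[y]"]) auto

lemma is_path_set: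
  assumes "is_path m x y p" "m \<ge> 1"
  shows "set p = insert y (set (butlast p))" "y \<notin> set (butlast p)" "x \<noteq> y" "x \<notin> set p"
proof -
  have "p \<noteq> []" using assms by (auto simp: is_path_def)
  then have "p = butlast p @ [y]" using assms append_butlast_last_id[of p] by (simp add: is_path_def)
  then obtain q where q: "p = q @ [y]" by blast
  then show "set p = insert y (set (butlast p))" "y \<notin> set (butlast p)" "x \<noteq> y" "x \<notin> set p"
    using assms by (auto simp: is_path_def)
qed

lemma is_path_in_V: "is_path m x y p \<Longrightarrow> m \<ge> 1 \<Longrightarrow> x \<in> V"
  by (cases p) (auto simp: is_path_def intro: adj_V)

lemma exists_outside:
  assumes "finite A" "finite B" "card A > card B"
  shows "\<exists>x\<in>A. x \<notin> B"
  using assms card_mono[of B A] by (meson leD subsetI)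

text \<open>A midpoint is taken from \<open>Z\<close> outside \<open>S\<close> and the two ends. The
  first half then avoids \<open>S\<close> and \<open>y\<close>, the second avoids \<open>S\<close>
  and the \<open>a + 1\<close> vertices of the first; this is what the surplus of \<open>L\<close>
  over \<open>L'\<close> pays for.\<close>

lemma robust_compose:
  assumes Z: "finite Z" "card Z > L' + 2" "\<And>z. z \<in> Z \<Longrightarrow> robust L a x z \<and> robust L b z y"
    and neq: "x \<noteq> y" and ab: "a \<ge> 1" "b \<ge> 1" and L: "L' + a + 2 \<le> L"
  shows "robust L' (a + b) x y"
  unfolding robust_def
proof (intro allI impI)
  fix S :: "'a set" assume S: "finite S" "card S \<le> L'"
  have "card (S \<union> {x, y}) \<le> card S + card {x, y}" by (rule card_Un_le)
  also have "\<dots> \<le> L' + 2" using S neq by simp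
  finally obtain z where z: "z \<in> Z" "z \<notin> S \<union> {x, y}"
    using exists_outside[of Z "S \<union> {x, y}"] Z S by auto
  have "card (insert y S) \<le> L"
    using S L by (simp add: card_insert_if)
  then obtain p where p: "is_path a x z p" "set (butlast p) \<inter> insert y S = {}"
    using Z(3)[OF z(1)] S unfolding robust_def by (metis finite_insert)
  have "card (S \<union> set (x # p)) \<le> card S + card (set (x # p))" by (rule card_Un_le)
  also have "card (set (x # p)) \<le> length (x # p)" by (rule card_length)
  also have "length (x # p) = a + 1" using p by (simp add: is_path_def)
  finally have "card (S \<union> set (x # p)) \<le> L" using S L by simp
  then obtain q where q: "is_path b z y q" "set (butlast q) \<inter> (S \<union> set (x # p)) = {}"
    using Z(3)[OF z(1)] S unfolding robust_def by (metis finite_Un List.finite_set)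
  note sp = is_path_set[OF p(1) ab(1)] and sq = is_path_set[OF q(1) ab(2)]
  have "y \<notin> set (x # p)"
    unfolding list.set sp(1) using p(2) z neq by blast
  then have "set (x # p) \<inter> set q = {}"
    unfolding sq(1) using q(2) by blast
  moreover have "q \<noteq> []" using q ab by (auto simp: is_path_def)
  then have "set (butlast (p @ q)) = set p \<union> set (butlast q)"
    by (simp add: butlast_append)
  moreover have "set p \<inter> S = {}"
    unfolding sp(1) using p(2) z by blast
  ultimately have "set (butlast (p @ q)) \<inter> S = {}"
    using q(2) by blast
  then show "\<exists>p. is_path (a + b) x y p \<and> set (butlast p) \<inter> S = {}"
    using is_path_append[OF p(1) q(1) \<open>set (x # p) \<inter> set q = {}\<close>] by blast
qed

text \<open>A centre is taken from \<open>Y\<close> outside \<open>S\<close> and the leaves, and the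
  legs are chosen greedily. The summands in the bound for \<open>L\<close> stand for
  \<open>S\<close>, the leaves, the centre and the inner vertices of the legs.\<close>

lemma robust_spider_from_pairs:
  assumes "k \<ge> 1" "s > 0" and Y: "finite Y" "card Y > L0 + s"
    and rob: "\<And>i y. i < s \<Longrightarrow> y \<in> Y \<Longrightarrow> robust L k (X i) y"
    and X: "inj_on X {..<s}" and L: "L \<ge> L0 + s + 1 + s * k"
  shows "robust_spider L0 (\<lambda>_. k) X"
  unfolding robust_spider_def
proof (intro allI impI)
  fix S :: "'a set" assume S: "finite S" "card S \<le> L0"
  have cX: "card (X ` {..<s}) \<le> s" using card_image_le[of "{..<s}" X] by simp
  have "card (S \<union> X ` {..<s}) \<le> L0 + s"
    using card_Un_le[of S "X ` {..<s}"] S cX by linarith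
  then obtain y where y: "y \<in> Y" "y \<notin> S \<union> X ` {..<s}"
    using exists_outside[of Y "S \<union> X ` {..<s}"] Y S by auto
  define T where "T = insert y (S \<union> X ` {..<s})"
  have T: "finite T" "card T + s * k \<le> L"
    using S L \<open>card (S \<union> X ` {..<s}) \<le> L0 + s\<close> y by (auto simp: T_def)
  have "\<exists>g. (\<forall>i<s. is_path k y (X i) (g i) \<and> set (butlast (g i)) \<inter> T = {}) \<and>
             (\<forall>i<s. \<forall>j<s. i \<noteq> j \<longrightarrow> set (butlast (g i)) \<inter> set (butlast (g j)) = {})"
  proof (rule greedy_disjoint[where B = L and c = k])
    fix i and U :: "'a set" assume "i < s" "finite U" "card U \<le> L"
    then show "\<exists>p. is_path k y (X i) p \<and> set (butlast p) \<inter> U = {}"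
      using robust_sym[OF rob[of i y]] assms(1) y by (auto simp: robust_def)
  next
    fix i p assume "i < s" "is_path k y (X i) p"
    then show "finite (set (butlast p)) \<and> card (set (butlast p)) \<le> k"
      using card_length[of "butlast p"] by (simp add: is_path_def)
  qed (use T in auto)
  then obtain g where g0: "\<forall>i<s. is_path k y (X i) (g i) \<and> set (butlast (g i)) \<inter> T = {}"
      "\<forall>i<s. \<forall>j<s. i \<noteq> j \<longrightarrow> set (butlast (g i)) \<inter> set (butlast (g j)) = {}"
    by (elim exE conjE)
  have g: "is_path k y (X i) (g i)" "set (butlast (g i)) \<inter> T = {}" if "i < s" for i
    using g0(1) that by simp_all
  define h where "h = restrict g {..<s}"
  have last: "last (y # g i) = X i" if "i < s" for i
    using g(1)[OF that] by (simp add: is_path_def)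
  have "y \<in> V" using is_path_in_V[OF g(1)[OF assms(2)]] assms(1) by simp
  moreover have "set (g i) \<inter> set (g j) = {}" if "i < s" "j < s" "i \<noteq> j" for i j
  proof -
    have "X i \<noteq> X j" using X that by (auto simp: inj_on_def)
    then show ?thesis
      unfolding is_path_set(1)[OF g(1)[OF that(1)] assms(1)] is_path_set(1)[OF g(1)[OF that(2)] assms(1)]
      using g(2)[OF that(1)] g(2)[OF that(2)] g0(2) that unfolding T_def by blast
  qed
  ultimately have "is_spider (\<lambda>_. k) y h"
    using g(1) last by (simp add: is_spider_def h_def del: last.simps)
  moreover have "set (butlast (h i)) \<inter> S = {}" if "i < s" for i
    using g(2)[OF that] that by (auto simp: T_def h_def)
  ultimately show "\<exists>y g. is_spider (\<lambda>_. k) y g \<and> (\<forall>i<s. last (y # g i) = X i) \<and> y \<notin> S \<and>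
              (\<forall>i<s. set (butlast (g i)) \<inter> S = {})"
    using last y by (intro exI[of _ y] exI[of _ h]) (auto simp: h_def)
qed

definition robust_paths :: "nat \<Rightarrow> nat \<Rightarrow> ('a \<times> 'a list) set" where
  "robust_paths L m = {(x, p). is_path m x (last (x # p)) p \<and> robust L m x (last (x # p))}"

lemma finite_robust_paths: "m \<ge> 1 \<Longrightarrow> finite (robust_paths L m)"
proof (rule finite_subset)
  show "m \<ge> 1 \<Longrightarrow> robust_paths L m \<subseteq> Sigma V (\<lambda>x. walks x m)"
    using is_path_in_V is_path_walks by (fastforce simp: robust_paths_def)
qed (auto simp: finite_V finite_walks)

text \<open>Robustness depends only on the two ends, so once the second vertex \<open>v\<close> is
  fixed, the first vertex and the continuation \<open>q\<close> can be recombined freely. The sum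
  counts the edges of a bipartite graph between \<open>nb v\<close> and the walks from
  \<open>v\<close>; some \<open>v\<close> does at least as well as the average.\<close>

lemma robust_paths_root:
  assumes V: "V \<noteq> {}" and m: "m \<ge> 2"
    and big: "real (card (robust_paths L m)) \<ge> \<epsilon> * real (card V) * D ^ m"
  shows "\<exists>v\<in>V. (\<Sum>q\<in>walks v (m - 1). real (card {x\<in>nb v. robust L m x (last (v # q))}))
            \<ge> \<epsilon> * D * D ^ (m - 1)"
proof -
  let ?A = "Sigma V (\<lambda>v. Sigma (walks v (m - 1)) (\<lambda>q. {x\<in>nb v. robust L m x (last (v # q))}))"
  let ?f = "\<lambda>(x, p). (hd p, tl p, x)"
  have "card (robust_paths L m) \<le> card ?A"
  proof (rule card_inj_on_le[of ?f])
    have ne: "p \<noteq> []" if "(x, p) \<in> robust_paths L m" for x p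
      using that m by (auto simp: robust_paths_def is_path_def)
    show "inj_on ?f (robust_paths L m)"
      using ne by (auto simp: inj_on_def intro: list.expand)
    show "?f ` robust_paths L m \<subseteq> ?A"
    proof
      fix z assume "z \<in> ?f ` robust_paths L m"
      then obtain a where a: "a \<in> robust_paths L m" "z = ?f a" by blast
      obtain x p where "a = (x, p)" by (cases a)
      with a have z: "z = ?f (x, p)" "(x, p) \<in> robust_paths L m" by auto
      then obtain v q where p: "p = v # q" using ne by (cases p) auto
      then show "z \<in> ?A"
        using z m adj_sym adj_V by (auto simp: robust_paths_def is_path_def walks_def nb_def)
    qed
    show "finite ?A"
      by (intro finite_SigmaI finite_V finite_walks) (simp add: finite_nb)
  qed
  also have "card ?A = (\<Sum>v\<in>V. \<Sum>q\<in>walks v (m - 1). card {x\<in>nb v. robust L m x (last (v # q))})"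
    by (simp add: card_SigmaI finite_V finite_walks finite_nb)
  finally have "real (card (robust_paths L m)) \<le>
      (\<Sum>v\<in>V. \<Sum>q\<in>walks v (m - 1). real (card {x\<in>nb v. robust L m x (last (v # q))}))"
    by (simp del: last.simps flip: of_nat_sum)
  then have "\<epsilon> * D ^ m * real (card V) \<le>
      (\<Sum>v\<in>V. \<Sum>q\<in>walks v (m - 1). real (card {x\<in>nb v. robust L m x (last (v # q))}))"
    using big by (simp add: mult_ac)
  from exists_large_fiber[OF finite_V V this] show ?thesis
    unfolding mult.assoc power_Suc[symmetric] using m by simp
qed

text \<open>Half of the density is spent on passing to continuations with at least \<epsilon> / 2 *
  D partners, and half of the rest on keeping the \<open>r\<close> chosen vertices distinct. Every
  member of \<open>Q\<close> is then tied to all the \<open>X i\<close> at once.\<close>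

lemma robust_paths_dense:
  assumes V: "V \<noteq> {}" and m: "m \<ge> 2" and e: "\<epsilon> > 0"
    and big: "real (card (robust_paths L m)) \<ge> \<epsilon> * real (card V) * D ^ m"
    and D: "\<epsilon> / 4 * D \<ge> real r"
  obtains v X Q where "inj_on X {..<r}" "X ` {..<r} \<subseteq> nb v" "Q \<subseteq> walks v (m - 1)"
    "\<And>q i. q \<in> Q \<Longrightarrow> i < r \<Longrightarrow> robust L m (X i) (last (v # q))"
    "real (card Q) \<ge> (\<epsilon> / 4) ^ r * (\<epsilon> / 2) * D ^ (m - 1)"
proof -
  from robust_paths_root[OF V m big] obtain v where
    v: "(\<Sum>q\<in>walks v (m - 1). real (card {x\<in>nb v. robust L m x (last (v # q))})) \<ge> \<epsilon> * D * D ^ (m - 1)"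
    by blast
  define Q0 where "Q0 = {q\<in>walks v (m - 1). real (card {x\<in>nb v. robust L m x (last (v # q))}) \<ge> \<epsilon> / 2 * D}"
  have le: "real (card {x\<in>nb v. robust L m x (last (v # q))}) \<le> D" for q
  proof -
    have "card {x\<in>nb v. robust L m x (last (v # q))} \<le> card (nb v)"
      by (intro card_mono finite_nb) auto
    with card_nb[of v] show ?thesis by linarith
  qed
  have Q0: "real (card Q0) \<ge> \<epsilon> / 2 * D ^ (m - 1)"
    unfolding Q0_def by (rule many_large_values[OF finite_walks le D_pos card_walks _ v]) (use e in simp)
  have "\<epsilon> / 2 * D ^ (m - 1) > 0" using e D_pos by simp
  then have "card Q0 > 0" using Q0 by linarith
  then have "Q0 \<noteq> {}" by auto
  moreover have "finite Q0" by (simp add: Q0_def finite_walks)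
  ultimately have "\<exists>X. inj_on X {..<r} \<and> X ` {..<r} \<subseteq> nb v \<and>
      real (card {q\<in>Q0. \<forall>i<r. robust L m (X i) (last (v # q))}) \<ge> (\<epsilon> / 4) ^ r * real (card Q0)"
    using e D D_pos
    by (intro common_neighbours[where a = D] finite_nb card_nb) (auto simp: Q0_def simp del: last.simps)
  then obtain X where X: "inj_on X {..<r}" "X ` {..<r} \<subseteq> nb v"
      "real (card {q\<in>Q0. \<forall>i<r. robust L m (X i) (last (v # q))}) \<ge> (\<epsilon> / 4) ^ r * real (card Q0)"
    by blast
  note X(3)
  moreover have "(\<epsilon> / 4) ^ r * (\<epsilon> / 2 * D ^ (m - 1)) \<le> (\<epsilon> / 4) ^ r * real (card Q0)"
    using Q0 e by (intro mult_left_mono) auto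
  ultimately have "(\<epsilon> / 4) ^ r * (\<epsilon> / 2) * D ^ (m - 1) \<le> real (card {q\<in>Q0. \<forall>i<r. robust L m (X i) (last (v # q))})"
    by (simp del: last.simps)
  with X(1,2) show thesis
    by (intro that[of X v "{q\<in>Q0. \<forall>i<r. robust L m (X i) (last (v # q))}"]) (auto simp: Q0_def simp del: last.simps)
qed

text \<open>At most \<open>D ^ (m - 1)\<close> walks of length \<open>m\<close> from
  \<open>v\<close> end in any given vertex.\<close>

lemma card_ends:
  assumes Q: "Q \<subseteq> walks v m" "m \<ge> 1" and big: "real (card Q) \<ge> c * D ^ m"
  shows "real (card (last ` Q)) \<ge> c * D"
proof -
  have "real (card Q) \<le> D ^ (m - 1) * real (card (last ` Q))"
  proof (rule card_le_fibers)
    fix u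
    have "{q\<in>Q. last q = u} \<subseteq> {q\<in>walks v m. q ! (m - 1) = u}"
    proof
      fix q assume q: "q \<in> {q\<in>Q. last q = u}"
      then have "length q = m" "q \<in> walks v m" using Q by (auto simp: walks_def)
      moreover from this have "q \<noteq> []" using Q(2) by auto
      ultimately show "q \<in> {q\<in>walks v m. q ! (m - 1) = u}"
        using q last_conv_nth[of q] by auto
    qed
    then have "card {q\<in>Q. last q = u} \<le> card {q\<in>walks v m. q ! (m - 1) = u}"
      by (intro card_mono) (auto simp: finite_walks)
    also have "real (card {q\<in>walks v m. q ! (m - 1) = u}) \<le> D ^ (m - 1)"
      using Q by (intro card_walks_through) simp
    finally show "real (card {q\<in>Q. last q = u}) \<le> D ^ (m - 1)" by simp
  qed (use Q in \<open>auto intro: finite_subset[OF _ finite_walks]\<close>)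
  with big have "c * D ^ m \<le> D ^ (m - 1) * real (card (last ` Q))" by linarith
  moreover have "D ^ m = D * D ^ (m - 1)" using Q by (cases m) auto
  ultimately have "D ^ (m - 1) * (c * D) \<le> D ^ (m - 1) * real (card (last ` Q))"
    by (simp add: mult_ac)
  then show ?thesis using D_pos by simp
qed

text \<open>The robust paths already have the length of the legs, so the ends of the continuations
  serve directly as centres for the leaves \<open>X i\<close>.\<close>

lemma robust_spider_of_paths_eq:
  assumes V: "V \<noteq> {}" and m: "m \<ge> 2" and s: "s > 0" and e: "\<epsilon> > 0"
    and big: "real (card (robust_paths L m)) \<ge> \<epsilon> * real (card V) * D ^ m"
    and L: "L \<ge> L0 + s + 1 + s * m"
    and D: "\<epsilon> / 4 * D \<ge> real s" "(\<epsilon> / 4) ^ s * (\<epsilon> / 2) * D > real (L0 + s)"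
  shows "\<exists>X. robust_spider L0 (\<lambda>_. m) X"
proof -
  obtain v X Q where X: "inj_on X {..<s}" and Q: "Q \<subseteq> walks v (m - 1)"
    and rob: "\<And>q i. q \<in> Q \<Longrightarrow> i < s \<Longrightarrow> robust L m (X i) (last (v # q))"
    and cQ: "real (card Q) \<ge> (\<epsilon> / 4) ^ s * (\<epsilon> / 2) * D ^ (m - 1)"
    using robust_paths_dense[OF V m e big D(1)] by metis
  have ne: "q \<noteq> []" if "q \<in> Q" for q using that Q m by (auto simp: walks_def)
  have "1 \<le> m - 1" using m by simp
  from card_ends[OF Q this cQ] have "real (card (last ` Q)) > real (L0 + s)"
    using D by linarith
  then have card: "card (last ` Q) > L0 + s" by linarith
  have "robust_spider L0 (\<lambda>_. m) X"
  proof (rule robust_spider_from_pairs[OF _ s _ card _ X L])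
    show "m \<ge> 1" using m by simp
    show "finite (last ` Q)" using finite_subset[OF Q finite_walks] by simp
    fix i y assume i: "i < s" and "y \<in> last ` Q"
    then obtain q where "q \<in> Q" "y = last q" by blast
    then show "robust L m (X i) y" using rob[of q i] ne[of q] i by simp
  qed
  then show ?thesis by blast
qed

text \<open>Any two of the \<open>X i\<close> share many partners that are robust for length 2,
  hence form a robust pair for length 4 themselves. So the \<open>X i\<close> play both parts:
  \<open>s\<close> of them are leaves, and the other \<open>L0 + s + 1\<close> are candidates for
  the centre.\<close>

lemma robust_spider_of_paths_4_2:
  assumes V: "V \<noteq> {}" and s: "s > 0" and e: "\<epsilon> > 0"
    and big: "real (card (robust_paths L 2)) \<ge> \<epsilon> * real (card V) * D ^ 2"
    and r: "r = s + (L0 + s + 1)" and L': "L' = L0 + s + 1 + s * 4" and L: "L \<ge> L' + 4"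
    and D: "\<epsilon> / 4 * D \<ge> real r" "(\<epsilon> / 4) ^ r * (\<epsilon> / 2) * D > real (L' + 2)"
  shows "\<exists>X. robust_spider L0 (\<lambda>_. 4) X"
proof -
  have "(2::nat) \<ge> 2" by simp
  from robust_paths_dense[OF V this e big D(1)]
  obtain v X Q where X: "inj_on X {..<r}" and Q: "Q \<subseteq> walks v (2 - 1)"
    and rob: "\<And>q i. q \<in> Q \<Longrightarrow> i < r \<Longrightarrow> robust L 2 (X i) (last (v # q))"
    and cQ: "real (card Q) \<ge> (\<epsilon> / 4) ^ r * (\<epsilon> / 2) * D ^ (2 - 1)"
    by metis
  have ne: "q \<noteq> []" if "q \<in> Q" for q using that Q by (auto simp: walks_def)
  have cZ: "card (last ` Q) > L' + 2"
    using card_ends[OF Q _ cQ] D by simp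
  have "robust L' 4 (X i) (X j)" if "i < r" "j < r" "i \<noteq> j" for i j
  proof -
    have "robust L' (2 + 2) (X i) (X j)"
    proof (rule robust_compose[OF _ cZ])
      show "finite (last ` Q)" using Q finite_walks finite_subset by blast
      show "X i \<noteq> X j" using X that by (auto simp: inj_on_def)
      fix z assume "z \<in> last ` Q"
      then have "robust L 2 (X i) z" "robust L 2 (X j) z" using rob ne that by auto
      then show "robust L 2 (X i) z \<and> robust L 2 z (X j)" using robust_sym by auto
    qed (use L in auto)
    then show ?thesis by simp
  qed
  moreover have "card (X ` {s..<r}) = L0 + s + 1"
  proof -
    have "inj_on X {s..<r}" by (rule inj_on_subset[OF X]) auto
    then show ?thesis using r by (simp add: card_image)
  qed
  moreover have "inj_on X {..<s}" by (rule inj_on_subset[OF X]) (use r in auto)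
  ultimately have "robust_spider L0 (\<lambda>_. 4) X"
  proof (intro robust_spider_from_pairs[where Y = "X ` {s..<r}" and L = L'])
    fix i y assume i: "i < s" and "y \<in> X ` {s..<r}"
    then obtain j where "j \<in> {s..<r}" "y = X j" by blast
    then show "robust L' 4 (X i) y"
      using i \<open>\<And>i j. i < r \<Longrightarrow> j < r \<Longrightarrow> i \<noteq> j \<Longrightarrow> robust L' 4 (X i) (X j)\<close>[of i j] r by simp
  qed (use s L' in simp_all)
  then show ?thesis by blast
qed

text \<open>A continuation consists of two vertices \<open>w\<close> and \<open>z\<close>. A robust
  path of length 3 from \<open>X i\<close> to \<open>z\<close> is prolonged by the edge from
  \<open>z\<close> back to \<open>w\<close>, which becomes the centre. Averaging provides many
  \<open>w\<close> that have many such \<open>z\<close> each.\<close>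

lemma robust_spider_of_paths_4_3:
  assumes V: "V \<noteq> {}" and s: "s > 0" and e: "\<epsilon> > 0"
    and big: "real (card (robust_paths L 3)) \<ge> \<epsilon> * real (card V) * D ^ 3"
    and L': "L' = L0 + s + 1 + s * 4" and L: "L \<ge> L' + 5"
    and c: "c = (\<epsilon> / 4) ^ s * (\<epsilon> / 2)"
    and D: "\<epsilon> / 4 * D \<ge> real s" "c / 2 * D > real (L' + 2)" "c / 2 * D > real (L0 + s + s)"
  shows "\<exists>X. robust_spider L0 (\<lambda>_. 4) X"
proof -
  have "(3::nat) \<ge> 2" by simp
  from robust_paths_dense[OF V this e big D(1)]
  obtain v X Q where X: "inj_on X {..<s}" and Q: "Q \<subseteq> walks v (3 - 1)"
    and rob: "\<And>q i. q \<in> Q \<Longrightarrow> i < s \<Longrightarrow> robust L 3 (X i) (last (v # q))"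
    and cQ: "real (card Q) \<ge> (\<epsilon> / 4) ^ s * (\<epsilon> / 2) * D ^ (3 - 1)"
    by metis
  have c0: "c > 0" using e by (simp add: c)
  define Z where "Z w = {z\<in>nb w. [w, z] \<in> Q}" for w
  have finZ: "finite (Z w)" for w by (simp add: Z_def finite_nb)
  have leZ: "real (card (Z w)) \<le> D" for w
  proof -
    have "card (Z w) \<le> card (nb w)"
      by (intro card_mono finite_nb) (auto simp: Z_def)
    with card_nb[of w] show ?thesis by linarith
  qed
  have "card Q \<le> card (Sigma (nb v) Z)"
  proof (rule card_inj_on_le[of "\<lambda>q. (q ! 0, q ! 1)"])
    have *: "\<exists>w z. q = [w, z] \<and> adj v w \<and> adj w z" if "q \<in> Q" for q
      using that Q by (auto simp: walks_def length_Suc_conv numeral_2_eq_2)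
    show "inj_on (\<lambda>q. (q ! 0, q ! 1)) Q"
      by (rule inj_onI) (auto dest!: *)
    show "(\<lambda>q. (q ! 0, q ! 1)) ` Q \<subseteq> Sigma (nb v) Z"
      using * by (fastforce simp: Z_def nb_def)
  qed (auto simp: finite_nb finZ)
  also have "\<dots> = (\<Sum>w\<in>nb v. card (Z w))"
    by (simp add: card_SigmaI finite_nb finZ)
  finally have "c * D * D \<le> (\<Sum>w\<in>nb v. real (card (Z w)))"
    using cQ by (simp add: c power2_eq_square flip: of_nat_sum)
  then have "c / 2 * D \<le> real (card {w\<in>nb v. real (card (Z w)) \<ge> c / 2 * D})"
    using c0 by (intro many_large_values[OF finite_nb leZ D_pos card_nb]) auto
  \<comment> \<open>A centre must differ from the leaves; this accounts for the second
    \<open>s\<close> in the last bound on \<open>c / 2 * D\<close>.\<close>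
  moreover define Y where "Y = {w\<in>nb v. real (card (Z w)) \<ge> c / 2 * D} - X ` {..<s}"
  moreover have "card {w\<in>nb v. real (card (Z w)) \<ge> c / 2 * D} - card (X ` {..<s}) \<le> card Y"
    unfolding Y_def by (rule diff_card_le_card_Diff) simp
  moreover have "card (X ` {..<s}) \<le> s" using card_image_le[of "{..<s}" X] by simp
  ultimately have cY: "card Y > L0 + s" using D(3) by linarith
  have "robust_spider L0 (\<lambda>_. 4) X"
  proof (rule robust_spider_from_pairs[where Y = Y and L = L'])
    fix i w assume i: "i < s" and w: "w \<in> Y"
    have "robust L' (3 + 1) (X i) w"
    proof (rule robust_compose[OF finZ[of w]])
      have "real (L' + 2) < real (card (Z w))"
        using w D(2) by (auto simp: Y_def)
      then show "L' + 2 < card (Z w)" by linarith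
      show "X i \<noteq> w" using i w by (auto simp: Y_def)
      fix z assume "z \<in> Z w"
      then show "robust L 3 (X i) z \<and> robust L 1 z w"
        using rob[of "[w, z]" i] i by (auto simp: Z_def nb_def intro: robust_adj[unfolded One_nat_def] adj_sym)
    qed (use L in auto)
    then show "robust L' 4 (X i) w" by simp
  qed (use s X L' cY in \<open>auto simp: Y_def finite_nb\<close>)
  then show ?thesis by blast
qed


text \<open>The inner vertex of a path of length 2 is a common neighbour of its ends; if there were
  at most \<open>L\<close> of these, they could form the set to be avoided.\<close>

lemma robust_2_codegree:
  assumes "robust L 2 x z"
  shows "card (nb x \<inter> nb z) > L"
proof (rule ccontr)
  assume "\<not> ?thesis"
  then have "card (nb x \<inter> nb z) \<le> L" by simp
  then obtain p where p: "is_path 2 x z p" "set (butlast p) \<inter> (nb x \<inter> nb z) = {}"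
    using assms finite_nb unfolding robust_def by (metis finite_Int)
  then obtain w where "p = [w, z]"
    by (auto simp: is_path_def numeral_2_eq_2 length_Suc_conv)
  with p adj_sym show False
    by (auto simp: is_path_def nb_def)
qed

text \<open>Here \<open>z\<close> must be joined by an edge to the other branch vertex, and a priori only \<open>v\<close> is
  adjacent to many of the \<open>z\<close>. Counting the 4-cycles through \<open>v\<close> gives many further such vertices
  \<open>y\<close>, because robust pairs have codegree larger than \<open>L\<close>.\<close>

lemma robust_spider_of_paths_3_2:
  assumes V: "V \<noteq> {}" and s: "s > 0" and e: "\<epsilon> > 0"
    and big: "real (card (robust_paths L 2)) \<ge> \<epsilon> * real (card V) * D ^ 2"
    and L': "L' = L0 + s + 1 + s * 3" and L: "L \<ge> L' + 4"
    and f: "\<epsilon> / 4 * f \<ge> real (L' + 3)"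
    and Lf: "(\<epsilon> / 8) ^ s * (real L * \<epsilon>\<^sup>2 / 4 - f) > real (L0 + s + s)" "real L * \<epsilon>\<^sup>2 / 4 > f"
    and D: "\<epsilon> / 8 * D \<ge> real s"
  shows "\<exists>X. robust_spider L0 (\<lambda>_. 3) X"
proof -
  have f0: "f > 0"
  proof (rule ccontr)
    assume "\<not> f > 0"
    then have "\<epsilon> / 4 * f \<le> 0" using e by (simp add: mult_nonneg_nonpos)
    with f show False by simp
  qed
  have "(2::nat) \<ge> 2" by simp
  from robust_paths_root[OF V this big] obtain v where
    v: "(\<Sum>q\<in>walks v (2 - 1). real (card {x\<in>nb v. robust L 2 x (last (v # q))})) \<ge> \<epsilon> * D * D ^ (2 - 1)"
    by blast
  have w1: "walks v (2 - 1) = (\<lambda>z. [z]) ` nb v"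
    by (auto simp: walks_Suc walks_0)
  define deg where "deg z = real (card {x\<in>nb v. robust L 2 x z})" for z
  have "(\<Sum>z\<in>nb v. deg z) \<ge> \<epsilon> * D * D"
    using v unfolding w1 by (subst (asm) sum.reindex) (auto simp: inj_on_def deg_def)
  moreover have deg_le: "deg z \<le> D" for z
  proof -
    have "card {x\<in>nb v. robust L 2 x z} \<le> card (nb v)"
      by (intro card_mono finite_nb) auto
    with card_nb[of v] show ?thesis by (simp add: deg_def)
  qed
  ultimately have cA: "real (card {z\<in>nb v. deg z \<ge> \<epsilon> / 2 * D}) \<ge> \<epsilon> / 2 * D"
    using e by (intro many_large_values[OF finite_nb _ D_pos card_nb]) auto
  define A where "A = {z\<in>nb v. deg z \<ge> \<epsilon> / 2 * D}"
  have finA: "finite A" by (simp add: A_def finite_nb)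
  define N where "N y = nb y \<inter> nb v" for y
  define B where "B y = nb y \<inter> A" for y
  have finN: "finite (N y)" and finB: "finite (B y)" for y
    by (auto simp: N_def B_def finite_nb)
  have cN: "real (card (N y)) \<le> D" and cB: "real (card (B y)) \<le> D" for y
    using card_mono[OF finite_nb[of y], of "N y"] card_mono[OF finite_nb[of y], of "B y"] card_nb[of y]
    by (auto simp: N_def B_def)
  define E where "E = Sigma A (\<lambda>z. {x\<in>nb v. robust L 2 x z})"
  have finE: "finite E" by (simp add: E_def finA finite_nb)
  have "(\<epsilon> / 2 * D) * (\<epsilon> / 2 * D) \<le> real (card A) * (\<epsilon> / 2 * D)"
    using cA e D_pos unfolding A_def by (intro mult_right_mono) auto
  also have "\<dots> = (\<Sum>z\<in>A. \<epsilon> / 2 * D)" by simp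
  also have "\<dots> \<le> (\<Sum>z\<in>A. deg z)" by (intro sum_mono) (auto simp: A_def)
  also have "\<dots> = real (card E)"
    by (simp add: E_def deg_def card_SigmaI finA finite_nb)
  finally have cE: "\<epsilon>\<^sup>2 / 4 * D\<^sup>2 \<le> real (card E)"
    by (simp add: power2_eq_square mult_ac)
  \<comment> \<open>Count pairs of an element (z, x) of \<open>E\<close> and a vertex
    \<open>y\<close> adjacent to both \<open>x\<close> and \<open>z\<close>. Each element of
    \<open>E\<close> contributes more than \<open>L\<close>. A vertex \<open>y\<close> with at most
    \<open>f\<close> neighbours in \<open>A\<close> is charged \<open>f\<close> for each of its
    neighbours in \<open>nb v\<close>, any other vertex is charged \<open>D\<^sup>2\<close>.\<close>
  have "real L * (\<epsilon>\<^sup>2 / 4 * D\<^sup>2) \<le> real L * real (card E)"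
    using cE by (intro mult_left_mono) auto
  also have "\<dots> = (\<Sum>e\<in>E. real L)" by simp
  also have "\<dots> \<le> (\<Sum>e\<in>E. real (card {y\<in>V. fst e \<in> nb y \<and> snd e \<in> nb y}))"
  proof (rule sum_mono)
    fix e assume "e \<in> E"
    then have "card (nb (snd e) \<inter> nb (fst e)) > L"
      by (intro robust_2_codegree) (auto simp: E_def)
    also have "nb (snd e) \<inter> nb (fst e) = {y\<in>V. fst e \<in> nb y \<and> snd e \<in> nb y}"
      using adj_sym adj_V by (auto simp: nb_def)
    finally show "real L \<le> real (card {y\<in>V. fst e \<in> nb y \<and> snd e \<in> nb y})" by simp
  qed
  also have "\<dots> = (\<Sum>y\<in>V. real (card {e\<in>E. fst e \<in> nb y \<and> snd e \<in> nb y}))"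
    by (rule double_count[OF finite_V finE])
  also have "\<dots> \<le> (\<Sum>y\<in>V. real (card (N y)) * f + D\<^sup>2 * of_bool (real (card (B y)) > f))"
  proof (rule sum_mono)
    fix y
    have "card {e\<in>E. fst e \<in> nb y \<and> snd e \<in> nb y} \<le> card (B y \<times> N y)"
      by (rule card_mono[OF finite_cartesian_product[OF finB finN]]) (auto simp: E_def B_def N_def)
    also have "real (card (B y \<times> N y)) = real (card (N y)) * real (card (B y))"
      by (simp add: card_cartesian_product)
    also have "\<dots> \<le> real (card (N y)) * f + D\<^sup>2 * of_bool (real (card (B y)) > f)"
    proof (cases "real (card (B y)) > f")
      case True
      have "real (card (N y)) * real (card (B y)) \<le> D * D"
        using cN[of y] cB[of y] D_nonneg by (intro mult_mono) auto
      then show ?thesis using True f0 by (simp add: power2_eq_square add_increasing)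
    qed (simp add: mult_left_mono)
    finally show "real (card {e\<in>E. fst e \<in> nb y \<and> snd e \<in> nb y})
        \<le> real (card (N y)) * f + D\<^sup>2 * of_bool (real (card (B y)) > f)" by simp
  qed
  also have "\<dots> = (\<Sum>y\<in>V. real (card (N y))) * f + D\<^sup>2 * real (card {y\<in>V. real (card (B y)) > f})"
    unfolding sum.distrib sum_distrib_left[symmetric] sum_distrib_right[symmetric]
    by (simp add: real_card_Collect_eq_sum finite_V)
  \<comment> \<open>These are the walks of length 2 from \<open>v\<close>, grouped by their last
    vertex.\<close>
  also have "(\<Sum>y\<in>V. real (card (N y))) \<le> D\<^sup>2"
  proof -
    have "(\<Sum>y\<in>V. real (card (N y))) = (\<Sum>y\<in>V. real (card {w\<in>nb v. w \<in> nb y}))"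
      by (simp add: N_def Int_def conj_commute)
    also have "\<dots> = (\<Sum>w\<in>nb v. real (card {y\<in>V. w \<in> nb y}))"
      by (rule double_count[OF finite_nb finite_V])
    also have "\<dots> \<le> (\<Sum>w\<in>nb v. D)"
    proof (rule sum_mono)
      fix w
      have "{y\<in>V. w \<in> nb y} = nb w" using adj_sym adj_V by (auto simp: nb_def)
      then show "real (card {y\<in>V. w \<in> nb y}) \<le> D" using card_nb by simp
    qed
    also have "\<dots> \<le> D * D" using card_nb D_nonneg by (simp add: mult_right_mono)
    finally show ?thesis by (simp add: power2_eq_square)
  qed
  also have "D\<^sup>2 * f = f * D\<^sup>2" by simp
  finally have main: "real L * (\<epsilon>\<^sup>2 / 4 * D\<^sup>2) \<le> f * D\<^sup>2 + D\<^sup>2 * real (card {y\<in>V. real (card (B y)) > f})"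
    using f0 by simp
  define Y0 where "Y0 = {y\<in>V. real (card (B y)) > f}"
  have finY0: "finite Y0" by (simp add: Y0_def finite_V)
  have "D\<^sup>2 * (real L * \<epsilon>\<^sup>2 / 4 - f) \<le> D\<^sup>2 * real (card Y0)"
    using main by (simp add: Y0_def algebra_simps)
  \<comment> \<open>This bound does not grow with \<open>D\<close>; it is the tolerance
    \<open>L\<close> that makes it as large as desired.\<close>
  then have cY0: "real L * \<epsilon>\<^sup>2 / 4 - f \<le> real (card Y0)"
    using D_pos by simp
  then have Y0ne: "Y0 \<noteq> {}" using Lf(2) by auto
  \<comment> \<open>\<open>R x y\<close> provides enough midpoints \<open>z\<close> for composing
    robust pairs \<open>x\<close>, \<open>z\<close> for length 2 with edges from \<open>z\<close> to
    \<open>y\<close>.\<close>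
  define R where "R x y \<longleftrightarrow> real (card {z\<in>B y. robust L 2 x z}) \<ge> \<epsilon> / 4 * f" for x y
  have deg_R: "real (card {x\<in>nb v. R x y}) \<ge> \<epsilon> / 8 * D + real s" if y: "y \<in> Y0" for y
  proof -
    have By: "real (card (B y)) > f" using y by (simp add: Y0_def)
    have "\<epsilon> / 2 * real (card (B y)) * D = (\<Sum>z\<in>B y. \<epsilon> / 2 * D)" by simp
    also have "\<dots> \<le> (\<Sum>z\<in>B y. deg z)" by (intro sum_mono) (auto simp: B_def A_def)
    also have "\<dots> = (\<Sum>x\<in>nb v. real (card {z\<in>B y. robust L 2 x z}))"
      unfolding deg_def by (rule double_count[OF finite_nb finB])
    finally have sum: "\<epsilon> / 2 * real (card (B y)) * D \<le> (\<Sum>x\<in>nb v. real (card {z\<in>B y. robust L 2 x z}))" .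
    have le: "real (card {z\<in>B y. robust L 2 x z}) \<le> real (card (B y))" for x
      using card_mono[OF finB[of y], of "{z\<in>B y. robust L 2 x z}"] by simp
    have "\<epsilon> / 2 / 2 * D \<le> real (card {x\<in>nb v. real (card {z\<in>B y. robust L 2 x z}) \<ge> \<epsilon> / 2 / 2 * real (card (B y))})"
      using By f0 e sum by (intro many_large_values[OF finite_nb le _ card_nb]) auto
    also have "\<dots> \<le> real (card {x\<in>nb v. R x y})"
    proof -
      have "\<epsilon> / 4 * f \<le> \<epsilon> / 4 * real (card (B y))" using By e by (intro mult_left_mono) auto
      then have "{x\<in>nb v. real (card {z\<in>B y. robust L 2 x z}) \<ge> \<epsilon> / 2 / 2 * real (card (B y))} \<subseteq> {x\<in>nb v. R x y}"
        by (auto simp: R_def)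
      then show ?thesis by (simp add: card_mono finite_nb)
    qed
    finally show ?thesis using D by linarith
  qed
  have "\<exists>X. inj_on X {..<s} \<and> X ` {..<s} \<subseteq> nb v \<and>
           real (card {y\<in>Y0. \<forall>i<s. R (X i) y}) \<ge> (\<epsilon> / 8) ^ s * real (card Y0)"
    using e D_pos deg_R by (intro common_neighbours[where a = D] finite_nb finY0 Y0ne card_nb) auto
  then obtain X where X: "inj_on X {..<s}"
     "real (card {y\<in>Y0. \<forall>i<s. R (X i) y}) \<ge> (\<epsilon> / 8) ^ s * real (card Y0)" by blast
  have "(\<epsilon> / 8) ^ s * (real L * \<epsilon>\<^sup>2 / 4 - f) \<le> (\<epsilon> / 8) ^ s * real (card Y0)"
    using cY0 e by (intro mult_left_mono) auto
  with X(2) Lf have c1: "card {y\<in>Y0. \<forall>i<s. R (X i) y} > L0 + s + s" by linarith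
  define Y where "Y = {y\<in>Y0. \<forall>i<s. R (X i) y} - X ` {..<s}"
  have "card {y\<in>Y0. \<forall>i<s. R (X i) y} - card (X ` {..<s}) \<le> card Y"
    unfolding Y_def by (rule diff_card_le_card_Diff) simp
  moreover have "card (X ` {..<s}) \<le> s" using card_image_le[of "{..<s}" X] by simp
  ultimately have cY: "card Y > L0 + s" using c1 by linarith
  have "robust_spider L0 (\<lambda>_. 3) X"
  proof (rule robust_spider_from_pairs[where Y = Y and L = L'])
    fix i y assume i: "i < s" and y: "y \<in> Y"
    have "robust L' (2 + 1) (X i) y"
    proof (rule robust_compose[where Z = "{z\<in>B y. robust L 2 (X i) z}" and L = L])
      show "finite {z\<in>B y. robust L 2 (X i) z}" by (simp add: finB)
      have "R (X i) y" using i y by (simp add: Y_def)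
      then have "real (L' + 3) \<le> real (card {z\<in>B y. robust L 2 (X i) z})"
        using f by (simp add: R_def)
      then show "L' + 2 < card {z\<in>B y. robust L 2 (X i) z}" by linarith
      show "X i \<noteq> y" using i y by (auto simp: Y_def)
      fix z assume z: "z \<in> {z\<in>B y. robust L 2 (X i) z}"
      then have "adj z y" using adj_sym by (auto simp: B_def nb_def)
      then show "robust L 2 (X i) z \<and> robust L 1 z y"
        using z robust_adj by simp
    qed (use L in auto)
    then show "robust L' 3 (X i) y" by simp
  qed (use s X L' cY in \<open>auto simp: Y_def finY0\<close>)
  then show ?thesis by blast
qed

end

section \<open>Dense robust spiders force a robust leaf tuple\<close>

section \<open>Robust spiders\<close>

lemma exists_large_fiber_of_map:
  fixes b c :: real
  assumes fin: "finite A" "finite B" and f: "f ` A \<subseteq> B" and A: "A \<noteq> {}"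
    and c: "c \<ge> 0" "real (card B) \<le> b" "real (card A) \<ge> c * b"
  shows "\<exists>y\<in>B. real (card {x\<in>A. f x = y}) \<ge> c"
proof (rule exists_large_fiber[OF fin(2)])
  show "B \<noteq> {}" using A f by auto
  have "c * real (card B) \<le> c * b" using c by (intro mult_left_mono) auto
  also have "\<dots> \<le> real (card A)" using c by simp
  also have "\<dots> = (\<Sum>y\<in>B. real (card {x\<in>A. f x = y}))"
    using sum.group[OF fin f, of "\<lambda>_. 1::real"] by simp
  finally show "c * real (card B) \<le> (\<Sum>y\<in>B. real (card {x\<in>A. f x = y}))" .
qed

context bounded_graph
begin

text \<open>\<open>L'\<close> is the tolerance for segments of the legs, \<open>L\<close> the
  tolerance for the leaves.\<close>

definition robust_spiders :: "nat \<Rightarrow> nat \<Rightarrow> (nat \<Rightarrow> nat) \<Rightarrow> ('a \<times> (nat \<Rightarrow> 'a list)) set" where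
  "robust_spiders L' L l = {(y, g). is_spider l y g \<and> (\<forall>i<s. good_path L' y (g i)) \<and>
     robust_spider L l (\<lambda>i. last (y # g i))}"

lemma finite_robust_spiders: "finite (robust_spiders L' L l)"
  by (rule finite_subset[OF _ finite_spiders[of l]]) (auto simp: robust_spiders_def)

lemma is_spider_path: "is_spider l y g \<Longrightarrow> i < s \<Longrightarrow> is_path (l i) y (last (y # g i)) (g i)"
  unfolding is_spider_def by blast

lemma is_spider_disjoint:
  "is_spider l y g \<Longrightarrow> i < s \<Longrightarrow> j < s \<Longrightarrow> i \<noteq> j \<Longrightarrow> set (g i) \<inter> set (g j) = {}"
  unfolding is_spider_def by blast

lemma spider_two_legs:
  assumes sp: "is_spider l y g" and ij: "i < s" "j < s" "i \<noteq> j"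
  shows "is_path (l i + l j) (last (y # g i)) (last (y # g j)) (rev (butlast (y # g i)) @ g j)"
proof (rule is_path_append)
  show "is_path (l i) (last (y # g i)) y (rev (butlast (y # g i)))"
    by (rule is_path_rev[OF is_spider_path[OF sp ij(1)]])
  show "is_path (l j) y (last (y # g j)) (g j)"
    by (rule is_spider_path[OF sp ij(2)])
  have "set (last (y # g i) # rev (butlast (y # g i))) = set (butlast (y # g i) @ [last (y # g i)])"
    by auto
  also have "\<dots> = set (y # g i)"
    by (subst append_butlast_last_id) auto
  finally show "set (last (y # g i) # rev (butlast (y # g i))) \<inter> set (g j) = {}"
    using is_spider_disjoint[OF sp ij] is_spider_path[OF sp ij(2)] by (auto simp: is_path_def)
qed

text \<open>Legs \<open>i\<close> and \<open>j\<close> of a spider that avoids \<open>S\<close> join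
  to a path that avoids \<open>S\<close>; its inner vertices include the centre, which is why a
  robust spider must avoid \<open>S\<close> with its centre too.\<close>

lemma robust_of_robust_spider:
  assumes rob: "robust_spider L l X" and ij: "i < s" "j < s" "i \<noteq> j" and l: "l i \<ge> 1" "l j \<ge> 1"
  shows "robust L (l i + l j) (X i) (X j)"
  unfolding robust_def
proof (intro allI impI)
  fix S :: "'a set" assume "finite S" "card S \<le> L"
  then have "\<exists>y g. is_spider l y g \<and> (\<forall>i<s. last (y # g i) = X i) \<and> y \<notin> S \<and>
              (\<forall>i<s. set (butlast (g i)) \<inter> S = {})"
    using rob by (simp only: robust_spider_def simp_thms)
  then obtain y g where g: "is_spider l y g" "\<forall>i<s. last (y # g i) = X i" "y \<notin> S"
      "\<forall>i<s. set (butlast (g i)) \<inter> S = {}"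
    by (elim exE conjE)
  have ne: "g i \<noteq> []" "g j \<noteq> []"
    using is_spider_path[OF g(1) ij(1)] is_spider_path[OF g(1) ij(2)] l by (auto simp: is_path_def)
  have "is_path (l i + l j) (X i) (X j) (rev (butlast (y # g i)) @ g j)"
    using spider_two_legs[OF g(1) ij] g(2) ij by simp
  moreover have "set (butlast (rev (butlast (y # g i)) @ g j)) \<inter> S = {}"
    using ne g(3,4) ij by (auto simp: butlast_append)
  ultimately show "\<exists>p. is_path (l i + l j) (X i) (X j) p \<and> set (butlast p) \<inter> S = {}"
    by blast
qed

lemma card_PiE_walks:
  assumes "finite I"
  shows "real (card (PiE I (\<lambda>i. walks (x i) (d i)))) \<le> D ^ (\<Sum>i\<in>I. d i)"
proof -
  have "real (card (PiE I (\<lambda>i. walks (x i) (d i)))) = (\<Prod>i\<in>I. real (card (walks (x i) (d i))))"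
    using assms by (simp add: card_PiE)
  also have "\<dots> \<le> (\<Prod>i\<in>I. D ^ d i)"
    by (intro prod_mono conjI card_walks) auto
  finally show ?thesis by (simp add: power_sum)
qed

lemma finite_PiE_walks: "finite I \<Longrightarrow> finite (PiE I (\<lambda>i. walks (x i) (d i)))"
  by (intro finite_PiE finite_walks)

lemma card_PiE_walks_hitting:
  assumes "finite S" "i < s"
  shows "real (card {h\<in>PiE {..<s} (\<lambda>i. walks (x i) (d i)). set (h i) \<inter> S \<noteq> {}})
     \<le> real (d i) * real (card S) / D * D ^ (\<Sum>i<s. d i)"
proof -
  let ?W = "\<lambda>j. if j = i then {p\<in>walks (x i) (d i). set p \<inter> S \<noteq> {}} else walks (x j) (d j)"
  have fin: "finite (?W j)" for j by (simp add: finite_walks)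
  have "{h\<in>PiE {..<s} (\<lambda>i. walks (x i) (d i)). set (h i) \<inter> S \<noteq> {}} \<subseteq> PiE {..<s} ?W"
    using assms by (auto simp: PiE_def Pi_def)
  then have "card {h\<in>PiE {..<s} (\<lambda>i. walks (x i) (d i)). set (h i) \<inter> S \<noteq> {}} \<le> card (PiE {..<s} ?W)"
    by (intro card_mono finite_PiE fin) auto
  also have "real (card (PiE {..<s} ?W)) = (\<Prod>j<s. real (card (?W j)))"
    by (simp add: card_PiE)
  also have "\<dots> = real (card (?W i)) * (\<Prod>j\<in>{..<s} - {i}. real (card (?W j)))"
    using assms by (intro prod.remove) auto
  also have "\<dots> \<le> (real (d i) * real (card S) / D * D ^ d i) * (\<Prod>j\<in>{..<s} - {i}. D ^ d j)"
  proof (rule mult_mono)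
    show "real (card (?W i)) \<le> real (d i) * real (card S) / D * D ^ d i"
      using card_walks_hitting[OF assms(1), of "x i" "d i"] by simp
    show "(\<Prod>j\<in>{..<s} - {i}. real (card (?W j))) \<le> (\<Prod>j\<in>{..<s} - {i}. D ^ d j)"
      by (intro prod_mono) (auto simp: card_walks)
  qed (use D_nonneg in \<open>auto intro!: prod_nonneg\<close>)
  also have "\<dots> = real (d i) * real (card S) / D * (D ^ d i * (\<Prod>j\<in>{..<s} - {i}. D ^ d j))"
    by simp
  also have "D ^ d i * (\<Prod>j\<in>{..<s} - {i}. D ^ d j) = (\<Prod>j<s. D ^ d j)"
    using assms by (intro prod.remove[symmetric]) auto
  also have "\<dots> = D ^ (\<Sum>i<s. d i)" by (simp add: power_sum)
  finally show ?thesis by simp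
qed

text \<open>The path formed by legs \<open>i\<close> and \<open>j\<close> has robust ends and
  determines the centre and both legs; the other legs are walks from the centre. So few robust paths
  of length \<open>l i + l j\<close> mean few robust spiders.\<close>

lemma card_robust_spiders_le_paths:
  assumes ij: "i < s" "j < s" "i \<noteq> j" and l: "l i \<ge> 1" "l j \<ge> 1"
  shows "real (card (robust_spiders L' L l)) \<le>
     D ^ (\<Sum>h\<in>{..<s} - {i, j}. l h) * real (card (robust_paths L (l i + l j)))"
proof (rule card_le_fibers[where f = "\<lambda>(y, g). (last (y # g i), rev (butlast (y # g i)) @ g j)"])
  let ?f = "\<lambda>(y, g). (last (y # g i), rev (butlast (y # g i)) @ g j)"
  show "finite (robust_spiders L' L l)" by (rule finite_robust_spiders)
  show "finite (robust_paths L (l i + l j))" using l by (intro finite_robust_paths) simp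
  show "?f ` robust_spiders L' L l \<subseteq> robust_paths L (l i + l j)"
  proof
    fix z assume "z \<in> ?f ` robust_spiders L' L l"
    then obtain w where w: "w \<in> robust_spiders L' L l" "z = ?f w" by blast
    obtain y g where "w = (y, g)" by (cases w)
    with w have sp: "is_spider l y g" "robust_spider L l (\<lambda>i. last (y # g i))"
      and z: "z = (last (y # g i), rev (butlast (y # g i)) @ g j)"
      by (auto simp: robust_spiders_def)
    note p = spider_two_legs[OF sp(1) ij]
    then have "last (last (y # g i) # rev (butlast (y # g i)) @ g j) = last (y # g j)"
      unfolding is_path_def by simp
    then show "z \<in> robust_paths L (l i + l j)"
      using p robust_of_robust_spider[OF sp(2) ij l] by (simp only: z robust_paths_def mem_Collect_eq split simp_thms)
  qed
  fix b assume "b \<in> robust_paths L (l i + l j)"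
  obtain x p where b: "b = (x, p)" by (cases b)
  \<comment> \<open>\<open>w\<close> is leg \<open>i\<close> read outwards, including the centre as
    its head.\<close>
  define w where "w = rev (x # take (l i) p)"
  let ?F = "{a\<in>robust_spiders L' L l. ?f a = b}"
  have det: "y # g i = w \<and> g j = drop (l i) p" if "(y, g) \<in> ?F" for y g
  proof -
    have e: "x = last (y # g i)" "p = rev (butlast (y # g i)) @ g j" and sp: "is_spider l y g"
      using that by (auto simp: b robust_spiders_def)
    have len: "length (rev (butlast (y # g i))) = l i"
      using is_spider_path[OF sp ij(1)] by (cases "g i") (auto simp: is_path_def)
    have "w = rev (last (y # g i) # rev (butlast (y # g i)))"
      using len unfolding w_def e by simp
    also have "\<dots> = butlast (y # g i) @ [last (y # g i)]" by simp
    also have "\<dots> = y # g i" by (rule append_butlast_last_id) simp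
    finally show ?thesis using len e by simp
  qed
  have "card ?F \<le> card (PiE ({..<s} - {i, j}) (\<lambda>h. walks (hd w) (l h)))"
  proof (rule card_inj_on_le[of "\<lambda>(y, g). restrict g ({..<s} - {i, j})"])
    show "inj_on (\<lambda>(y, g). restrict g ({..<s} - {i, j})) ?F"
    proof (rule inj_onI)
      fix a c assume ac: "a \<in> ?F" "c \<in> ?F"
        and eq: "(\<lambda>(y, g). restrict g ({..<s} - {i, j})) a = (\<lambda>(y, g). restrict g ({..<s} - {i, j})) c"
      obtain y g y' g' where yg: "a = (y, g)" "c = (y', g')" by (cases a, cases c)
      have d: "y = y'" "g i = g' i" "g j = g' j"
        using det[of y g] det[of y' g'] ac yg by auto
      have ext: "g \<in> extensional {..<s}" "g' \<in> extensional {..<s}"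
        using ac yg by (auto simp: robust_spiders_def is_spider_def)
      have "g h = g' h" for h
      proof (cases "h \<in> {..<s} - {i, j}")
        case True
        then show ?thesis using fun_cong[OF eq, of h] yg by simp
      next
        case False
        then show ?thesis using d ext by (cases "h < s") (auto simp: extensional_def)
      qed
      then show "a = c" using d yg by auto
    qed
    show "(\<lambda>(y, g). restrict g ({..<s} - {i, j})) ` ?F \<subseteq> PiE ({..<s} - {i, j}) (\<lambda>h. walks (hd w) (l h))"
    proof
      fix r assume "r \<in> (\<lambda>(y, g). restrict g ({..<s} - {i, j})) ` ?F"
      then obtain a where a: "a \<in> ?F" "r = (\<lambda>(y, g). restrict g ({..<s} - {i, j})) a" by blast
      obtain y g where yg: "a = (y, g)" by (cases a)
      have "hd w = y" using det[of y g] a yg by (metis list.sel(1))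
      moreover have "is_spider l y g" using a yg by (auto simp: robust_spiders_def)
      ultimately show "r \<in> PiE ({..<s} - {i, j}) (\<lambda>h. walks (hd w) (l h))"
        using a yg is_path_walks[OF is_spider_path] by auto
    qed
    show "finite (PiE ({..<s} - {i, j}) (\<lambda>h. walks (hd w) (l h)))"
      by (rule finite_PiE_walks) simp
  qed
  also have "real (card (PiE ({..<s} - {i, j}) (\<lambda>h. walks (hd w) (l h)))) \<le> D ^ (\<Sum>h\<in>{..<s} - {i, j}. l h)"
    by (rule card_PiE_walks) simp
  finally show "real (card ?F) \<le> D ^ (\<Sum>h\<in>{..<s} - {i, j}. l h)" by simp
qed

text \<open>The numbers fit because a leg of length \<open>l i\<close> to an old leaf, followed by
  the remainder of length \<open>k - l i\<close> in reverse, has length \<open>k\<close> and ends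
  where the initial segment of length \<open>2 * l i - k\<close> ended. By \<open>pairs\<close> at
  most one initial segment has length 0, so at most one new leaf coincides with the old centre. A
  bounded set cannot meet all the varying remainders.\<close>

lemma robust_spider_of_long_legs:
  assumes s: "s > 0" and V: "V \<noteq> {}" and k: "k \<ge> 1" and e: "\<epsilon> > 0"
    and l: "\<And>i. i < s \<Longrightarrow> l i \<le> k \<and> k \<le> 2 * l i"
    and pairs: "\<And>i j. i < s \<Longrightarrow> j < s \<Longrightarrow> i \<noteq> j \<Longrightarrow> l i + l j > k"
    and big: "real (card (robust_spiders L' L l)) \<ge> \<epsilon> * real (card V) * D ^ (\<Sum>i<s. l i)"
    and L: "L \<ge> L0 + s * (k + 1)"
    and D: "\<epsilon> * D > real (s * k * L0)"
  shows "\<exists>X. robust_spider L0 (\<lambda>_. k) X"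
proof -
  define e' where "e' i = 2 * l i - k" for i
  define d where "d i = k - l i" for i
  have led: "l i = e' i + d i" "d i \<le> k" "l i + d i = k" if "i < s" for i
    using l[OF that] by (auto simp: e'_def d_def)
  let ?T = "Sigma V (\<lambda>y. PiE {..<s} (\<lambda>i. walks y (e' i)))"
  let ?f = "\<lambda>(y, g). (y, \<lambda>i\<in>{..<s}. take (e' i) (g i))"
  have finT: "finite ?T" by (intro finite_SigmaI finite_V finite_PiE_walks) auto
  have pos: "\<epsilon> * real (card V) * D ^ (\<Sum>i<s. l i) > 0"
    using e V D_pos finite_V by (simp add: card_gt_0_iff)
  have ne: "robust_spiders L' L l \<noteq> {}"
  proof
    assume "robust_spiders L' L l = {}"
    with big pos show False by simp
  qed
  have sub: "?f ` robust_spiders L' L l \<subseteq> ?T"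
  proof
    fix z assume "z \<in> ?f ` robust_spiders L' L l"
    then obtain w where w: "w \<in> robust_spiders L' L l" "z = ?f w" by blast
    obtain y g where yg: "w = (y, g)" by (cases w)
    have sp: "is_spider l y g" using w yg by (auto simp: robust_spiders_def)
    have "take (e' i) (g i) \<in> walks y (e' i)" if "i < s" for i
      using walks_take_drop(1)[OF is_path_walks[OF is_spider_path[OF sp that]]] led[OF that] by simp
    then show "z \<in> ?T" using w yg sp by (auto simp: is_spider_def)
  qed
  have cT: "real (card ?T) \<le> real (card V) * D ^ (\<Sum>i<s. e' i)"
  proof -
    have "real (card ?T) = (\<Sum>y\<in>V. real (card (PiE {..<s} (\<lambda>i. walks y (e' i)))))"
      by (subst card_SigmaI) (auto simp: finite_V intro!: finite_PiE_walks)
    also have "\<dots> \<le> (\<Sum>y\<in>V. D ^ (\<Sum>i<s. e' i))"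
      by (intro sum_mono card_PiE_walks) simp
    finally show ?thesis by simp
  qed
  have "(\<Sum>i<s. l i) = (\<Sum>i<s. e' i) + (\<Sum>i<s. d i)"
    using led by (simp add: sum.distrib[symmetric])
  then have big': "\<epsilon> * D ^ (\<Sum>i<s. d i) * (real (card V) * D ^ (\<Sum>i<s. e' i)) \<le> real (card (robust_spiders L' L l))"
    using big by (simp add: power_add mult_ac)
  \<comment> \<open>Some choice of the centre and the initial segments is shared by at least
    \<epsilon> * D ^ (\<Sum>i<s. d i) robust spiders.\<close>
  from exists_large_fiber_of_map[OF finite_robust_spiders finT sub ne _ cT big']
  obtain b where b: "b \<in> ?T" and fib: "real (card {a\<in>robust_spiders L' L l. ?f a = b}) \<ge> \<epsilon> * D ^ (\<Sum>i<s. d i)"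
    using e D_nonneg by auto
  obtain y g0 where yg0: "b = (y, g0)" by (cases b)
  define F where "F = {a\<in>robust_spiders L' L l. ?f a = b}"
  define X where "X i = last (y # g0 i)" for i
  have FD: "is_spider l y g \<and> robust_spider L l (\<lambda>i. last (y # g i)) \<and> y' = y \<and> (\<forall>i<s. take (e' i) (g i) = g0 i)"
    if "(y', g) \<in> F" for y' g
  proof -
    have "(\<lambda>i\<in>{..<s}. take (e' i) (g i)) = g0" "y' = y"
      using that by (auto simp: F_def yg0)
    moreover from this have "\<forall>i<s. take (e' i) (g i) = g0 i"
      by (metis lessThan_iff restrict_apply')
    ultimately show ?thesis using that by (auto simp: F_def robust_spiders_def)
  qed
  have parts: "(y # g i) ! e' i = X i \<and> is_path (d i) (X i) (last (y # g i)) (drop (e' i) (g i))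
       \<and> set (X i # drop (e' i) (g i)) \<subseteq> set (y # g i) \<and> (e' i > 0 \<longrightarrow> set (X i # drop (e' i) (g i)) \<subseteq> set (g i))"
    if g: "(y', g) \<in> F" and i: "i < s" for y' g i
  proof -
    have sp: "is_spider l y g" and t: "take (e' i) (g i) = g0 i" using FD[OF g] i by auto
    note p = is_spider_path[OF sp i]
    have len: "length (g i) = l i" using p by (simp add: is_path_def)
    have Xi: "(y # g i) ! e' i = X i"
      using last_Cons_take[of "e' i" "g i" y] led[OF i] len t by (simp add: X_def)
    have "set (X i # drop (e' i) (g i)) = set (drop (e' i) (y # g i))"
      using Cons_nth_drop[of "e' i" "g i" y] led[OF i] len Xi by simp
    moreover have "set (drop (e' i) (y # g i)) \<subseteq> set (y # g i)" by (rule set_drop_subset)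
    moreover have "set (drop (e' i) (y # g i)) \<subseteq> set (g i)" if "e' i > 0"
      using that set_drop_subset[of "e' i - 1" "g i"] by (cases "e' i") auto
    moreover have "is_path (d i) (X i) (last (y # g i)) (drop (e' i) (g i))"
      using is_path_take_drop(2)[OF p, of "e' i"] led[OF i] Xi by simp
    ultimately show ?thesis using Xi by simp
  qed
  have "robust_spider L0 (\<lambda>_. k) X"
    unfolding robust_spider_def
  proof (intro allI impI)
    fix S :: "'a set" assume S: "finite S" "card S \<le> L0"
    \<comment> \<open>At most a proportion s * k * L0 / D of \<open>D ^ (\<Sum>i<s. d i)\<close> is
      lost to remainders meeting \<open>S\<close>, and this is less than \<epsilon>.\<close>
    have "\<exists>g. (y, g) \<in> F \<and> (\<forall>i<s. set (drop (e' i) (g i)) \<inter> S = {})"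
    proof (rule ccontr)
      assume none: "\<not> ?thesis"
      let ?H = "\<lambda>i. {h\<in>PiE {..<s} (\<lambda>i. walks (X i) (d i)). set (h i) \<inter> S \<noteq> {}}"
      have finH: "finite (?H i)" for i
        by (rule finite_subset[OF _ finite_PiE_walks[of "{..<s}" X d]]) auto
      let ?r = "\<lambda>(y', g). \<lambda>i\<in>{..<s}. drop (e' i) (g i)"
      have "card F \<le> card (\<Union>i<s. ?H i)"
      proof (rule card_inj_on_le[of ?r])
        show "inj_on ?r F"
        proof (rule inj_onI)
          fix a c assume ac: "a \<in> F" "c \<in> F" and eq: "?r a = ?r c"
          obtain y1 g1 y2 g2 where yg: "a = (y1, g1)" "c = (y2, g2)" by (cases a, cases c)
          have "g1 i = g2 i" if "i < s" for i
          proof -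
            have "drop (e' i) (g1 i) = drop (e' i) (g2 i)"
              using fun_cong[OF eq, of i] that yg by simp
            moreover have "take (e' i) (g1 i) = take (e' i) (g2 i)"
              using FD[of y1 g1] FD[of y2 g2] ac yg that by simp
            ultimately show ?thesis by (metis append_take_drop_id)
          qed
          moreover have "g1 \<in> extensional {..<s}" "g2 \<in> extensional {..<s}"
            using FD[of y1 g1] FD[of y2 g2] ac yg by (auto simp: is_spider_def)
          ultimately have "g1 = g2" by (intro extensionalityI) auto
          then show "a = c" using FD[of y1 g1] FD[of y2 g2] ac yg by simp
        qed
        show "?r ` F \<subseteq> (\<Union>i<s. ?H i)"
        proof
          fix h assume "h \<in> ?r ` F"
          then obtain a where a: "a \<in> F" "h = ?r a" by blast
          obtain y' g where yg: "a = (y', g)" by (cases a)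
          have "(y, g) \<in> F" using FD[of y' g] a yg by simp
          then obtain i where "i < s" "set (drop (e' i) (g i)) \<inter> S \<noteq> {}" using none by blast
          moreover have "h \<in> PiE {..<s} (\<lambda>i. walks (X i) (d i))"
          proof -
            have "drop (e' i) (g i) \<in> walks (X i) (d i)" if "i < s" for i
              using is_path_walks parts[of y' g i] that a yg by blast
            then show ?thesis using a yg by simp
          qed
          ultimately show "h \<in> (\<Union>i<s. ?H i)" using a yg by auto
        qed
      qed (simp add: finH)
      also have "\<dots> \<le> (\<Sum>i<s. card (?H i))" by (rule card_UN_le) simp
      finally have "real (card F) \<le> (\<Sum>i<s. real (card (?H i)))"
        by (simp flip: of_nat_sum)
      also have "\<dots> \<le> (\<Sum>i<s. real k * real L0 / D * D ^ (\<Sum>i<s. d i))"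
      proof (rule sum_mono)
        fix i assume "i \<in> {..<s}"
        then have i: "i < s" by simp
        have "real (card (?H i)) \<le> real (d i) * real (card S) / D * D ^ (\<Sum>i<s. d i)"
          by (rule card_PiE_walks_hitting[OF S(1) i])
        also have "\<dots> \<le> real k * real L0 / D * D ^ (\<Sum>i<s. d i)"
          using led(2)[OF i] S D_pos by (intro mult_right_mono divide_right_mono mult_mono) auto
        finally show "real (card (?H i)) \<le> real k * real L0 / D * D ^ (\<Sum>i<s. d i)" .
      qed
      also have "\<dots> = real (s * k * L0) / D * D ^ (\<Sum>i<s. d i)" by simp
      also have "\<dots> < \<epsilon> * D ^ (\<Sum>i<s. d i)"
        using D D_pos by (intro mult_strict_right_mono) (auto simp: pos_divide_less_eq)
      finally show False using fib by (simp add: F_def)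
    qed
    then obtain g where gF: "(y, g) \<in> F" and gS: "\<forall>i<s. set (drop (e' i) (g i)) \<inter> S = {}" by blast
    define h where "h i = drop (e' i) (g i)" for i
    define z where "z i = last (y # g i)" for i
    define H where "H i = set (X i # h i)" for i
    have sp: "is_spider l y g" and rob: "robust_spider L l z"
      using FD[OF gF] by (auto simp: z_def[abs_def])
    have hp: "is_path (d i) (X i) (z i) (h i)" "H i \<subseteq> set (y # g i)" "e' i > 0 \<Longrightarrow> H i \<subseteq> set (g i)"
      if "i < s" for i
      using parts[OF gF that] by (auto simp: h_def z_def H_def)
    \<comment> \<open>\<open>H i\<close> can contain the centre \<open>y\<close> only if
      \<open>e' i = 0\<close>, which happens for at most one leg.\<close>
    have Hdisj: "H i \<inter> H j = {}" if ij: "i < s" "j < s" "i \<noteq> j" for i j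
    proof -
      have "y \<notin> set (g i)" "y \<notin> set (g j)"
        using is_spider_path[OF sp ij(1)] is_spider_path[OF sp ij(2)] by (auto simp: is_path_def)
      moreover have "set (g i) \<inter> set (g j) = {}" by (rule is_spider_disjoint[OF sp ij])
      moreover have "e' i > 0 \<or> e' j > 0"
        using pairs[OF ij] l[OF ij(1)] l[OF ij(2)] by (auto simp: e'_def)
      ultimately show ?thesis using hp[OF ij(1)] hp[OF ij(2)] by auto
    qed
    have cH: "card (H i) \<le> k + 1" if "i < s" for i
      using card_length[of "X i # h i"] hp(1)[OF that] led(2)[OF that] by (simp add: H_def is_path_def)
    \<comment> \<open>The new spider on the leaves \<open>z i\<close> avoids all remainders with its
      centre and its inner vertices; then each leg prolonged by its reversed remainder is a path,
      and these paths are disjoint.\<close>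
    define S' where "S' = S \<union> (\<Union>i<s. H i)"
    have "card (\<Union>i<s. H i) \<le> (\<Sum>i<s. card (H i))" by (rule card_UN_le) simp
    also have "\<dots> \<le> (\<Sum>i<s. k + 1)" by (intro sum_mono cH) simp
    finally have "card S' \<le> L"
      using card_Un_le[of S "\<Union>i<s. H i"] S L by (simp add: S'_def)
    moreover have "finite S'" using S by (simp add: S'_def H_def)
    ultimately have "\<exists>y g. is_spider l y g \<and> (\<forall>i<s. last (y # g i) = z i) \<and> y \<notin> S' \<and>
              (\<forall>i<s. set (butlast (g i)) \<inter> S' = {})"
      using rob by (simp only: robust_spider_def simp_thms)
    then obtain y1 g1 where g1: "is_spider l y1 g1" "\<forall>i<s. last (y1 # g1 i) = z i" "y1 \<notin> S'"
        "\<forall>i<s. set (butlast (g1 i)) \<inter> S' = {}"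
      by (elim exE conjE)
    define n where "n i = g1 i @ rev (butlast (X i # h i))" for i
    have l1: "l i \<ge> 1" if "i < s" for i using l[OF that] k by simp
    have g1p: "is_path (l i) y1 (z i) (g1 i)" if "i < s" for i
      using is_spider_path[OF g1(1) that] g1(2) that by simp
    have zH: "z i \<in> H i" if "i < s" for i
      using hp(1)[OF that] last_in_set[of "X i # h i"] by (simp only: is_path_def H_def) auto
    have bH: "set (butlast (X i # h i)) = H i - {z i}" if "i < s" for i
    proof -
      have d: "distinct (X i # h i)" "last (X i # h i) = z i" using hp(1)[OF that] by (auto simp: is_path_def)
      have e: "X i # h i = butlast (X i # h i) @ [z i]"
        using append_butlast_last_id[of "X i # h i"] d(2) by simp
      have "z i \<notin> set (butlast (X i # h i))"
        using d(1) e by (metis distinct_append distinct.simps(2) append.assoc not_distinct_conv_prefix)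
      moreover have "H i = set (butlast (X i # h i)) \<union> {z i}"
        unfolding H_def by (subst e) simp
      ultimately show ?thesis by blast
    qed
    have g1s: "set (g1 i) = insert (z i) (set (butlast (g1 i)))" if "i < s" for i
      by (rule is_path_set(1)[OF g1p[OF that] l1[OF that]])
    have np: "is_path k y1 (X i) (n i)" if i: "i < s" for i
    proof -
      have "is_path (l i + d i) y1 (X i) (n i)"
        unfolding n_def
      proof (rule is_path_append[OF g1p[OF i] is_path_rev[OF hp(1)[OF i]]])
        have "y1 \<notin> H i" "set (butlast (g1 i)) \<inter> H i = {}" using g1(3,4) i by (auto simp: S'_def)
        then show "set (y1 # g1 i) \<inter> set (rev (butlast (X i # h i))) = {}"
          unfolding set_rev bH[OF i] list.set(2) g1s[OF i] by blast
      qed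
      then show ?thesis using led[OF i] by simp
    qed
    have nsub: "set (n i) \<subseteq> set (butlast (g1 i)) \<union> H i" if "i < s" for i
      unfolding n_def set_append set_rev bH[OF that] g1s[OF that] using zH[OF that] by blast
    have ndisj: "set (n i) \<inter> set (n j) = {}" if ij: "i < s" "j < s" "i \<noteq> j" for i j
    proof -
      have "set (butlast (g1 i)) \<inter> H j = {}" "set (butlast (g1 j)) \<inter> H i = {}"
        using g1(4) ij unfolding S'_def by blast+
      moreover have "set (butlast (g1 i)) \<inter> set (butlast (g1 j)) = {}"
        using is_spider_disjoint[OF g1(1) ij] unfolding g1s[OF ij(1)] g1s[OF ij(2)] by blast
      ultimately show ?thesis using nsub[OF ij(1)] nsub[OF ij(2)] Hdisj[OF ij] by blast
    qed
    have navoid: "set (butlast (n i)) \<inter> S = {}" if i: "i < s" for i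
    proof -
      have "set (butlast (n i)) \<subseteq> set (n i) - {X i}"
        using is_path_set[OF np[OF i] k] by blast
      also have "\<dots> \<subseteq> set (butlast (g1 i)) \<union> set (h i)"
        using nsub[OF i] by (auto simp: H_def)
      finally show ?thesis
        using g1(4) gS i unfolding S'_def h_def by blast
    qed
    define n' where "n' = restrict n {..<s}"
    have last: "last (y1 # n i) = X i" if "i < s" for i
      using np[OF that] by (simp add: is_path_def)
    have "is_spider (\<lambda>_. k) y1 n'"
      using g1(1) np ndisj last by (simp add: is_spider_def n'_def del: last.simps)
    then show "\<exists>y g. is_spider (\<lambda>_. k) y g \<and> (\<forall>i<s. last (y # g i) = X i) \<and> y \<notin> S \<and>
              (\<forall>i<s. set (butlast (g i)) \<inter> S = {})"
      using last navoid g1(3) by (intro exI[of _ y1] exI[of _ n']) (simp add: n'_def S'_def del: last.simps)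
  qed
  then show ?thesis by blast
qed


section \<open>Levels of rich vertices and spiders with one leg of length 1\<close>

primrec rich :: "nat \<Rightarrow> 'a set \<Rightarrow> nat \<Rightarrow> 'a set" where
  "rich T U 0 = U"
| "rich T U (Suc j) = {w. card (nb w \<inter> rich T U j) \<ge> T}"

text \<open>From \<open>w\<close> one descends through the levels; at each level the
  \<open>T\<close> neighbours leave one outside the avoided set, which grows by one vertex per
  level. The list \<open>r\<close> runs in the opposite direction, from \<open>U\<close> to
  \<open>w\<close>, and \<open>w\<close> itself may lie in \<open>S\<close>.\<close>

lemma rich_path:
  assumes "w \<in> rich T U j" "finite S" "card S + j < T"
  shows "\<exists>u r. u \<in> U \<and> is_path j u w r \<and> (set (u # r) - {w}) \<inter> S = {}"
  using assms
proof (induction j arbitrary: w S)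
  case 0
  then show ?case by (intro exI[of _ w] exI[of _ "[]"]) (simp add: is_path_def)
next
  case (Suc j)
  have c: "card (insert w S) \<le> Suc (card S)" by (rule card_insert_le_m1) auto
  have "card (nb w \<inter> rich T U j) > card (insert w S)"
    using Suc.prems c by simp
  then obtain w1 where w1: "w1 \<in> nb w \<inter> rich T U j" "w1 \<notin> insert w S"
    using exists_outside[of "nb w \<inter> rich T U j" "insert w S"] finite_nb Suc.prems by blast
  have "card (insert w S) + j < T" using c Suc.prems by simp
  with Suc.IH[of w1 "insert w S"] w1 Suc.prems obtain u r where
    r: "u \<in> U" "is_path j u w1 r" "(set (u # r) - {w1}) \<inter> insert w S = {}"
    by auto
  have a: "adj w1 w" using w1 adj_sym by (auto simp: nb_def)
  then have "is_path 1 w1 w [w]" using adj_irrefl by (auto simp: is_path_def)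
  moreover have "w \<notin> set (u # r)" using r(3) w1(2) by blast
  ultimately have p: "is_path (j + 1) u w (r @ [w])"
    by (intro is_path_append[OF r(2)]) simp_all
  have "set (u # r @ [w]) - {w} \<subseteq> insert w1 (set (u # r) - {w1})"
    by auto
  then have "(set (u # r @ [w]) - {w}) \<inter> S = {}"
    using r(3) w1(2) by blast
  then show ?case using r(1) p unfolding Suc_eq_plus1 by blast
qed

text \<open>A path with \<open>k - 1\<close> edges leads from some \<open>u\<close> in
  \<open>U\<close> to \<open>w\<close>. The leaves with \<open>u\<close> at \<open>i0\<close> are
  robust, so a spider avoids this path with its centre and inner vertices, and its short leg
  continues along the path to a leg of length \<open>k\<close> ending in \<open>w\<close>.\<close>

lemma robust_spider_of_rich:
  assumes i0: "i0 < s" and k: "k \<ge> 2"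
    and U: "U = {u. robust_spider L ((\<lambda>_. k)(i0 := 1)) (x(i0 := u))}"
    and w: "w \<in> rich T U (k - 1)" "w \<notin> x ` ({..<s} - {i0})"
    and T: "T > L0 + s + k" and L: "L \<ge> L0 + k"
  shows "robust_spider L0 (\<lambda>_. k) (x(i0 := w))"
  unfolding robust_spider_def
proof (intro allI impI)
  fix S :: "'a set" assume S: "finite S" "card S \<le> L0"
  let ?x = "x ` ({..<s} - {i0})"
  have "card ?x \<le> card ({..<s} - {i0})" by (rule card_image_le) simp
  also have "\<dots> \<le> s" using card_mono[of "{..<s}" "{..<s} - {i0}"] by auto
  finally have "card (S \<union> ?x) + (k - 1) < T"
    using card_Un_le[of S ?x] S T by linarith
  with rich_path[OF w(1), of "S \<union> ?x"] S obtain u r where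
    r: "u \<in> U" "is_path (k - 1) u w r" "(set (u # r) - {w}) \<inter> (S \<union> ?x) = {}"
    by auto
  have lr: "length (u # r) = k" using r(2) k by (simp add: is_path_def)
  have "card (S \<union> set (u # r)) \<le> L"
    using card_Un_le[of S "set (u # r)"] card_length[of "u # r"] S L lr by linarith
  then have "\<exists>y g. is_spider ((\<lambda>_. k)(i0 := 1)) y g \<and> (\<forall>i<s. last (y # g i) = (x(i0 := u)) i) \<and>
      y \<notin> S \<union> set (u # r) \<and> (\<forall>i<s. set (butlast (g i)) \<inter> (S \<union> set (u # r)) = {})"
  proof -
    assume c: "card (S \<union> set (u # r)) \<le> L"
    have "robust_spider L ((\<lambda>_. k)(i0 := 1)) (x(i0 := u))" using r(1) by (simp add: U)
    moreover have "finite (S \<union> set (u # r))" using S by simp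
    ultimately show ?thesis using c unfolding robust_spider_def by (elim allE impE)
  qed
  then obtain y g where g: "is_spider ((\<lambda>_. k)(i0 := 1)) y g" "\<forall>i<s. last (y # g i) = (x(i0 := u)) i"
      "y \<notin> S \<union> set (u # r)" "\<forall>i<s. set (butlast (g i)) \<inter> (S \<union> set (u # r)) = {}"
    by (elim exE conjE)
  define h where "h = g(i0 := u # r)"
  have p0: "is_path 1 y u (g i0)" using is_spider_path[OF g(1) i0] g(2) i0 by simp
  have gi0: "g i0 = [u]"
  proof -
    have "length (g i0) = 1" using p0 by (simp add: is_path_def)
    then obtain a where "g i0 = [a]" by (auto simp: length_Suc_conv)
    then show ?thesis using p0 by (simp add: is_path_def)
  qed
  have "is_path (1 + (k - 1)) y w (g i0 @ r)"
  proof (rule is_path_append[OF p0 r(2)])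
    show "set (y # g i0) \<inter> set r = {}"
      using g(3) r(2) by (auto simp: gi0 is_path_def)
  qed
  then have ph0: "is_path k y w (h i0)" using k by (simp add: gi0 h_def)
  have ph: "is_path k y ((x(i0 := w)) i) (h i)" if "i < s" for i
  proof (cases "i = i0")
    case False
    then show ?thesis using is_spider_path[OF g(1) that] g(2) that by (simp add: h_def)
  qed (simp add: ph0)
  have dis0: "set (g i) \<inter> set (u # r) = {}" if "i < s" "i \<noteq> i0" for i
  proof -
    have "is_path k y (x i) (g i)" using ph[OF that(1)] that by (simp add: h_def)
    then have gi: "set (g i) = insert (x i) (set (butlast (g i)))"
      by (rule is_path_set(1)) (use k in simp)
    have "set (butlast (g i)) \<inter> (S \<union> set (u # r)) = {}"
      by (rule g(4)[rule_format, OF that(1)])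
    then have b: "set (butlast (g i)) \<inter> set (u # r) = {}"
      unfolding Int_Un_distrib by (rule conjunct2[OF Un_empty[THEN iffD1]])
    have "x i \<in> ?x" using that by simp
    then have "x i \<notin> set (u # r)" using r(3) w(2) by (metis DiffI IntI UnI2 empty_iff singletonD)
    then show ?thesis unfolding gi using b by (simp del: set_simps)
  qed
  have last: "last (y # h i) = (x(i0 := w)) i" if "i < s" for i
    using ph[OF that] by (simp add: is_path_def)
  have "is_spider (\<lambda>_. k) y h"
    unfolding is_spider_def
  proof (intro conjI allI impI)
    show "y \<in> V" using g(1) by (simp add: is_spider_def)
    show "h \<in> extensional {..<s}" using g(1) i0 by (auto simp: is_spider_def h_def extensional_def)
    show "is_path k y (last (y # h i)) (h i)" if "i < s" for i
      unfolding last[OF that] by (rule ph[OF that])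
    fix i j assume ij: "i < s" "j < s" "i \<noteq> j"
    consider "i = i0" | "j = i0" | "i \<noteq> i0" "j \<noteq> i0" by blast
    then show "set (h i) \<inter> set (h j) = {}"
    proof cases
      case 1
      then show ?thesis using dis0[OF ij(2)] ij by (auto simp: h_def)
    next
      case 2
      then show ?thesis using dis0[OF ij(1)] ij by (auto simp: h_def)
    next
      case 3
      then show ?thesis using is_spider_disjoint[OF g(1) ij] by (simp add: h_def)
    qed
  qed
  moreover have "set (butlast (h i)) \<inter> S = {}" if "i < s" for i
  proof (cases "i = i0")
    case True
    have k1: "k \<ge> 1" using k by simp
    have "set (h i0) = set (u # r)" by (simp add: h_def)
    then have "set (butlast (h i0)) \<subseteq> set (u # r) - {w}"
      using is_path_set(1,2)[OF ph0 k1] by blast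
    then show ?thesis unfolding True using r(3) by blast
  next
    case False
    have "set (butlast (g i)) \<inter> (S \<union> set (u # r)) = {}"
      by (rule g(4)[rule_format, OF that])
    then show ?thesis using False by (simp add: h_def Int_Un_distrib)
  qed
  ultimately show "\<exists>y g. is_spider (\<lambda>_. k) y g \<and> (\<forall>i<s. last (y # g i) = (x(i0 := w)) i) \<and> y \<notin> S \<and>
              (\<forall>i<s. set (butlast (g i)) \<inter> S = {})"
    using last g(3) by (intro exI[of _ y] exI[of _ h] conjI allI impI) (simp_all del: last.simps)
qed

definition other_leaves :: "nat \<Rightarrow> 'a \<times> (nat \<Rightarrow> 'a list) \<Rightarrow> nat \<Rightarrow> 'a" where
  "other_leaves i0 z = restrict (\<lambda>i. last (fst z # snd z i)) ({..<s} - {i0})"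

text \<open>The centre and the long legs determine the set \<open>W\<close> and leave fewer than
  \<open>T\<close> choices for the short leaf. This saves a factor of order \<open>D\<close> over
  the trivial bound, so such spiders are rare.\<close>

lemma card_spiders_few_ends:
  fixes W :: "(nat \<Rightarrow> 'a) \<Rightarrow> 'a set" and k T :: nat
  assumes i0: "i0 < s"
  defines "l \<equiv> (\<lambda>_. k)(i0 := 1)"
  defines "A \<equiv> {(y, g). is_spider l y g \<and> last (y # g i0) \<in> W (other_leaves i0 (y, g)) \<and>
      card (nb y \<inter> W (other_leaves i0 (y, g))) < T}"
  shows "finite A" "real (card A) \<le> real T * (real (card V) * D ^ ((s - 1) * k))"
proof -
  show finA: "finite A" by (rule finite_subset[OF _ finite_spiders[of l]]) (auto simp: A_def)
  \<comment> \<open>The short leg is deleted by giving it length 0.\<close>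
  let ?l = "l(i0 := 0)"
  let ?B = "Sigma V (\<lambda>y. PiE {..<s} (\<lambda>i. walks y (?l i)))"
  let ?f = "\<lambda>(y, g). (y, g(i0 := []))"
  have finB: "finite ?B" by (intro finite_SigmaI finite_V finite_PiE_walks) auto
  have "(\<Sum>i<s. ?l i) = (\<Sum>i\<in>{..<s} - {i0}. k)"
  proof -
    have "(\<Sum>i<s. ?l i) = ?l i0 + (\<Sum>i\<in>{..<s} - {i0}. ?l i)"
      using i0 by (intro sum.remove) auto
    also have "(\<Sum>i\<in>{..<s} - {i0}. ?l i) = (\<Sum>i\<in>{..<s} - {i0}. k)"
      by (intro sum.cong) (auto simp: l_def)
    finally show ?thesis by simp
  qed
  also have "\<dots> = (s - 1) * k" using i0 by simp
  finally have suml: "(\<Sum>i<s. ?l i) = (s - 1) * k" .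
  have "real (card ?B) = (\<Sum>y\<in>V. real (card (PiE {..<s} (\<lambda>i. walks y (?l i)))))"
    by (subst card_SigmaI) (auto simp: finite_V intro!: finite_PiE_walks)
  also have "\<dots> \<le> (\<Sum>y\<in>V. D ^ ((s - 1) * k))"
    unfolding suml[symmetric] by (intro sum_mono card_PiE_walks) simp
  finally have cB: "real (card ?B) \<le> real (card V) * D ^ ((s - 1) * k)" by simp
  have "real (card A) \<le> real T * real (card ?B)"
  proof (rule card_le_fibers[OF finA finB, where f = ?f])
    show "?f ` A \<subseteq> ?B"
    proof
      fix b assume "b \<in> ?f ` A"
      then obtain a where a: "a \<in> A" "b = ?f a" by blast
      obtain y g where yg: "a = (y, g)" by (cases a)
      have "is_spider l y g" using a yg by (simp add: A_def)
      note sp = spider_subset_PiE[OF this]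
      then have "(g(i0 := [])) i \<in> walks y (?l i)" if "i < s" for i
        using that by (auto simp: walks_0)
      moreover have "g(i0 := []) \<in> extensional {..<s}"
        using sp i0 by (auto simp: PiE_def extensional_def)
      ultimately show "b \<in> ?B" using sp a yg by (auto simp: PiE_def Pi_def)
    qed
    fix b assume "b \<in> ?B"
    obtain y g' where b: "b = (y, g')" by (cases b)
    let ?F = "{a\<in>A. ?f a = b}"
    define x where "x = restrict (\<lambda>i. last (y # g' i)) ({..<s} - {i0})"
    have F: "y' = y \<and> g = g'(i0 := [last (y # g i0)]) \<and> last (y # g i0) \<in> nb y \<inter> W x \<and>
        card (nb y \<inter> W x) < T" if "(y', g) \<in> ?F" for y' g
    proof -
      have e: "y' = y" "g(i0 := []) = g'" and A: "(y, g) \<in> A" using that b by auto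
      have x: "other_leaves i0 (y, g) = x"
        unfolding other_leaves_def x_def e(2)[symmetric] by (rule ext) (simp add: restrict_def del: last.simps)
      have p: "is_path 1 y (last (y # g i0)) (g i0)"
        using is_spider_path[of l y g i0] A i0 by (auto simp: A_def l_def)
      then obtain a where a: "g i0 = [a]" by (auto simp: is_path_def length_Suc_conv)
      have "adj y a" using p a by (simp add: is_path_def)
      moreover have "g = g'(i0 := [a])" using e(2) a by auto
      ultimately show ?thesis using e A x a by (auto simp: A_def nb_def)
    qed
    show "real (card ?F) \<le> real T"
    proof (cases "?F = {}")
      case False
      then obtain a0 where "a0 \<in> ?F" by blast
      then have lt: "card (nb y \<inter> W x) < T" using F[of "fst a0" "snd a0"] by simp
      have "card ?F \<le> card (nb y \<inter> W x)"
      proof (rule card_inj_on_le[of "\<lambda>(y', g). last (y # g i0)"])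
        show "inj_on (\<lambda>(y', g). last (y # g i0)) ?F"
        proof (rule inj_onI)
          fix a c assume ac: "a \<in> ?F" "c \<in> ?F"
            and eq: "(\<lambda>(y', g). last (y # g i0)) a = (\<lambda>(y', g). last (y # g i0)) c"
          obtain y1 g1 y2 g2 where yg: "a = (y1, g1)" "c = (y2, g2)" by (cases a, cases c)
          have "g1 = g'(i0 := [last (y # g1 i0)])" "g2 = g'(i0 := [last (y # g2 i0)])" "y1 = y" "y2 = y"
            using F[of y1 g1] F[of y2 g2] ac yg by auto
          moreover have "last (y # g1 i0) = last (y # g2 i0)" using eq yg by simp
          ultimately show "a = c" using yg by metis
        qed
        show "(\<lambda>(y', g). last (y # g i0)) ` ?F \<subseteq> nb y \<inter> W x"
          using F by (auto simp del: last.simps)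
      qed (simp add: finite_nb)
      then show ?thesis using lt by simp
    next
      case True
      show ?thesis unfolding True by simp
    qed
  qed
  also have "\<dots> \<le> real T * (real (card V) * D ^ ((s - 1) * k))"
    using cB by (intro mult_left_mono) auto
  finally show "real (card A) \<le> real T * (real (card V) * D ^ ((s - 1) * k))" .
qed

lemma card_good_spiders_fixed_leaves:
  assumes l: "\<And>i. i < s \<Longrightarrow> l i \<le> k" and C: "finite C"
  shows "card {(y, g). y \<in> C \<and> g \<in> PiE {..<s} (\<lambda>i. good_paths L (l i) y (X i))}
       \<le> card C * path_bound L k ^ s"
proof -
  have "{(y, g). y \<in> C \<and> g \<in> PiE {..<s} (\<lambda>i. good_paths L (l i) y (X i))}
      = Sigma C (\<lambda>y. PiE {..<s} (\<lambda>i. good_paths L (l i) y (X i)))" by auto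
  then have "card {(y, g). y \<in> C \<and> g \<in> PiE {..<s} (\<lambda>i. good_paths L (l i) y (X i))}
     = (\<Sum>y\<in>C. card (PiE {..<s} (\<lambda>i. good_paths L (l i) y (X i))))"
    using C by (simp add: card_SigmaI finite_PiE finite_good_paths)
  also have "\<dots> \<le> (\<Sum>y\<in>C. path_bound L k ^ s)"
  proof (rule sum_mono)
    fix y
    have "card (PiE {..<s} (\<lambda>i. good_paths L (l i) y (X i))) = (\<Prod>i<s. card (good_paths L (l i) y (X i)))"
      by (simp add: card_PiE)
    also have "\<dots> \<le> (\<Prod>i<s. path_bound L k)"
    proof (rule prod_mono)
      fix i assume "i \<in> {..<s}"
      then show "0 \<le> card (good_paths L (l i) y (X i)) \<and> card (good_paths L (l i) y (X i)) \<le> path_bound L k"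
        using card_good_paths[of L "l i" y "X i"] path_bound_mono[of "l i" k L] l[of i] by auto
    qed
    finally show "card (PiE {..<s} (\<lambda>i. good_paths L (l i) y (X i))) \<le> path_bound L k ^ s" by simp
  qed
  finally show ?thesis by simp
qed

text \<open>A short end \<open>u\<close> outside the second level has few neighbours in the first one, so by
  robustness some spider on the same leaves has its centre outside the first level. Such centres
  carry few spiders, which bounds the number of the leaf tuples with such an end \<open>u\<close>.\<close>

lemma card_robust_spiders_short_leg:
  assumes i0: "i0 < s" and k: "k \<in> {3, 4}"
    and none: "\<not> (\<exists>X. robust_spider L0 (\<lambda>_. k) X)"
    and T: "T = L0 + s + k + 1" and L: "L \<ge> T"
  shows "real (card (robust_spiders L' L ((\<lambda>_. k)(i0 := 1))))
     \<le> (2 + real T * real (path_bound L' k ^ s)) * real T * (real (card V) * D ^ ((s - 1) * k))"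
proof -
  define l where "l = ((\<lambda>_. k)(i0 := 1::nat))"
  define U where "U x = {u. robust_spider L l (x(i0 := u))}" for x
  define xs where "xs x = x ` ({..<s} - {i0})" for x :: "nat \<Rightarrow> 'a"
  define R where "R x = rich T (U x)" for x
  define W2 where "W2 x = R x 2 - xs x" for x
  define M where "M = real (card V) * D ^ ((s - 1) * k)"
  define Q where "Q = path_bound L' k ^ s"
  \<comment> \<open>Level \<open>k - 1\<close> contains no vertices besides long leaves, since any
    other would yield a robust tuple for legs of length \<open>k\<close>.\<close>
  have nr: "w \<in> xs x" if "w \<in> R x (k - 1)" for x w
  proof (rule ccontr)
    assume "w \<notin> xs x"
    then have "robust_spider L0 (\<lambda>_. k) (x(i0 := w))"
      using that i0 k T L unfolding xs_def R_def
      by (intro robust_spider_of_rich[where U = "U x" and L = L and T = T]) (auto simp: U_def l_def)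
    with none show False by blast
  qed
  define A1 where "A1 = {(y, g). is_spider l y g \<and> last (y # g i0) \<in> U (other_leaves i0 (y, g)) \<and>
      card (nb y \<inter> U (other_leaves i0 (y, g))) < T}"
  define A2 where "A2 = {(y, g). is_spider l y g \<and> last (y # g i0) \<in> W2 (other_leaves i0 (y, g)) \<and>
      card (nb y \<inter> W2 (other_leaves i0 (y, g))) < T}"
  have A1: "finite A1" "real (card A1) \<le> real T * M"
    unfolding A1_def M_def l_def by (rule card_spiders_few_ends[OF i0])+
  have A2: "finite A2" "real (card A2) \<le> real T * M"
    unfolding A2_def M_def l_def by (rule card_spiders_few_ends[OF i0])+
  define P where "P = {(x, u). x \<in> extensional ({..<s} - {i0}) \<and> u \<in> U x \<and> u \<notin> R x 2}"
  have leaves: "robust_spider L l (\<lambda>i. last (y # g i)) \<longleftrightarrow> last (y # g i0) \<in> U (other_leaves i0 (y, g))" for y g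
    unfolding U_def mem_Collect_eq by (rule robust_spider_cong) (auto simp: other_leaves_def)
  have P_sub: "P \<subseteq> (\<lambda>(y, g). (other_leaves i0 (y, g), last (y # g i0))) ` A1"
  proof
    fix p assume p: "p \<in> P"
    obtain x u where xu: "p = (x, u)" by (cases p)
    have x: "x \<in> extensional ({..<s} - {i0})" and u: "u \<in> U x" "u \<notin> R x 2"
      using p xu by (auto simp: P_def)
    have "card (nb u \<inter> R x 1) < T" using u(2) by (simp add: R_def numeral_2_eq_2)
    then have "card (nb u \<inter> R x 1) \<le> L" "finite (nb u \<inter> R x 1)" using L finite_nb by auto
    \<comment> \<open>The neighbours of \<open>u\<close> in level 1 number fewer than
      \<open>T \<le> L\<close>, so they may be avoided; the centre obtained is adjacent to
      \<open>u\<close> and hence outside level 1.\<close>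
    then have "\<exists>y g. is_spider l y g \<and> (\<forall>i<s. last (y # g i) = (x(i0 := u)) i) \<and> y \<notin> nb u \<inter> R x 1 \<and>
              (\<forall>i<s. set (butlast (g i)) \<inter> (nb u \<inter> R x 1) = {})"
      using u(1) by (simp only: U_def mem_Collect_eq robust_spider_def simp_thms)
    then obtain y g where g: "is_spider l y g" "\<forall>i<s. last (y # g i) = (x(i0 := u)) i" "y \<notin> nb u \<inter> R x 1"
      by (elim exE conjE)
    have ol: "other_leaves i0 (y, g) = x"
    proof
      fix i
      show "other_leaves i0 (y, g) i = x i"
        using x g(2) by (cases "i \<in> {..<s} - {i0}") (auto simp: other_leaves_def extensional_def)
    qed
    have lu: "last (y # g i0) = u" using g(2) i0 by simp
    have "is_path 1 y u (g i0)" using is_spider_path[OF g(1) i0] lu by (simp add: l_def)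
    then have "adj y u" by (auto simp: is_path_def length_Suc_conv)
    then have "y \<notin> R x 1" using g(3) adj_sym by (auto simp: nb_def)
    then have "card (nb y \<inter> U x) < T" by (simp add: R_def)
    then have "(y, g) \<in> A1" unfolding A1_def mem_Collect_eq split ol lu using g(1) u(1) by (intro conjI)
    then show "p \<in> (\<lambda>(y, g). (other_leaves i0 (y, g), last (y # g i0))) ` A1"
      by (rule rev_image_eqI) (simp only: xu ol lu split)
  qed
  have finP: "finite P" by (rule finite_subset[OF P_sub]) (simp add: A1)
  have "card P \<le> card A1" by (rule surj_card_le[OF A1(1) P_sub])
  then have cP: "real (card P) \<le> real T * M" using A1 by linarith
  \<comment> \<open>For given leaves the centre of such a spider is one of fewer than
    \<open>T\<close> neighbours of \<open>u\<close> in level 1, and good legs between known ends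
    have boundedly many choices. So \<open>A3\<close> is controlled by the number of pairs in
    \<open>P\<close>.\<close>
  define A3 where "A3 = {(y, g). (y, g) \<in> robust_spiders L' L l \<and>
      y \<in> R (other_leaves i0 (y, g)) 1 \<and> last (y # g i0) \<notin> R (other_leaves i0 (y, g)) 2}"
  have finA3: "finite A3" by (rule finite_subset[OF _ finite_robust_spiders[of L' L l]]) (auto simp: A3_def)
  have cA3: "real (card A3) \<le> real (T * Q) * real (card P)"
  proof (rule card_le_fibers[OF finA3 finP, where f = "\<lambda>(y, g). (other_leaves i0 (y, g), last (y # g i0))"])
    let ?f = "\<lambda>(y, g). (other_leaves i0 (y, g), last (y # g i0))"
    show "?f ` A3 \<subseteq> P"
    proof
      fix p assume "p \<in> ?f ` A3"
      then obtain a where a: "a \<in> A3" "p = ?f a" by blast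
      obtain y g where yg: "a = (y, g)" by (cases a)
      have "other_leaves i0 (y, g) \<in> extensional ({..<s} - {i0})" by (simp add: other_leaves_def)
      moreover have "last (y # g i0) \<in> U (other_leaves i0 (y, g))"
        using a leaves[of y g] by (simp add: yg A3_def robust_spiders_def del: last.simps)
      moreover have "last (y # g i0) \<notin> R (other_leaves i0 (y, g)) 2"
        using a by (simp add: yg A3_def del: last.simps)
      ultimately show "p \<in> P"
        using a(2) by (simp add: yg P_def del: last.simps)
    qed
    fix p assume p: "p \<in> P"
    obtain x u where xu: "p = (x, u)" by (cases p)
    have lt: "card (nb u \<inter> R x 1) < T" using p xu by (simp add: P_def R_def numeral_2_eq_2)
    define C where "C = nb u \<inter> R x 1"
    have finC: "finite C" by (simp add: C_def finite_nb)
    have "{a\<in>A3. ?f a = p} \<subseteq> {(y, g). y \<in> C \<and> g \<in> PiE {..<s} (\<lambda>i. good_paths L' (l i) y ((x(i0 := u)) i))}"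
    proof
      fix a assume a: "a \<in> {a\<in>A3. ?f a = p}"
      obtain y g where yg: "a = (y, g)" by (cases a)
      have e: "other_leaves i0 (y, g) = x" "last (y # g i0) = u" and
        sp: "is_spider l y g" "\<forall>i<s. good_path L' y (g i)" and yR: "y \<in> R x 1"
        using a unfolding yg xu A3_def robust_spiders_def by auto
      have lasts: "last (y # g i) = (x(i0 := u)) i" if "i < s" for i
        using fun_cong[OF e(1), of i] e(2) that by (auto simp: other_leaves_def)
      have gp: "g i \<in> good_paths L' (l i) y ((x(i0 := u)) i)" if "i < s" for i
        using is_spider_path[OF sp(1) that] sp(2) that lasts[OF that] by (simp only: good_paths_def mem_Collect_eq)
      have "is_path 1 y u (g i0)" using is_spider_path[OF sp(1) i0] e(2) by (simp add: l_def)
      then have "adj y u" by (auto simp: is_path_def length_Suc_conv)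
      then have "y \<in> C" using yR adj_sym by (auto simp: C_def nb_def)
      moreover have "g \<in> PiE {..<s} (\<lambda>i. good_paths L' (l i) y ((x(i0 := u)) i))"
        using gp sp(1) by (simp add: PiE_def Pi_def is_spider_def)
      ultimately show "a \<in> {(y, g). y \<in> C \<and> g \<in> PiE {..<s} (\<lambda>i. good_paths L' (l i) y ((x(i0 := u)) i))}"
        using yg by simp
    qed
    moreover have "finite {(y, g). y \<in> C \<and> g \<in> PiE {..<s} (\<lambda>i. good_paths L' (l i) y ((x(i0 := u)) i))}"
    proof -
      have "{(y, g). y \<in> C \<and> g \<in> PiE {..<s} (\<lambda>i. good_paths L' (l i) y ((x(i0 := u)) i))}
        = Sigma C (\<lambda>y. PiE {..<s} (\<lambda>i. good_paths L' (l i) y ((x(i0 := u)) i)))" by auto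
      then show ?thesis using finC by (simp add: finite_PiE finite_good_paths)
    qed
    ultimately have "card {a\<in>A3. ?f a = p} \<le>
        card {(y, g). y \<in> C \<and> g \<in> PiE {..<s} (\<lambda>i. good_paths L' (l i) y ((x(i0 := u)) i))}"
      by (rule card_mono[rotated])
    also have "\<dots> \<le> card C * path_bound L' k ^ s"
      using k by (intro card_good_spiders_fixed_leaves finC) (auto simp: l_def)
    also have "\<dots> \<le> T * Q" using lt by (simp add: C_def Q_def)
    finally show "real (card {a\<in>A3. ?f a = p}) \<le> real (T * Q)" by (simp only: of_nat_le_iff)
  qed
  have sub: "robust_spiders L' L l \<subseteq> A1 \<union> A2 \<union> A3"
  proof
    fix a assume a: "a \<in> robust_spiders L' L l"
    obtain y g where yg: "a = (y, g)" by (cases a)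
    define x where "x = other_leaves i0 (y, g)"
    define u where "u = last (y # g i0)"
    have sp: "is_spider l y g" and uU: "u \<in> U x"
      using a leaves[of y g] unfolding yg robust_spiders_def x_def u_def by auto
    have xi: "x i = last (y # g i)" if "i < s" "i \<noteq> i0" for i
      using that by (simp add: x_def other_leaves_def)
    have leaf_in: "last (y # g i) \<in> set (g i)" if "i < s" for i
      using is_spider_path[OF sp that] k by (cases "g i") (auto simp: is_path_def l_def split: if_splits)
    have uxs: "u \<notin> xs x"
    proof
      assume "u \<in> xs x"
      then obtain i where i: "i < s" "i \<noteq> i0" "u = x i" by (auto simp: xs_def)
      have "u \<in> set (g i0)" unfolding u_def by (rule leaf_in[OF i0])
      moreover have "u \<in> set (g i)" unfolding i(3) xi[OF i(1,2)] by (rule leaf_in[OF i(1)])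
      ultimately show False
        using is_spider_disjoint[OF sp i0 i(1) i(2)[symmetric]] by (meson disjoint_iff)
    qed
    have yxs: "y \<notin> xs x"
    proof
      assume "y \<in> xs x"
      then obtain i where i: "i < s" "i \<noteq> i0" "y = x i" by (auto simp: xs_def)
      have "x i \<in> set (g i)" unfolding xi[OF i(1,2)] by (rule leaf_in[OF i(1)])
      then have "y \<in> set (g i)" using i(3) by simp
      then show False using is_spider_path[OF sp i(1)] by (simp add: is_path_def)
    qed
    \<comment> \<open>The third case can occur only for k = 4: for k = 3 level 2 is already level
      \<open>k - 1\<close> and contains only long leaves, whereas \<open>u\<close> is none of
      them.\<close>
    consider "y \<notin> R x 1" | "y \<in> R x 1" "u \<notin> R x 2" | "u \<in> R x 2" by blast
    then show "a \<in> A1 \<union> A2 \<union> A3"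
    proof cases
      case 1
      then have "card (nb y \<inter> U x) < T" by (simp add: R_def)
      then have "a \<in> A1" using sp uU unfolding A1_def yg mem_Collect_eq split x_def u_def by (intro conjI)
      then show ?thesis by blast
    next
      case 2
      then have "a \<in> A3" using a unfolding A3_def yg mem_Collect_eq split x_def u_def by (intro conjI)
      then show ?thesis by blast
    next
      case 3
      have "k = 4"
      proof (rule ccontr)
        assume "k \<noteq> 4"
        then have "k - 1 = 2" using k by simp
        then show False using nr[of u x] 3 uxs by simp
      qed
      then have "y \<notin> R x 3" using nr[of y x] yxs by auto
      then have "card (nb y \<inter> R x 2) < T" by (simp add: R_def numeral_3_eq_3 numeral_2_eq_2)
      moreover have "card (nb y \<inter> W2 x) \<le> card (nb y \<inter> R x 2)"
        by (rule card_mono) (auto simp: W2_def finite_nb)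
      ultimately have "card (nb y \<inter> W2 x) < T" by simp
      moreover have "u \<in> W2 x" using 3 uxs by (simp add: W2_def)
      ultimately have "a \<in> A2" using sp unfolding A2_def yg mem_Collect_eq split x_def u_def by (intro conjI)
      then show ?thesis by blast
    qed
  qed
  have "card (robust_spiders L' L l) \<le> card (A1 \<union> A2 \<union> A3)"
    using sub A1 A2 finA3 by (intro card_mono) auto
  also have "\<dots> \<le> card A1 + card A2 + card A3"
    using card_Un_le[of "A1 \<union> A2" A3] card_Un_le[of A1 A2] by linarith
  finally have "real (card (robust_spiders L' L l)) \<le> real (card A1) + real (card A2) + real (card A3)"
    by linarith
  also have "\<dots> \<le> real T * M + real T * M + real (T * Q) * (real T * M)"
  proof -
    have "real (T * Q) * real (card P) \<le> real (T * Q) * (real T * M)"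
      using cP by (intro mult_left_mono) auto
    then show ?thesis using A1 A2 cA3 by linarith
  qed
  also have "\<dots> = (2 + real T * real Q) * real T * M" by (simp add: algebra_simps)
  finally show ?thesis by (simp add: l_def M_def Q_def)
qed

end

section \<open>Lower and upper bounds for the number of spiders\<close>

section \<open>Counting spiders\<close>

context bounded_graph
begin

definition paths_avoiding :: "'a \<Rightarrow> nat \<Rightarrow> 'a set \<Rightarrow> 'a list set" where
  "paths_avoiding v m S = {p\<in>walks v m. distinct p \<and> set p \<inter> S = {}}"

lemma finite_paths_avoiding: "finite (paths_avoiding v m S)"
  by (simp add: paths_avoiding_def finite_walks)

lemma paths_avoiding_Suc:
  "paths_avoiding v (Suc m) S = (\<Union>u\<in>nb v - S. (#) u ` paths_avoiding u m (insert u S))"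
  by (auto simp: paths_avoiding_def walks_Suc)

text \<open>Each new vertex joins the avoided set, whose size stays at most
  \<open>card S + m \<le> c\<close>; so every step has at least \<delta> - c choices.\<close>

lemma card_paths_avoiding:
  assumes deg: "\<And>v. v \<in> V \<Longrightarrow> real (card (nb v)) \<ge> \<delta>"
    and "v \<in> V" "finite S" "card S + m \<le> c" "real c \<le> \<delta>"
  shows "real (card (paths_avoiding v m S)) \<ge> (\<delta> - real c) ^ m"
  using assms(2-4)
proof (induction m arbitrary: v S)
  case 0
  have "paths_avoiding v 0 S = {[]}" by (auto simp: paths_avoiding_def walks_0)
  then show ?case by simp
next
  case (Suc m)
  have "real (card (nb v)) \<le> real (card (nb v - S)) + real (card S)"
  proof -
    have "card (nb v) \<le> card ((nb v - S) \<union> S)"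
      using Suc.prems finite_nb by (intro card_mono) auto
    also have "\<dots> \<le> card (nb v - S) + card S" by (rule card_Un_le)
    finally show ?thesis by simp
  qed
  with deg[OF Suc.prems(1)] Suc.prems have c: "real (card (nb v - S)) \<ge> \<delta> - real c" by linarith
  have "(\<delta> - real c) ^ Suc m \<le> real (card (nb v - S)) * (\<delta> - real c) ^ m"
    using c assms(5) by (simp add: mult_right_mono)
  also have "\<dots> = (\<Sum>u\<in>nb v - S. (\<delta> - real c) ^ m)" by simp
  also have "\<dots> \<le> (\<Sum>u\<in>nb v - S. real (card (paths_avoiding u m (insert u S))))"
  proof (rule sum_mono)
    fix u assume u: "u \<in> nb v - S"
    then have "u \<in> V" using nb_subset_V by blast
    moreover have "card (insert u S) + m \<le> c" using u Suc.prems by simp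
    ultimately show "(\<delta> - real c) ^ m \<le> real (card (paths_avoiding u m (insert u S)))"
      using Suc.prems by (intro Suc.IH) auto
  qed
  also have "\<dots> = real (\<Sum>u\<in>nb v - S. card ((#) u ` paths_avoiding u m (insert u S)))"
    by (simp add: card_image)
  also have "(\<Sum>u\<in>nb v - S. card ((#) u ` paths_avoiding u m (insert u S))) = card (paths_avoiding v (Suc m) S)"
    unfolding paths_avoiding_Suc
    by (rule card_UN_disjoint[symmetric]) (auto simp: finite_nb finite_paths_avoiding)
  finally show ?case .
qed

definition legs :: "nat \<Rightarrow> nat \<Rightarrow> 'a \<Rightarrow> (nat \<Rightarrow> 'a list) set" where
  "legs k r y = {g\<in>extensional {..<r}. (\<forall>i<r. g i \<in> paths_avoiding y k {y}) \<and>
     (\<forall>i<r. \<forall>j<r. i \<noteq> j \<longrightarrow> set (g i) \<inter> set (g j) = {})}"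

lemma finite_legs: "finite (legs k r y)"
  by (rule finite_subset[OF _ finite_PiE[of "{..<r}" "\<lambda>_. paths_avoiding y k {y}"]])
    (auto simp: legs_def PiE_def finite_paths_avoiding)

text \<open>Legs are added one at a time; a new leg avoids the centre and the earlier legs, at most
  \<open>r * k + 1\<close> vertices, and its own \<open>k\<close> vertices complete the bound
  \<open>c\<close>.\<close>

lemma card_legs:
  assumes deg: "\<And>v. v \<in> V \<Longrightarrow> real (card (nb v)) \<ge> \<delta>"
    and y: "y \<in> V" and c: "r * k + k + 1 \<le> c" "real c \<le> \<delta>"
  shows "real (card (legs k r y)) \<ge> ((\<delta> - real c) ^ k) ^ r"
  using c(1)
proof (induction r)
  case 0
  have "legs k 0 y = {\<lambda>_. undefined}" by (auto simp: legs_def)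
  then show ?case by simp
next
  case (Suc r)
  let ?S = "\<lambda>g. insert y (\<Union>i<r. set (g i))"
  have cS: "card (?S g) + k \<le> c" if g: "g \<in> legs k r y" for g
  proof -
    have "card (\<Union>i<r. set (g i)) \<le> (\<Sum>i<r. card (set (g i)))" by (rule card_UN_le) simp
    also have "\<dots> \<le> (\<Sum>i<r. k)"
    proof (rule sum_mono)
      fix i assume "i \<in> {..<r}"
      then have "length (g i) = k" using g by (auto simp: legs_def paths_avoiding_def walks_def)
      then show "card (set (g i)) \<le> k" using card_length[of "g i"] by simp
    qed
    finally have "card (?S g) \<le> r * k + 1"
      using card_insert_le_m1[of "Suc (r * k)" "\<Union>i<r. set (g i)" y] by simp
    then show ?thesis using Suc.prems by simp
  qed
  have "((\<delta> - real c) ^ k) ^ Suc r \<le> real (card (legs k r y)) * (\<delta> - real c) ^ k"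
    using Suc c(2) by (simp add: mult_left_mono mult.commute)
  also have "\<dots> = (\<Sum>g\<in>legs k r y. (\<delta> - real c) ^ k)" by simp
  also have "\<dots> \<le> (\<Sum>g\<in>legs k r y. real (card (paths_avoiding y k (?S g))))"
    using cS c(2) by (intro sum_mono card_paths_avoiding[OF deg y]) auto
  also have "\<dots> = real (card (Sigma (legs k r y) (\<lambda>g. paths_avoiding y k (?S g))))"
    by (simp add: card_SigmaI finite_legs finite_paths_avoiding)
  also have "card (Sigma (legs k r y) (\<lambda>g. paths_avoiding y k (?S g))) \<le> card (legs k (Suc r) y)"
  proof (rule card_inj_on_le[of "\<lambda>(g, p). g(r := p)"])
    show "inj_on (\<lambda>(g, p). g(r := p)) (Sigma (legs k r y) (\<lambda>g. paths_avoiding y k (?S g)))"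
    proof (rule inj_onI)
      fix a b assume ab: "a \<in> Sigma (legs k r y) (\<lambda>g. paths_avoiding y k (?S g))"
        "b \<in> Sigma (legs k r y) (\<lambda>g. paths_avoiding y k (?S g))"
        and eq: "(\<lambda>(g, p). g(r := p)) a = (\<lambda>(g, p). g(r := p)) b"
      obtain g p g' p' where gp: "a = (g, p)" "b = (g', p')" by (cases a, cases b)
      have "p = p'" using fun_cong[OF eq, of r] gp by simp
      moreover have "g r = undefined" "g' r = undefined"
        using ab gp by (auto simp: legs_def extensional_def)
      then have "g i = g' i" for i
        using fun_cong[OF eq, of i] gp by (cases "i = r") auto
      then have "g = g'" by (rule ext)
      ultimately show "a = b" using gp by simp
    qed
    show "(\<lambda>(g, p). g(r := p)) ` Sigma (legs k r y) (\<lambda>g. paths_avoiding y k (?S g)) \<subseteq> legs k (Suc r) y"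
    proof
      fix h assume "h \<in> (\<lambda>(g, p). g(r := p)) ` Sigma (legs k r y) (\<lambda>g. paths_avoiding y k (?S g))"
      then obtain g p where gp: "g \<in> legs k r y" "p \<in> paths_avoiding y k (?S g)" "h = g(r := p)" by auto
      have d: "set p \<inter> set (g i) = {}" if "i < r" for i
        using gp(2) that by (auto simp: paths_avoiding_def)
      have "p \<in> paths_avoiding y k {y}" using gp(2) by (auto simp: paths_avoiding_def)
      moreover have "h \<in> extensional {..<Suc r}"
        using gp by (auto simp: legs_def extensional_def)
      moreover have "set (h i) \<inter> set (h j) = {}" if ij: "i < Suc r" "j < Suc r" "i \<noteq> j" for i j
      proof -
        consider "i = r" "j < r" | "j = r" "i < r" | "i < r" "j < r" using ij by linarith
        then show ?thesis
        proof cases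
          case 1
          then show ?thesis using d[of j] gp by simp
        next
          case 2
          then show ?thesis using d[of i] gp by (simp add: Int_commute)
        next
          case 3
          then show ?thesis using gp ij by (simp add: legs_def)
        qed
      qed
      moreover have "\<forall>i<Suc r. h i \<in> paths_avoiding y k {y}"
        using \<open>p \<in> paths_avoiding y k {y}\<close> gp by (auto simp: legs_def less_Suc_eq)
      ultimately show "h \<in> legs k (Suc r) y"
        unfolding legs_def mem_Collect_eq by blast
    qed
  qed (rule finite_legs)
  finally show ?case by simp
qed

lemma card_spiders_ge:
  assumes deg: "\<And>v. v \<in> V \<Longrightarrow> real (card (nb v)) \<ge> \<delta>"
    and c: "s * k + k + 1 \<le> c" "real c \<le> \<delta>"
  shows "real (card {(y, g). is_spider (\<lambda>_. k) y g}) \<ge> real (card V) * ((\<delta> - real c) ^ k) ^ s"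
proof -
  have "real (card V) * ((\<delta> - real c) ^ k) ^ s = (\<Sum>y\<in>V. ((\<delta> - real c) ^ k) ^ s)" by simp
  also have "\<dots> \<le> (\<Sum>y\<in>V. real (card (legs k s y)))"
    by (intro sum_mono card_legs[OF deg _ c])
  also have "\<dots> = real (card (Sigma V (legs k s)))"
    by (simp add: card_SigmaI finite_V finite_legs)
  also have "card (Sigma V (legs k s)) \<le> card {(y, g). is_spider (\<lambda>_. k) y g}"
  proof (rule card_mono[OF finite_spiders])
    have "is_spider (\<lambda>_. k) y g" if "y \<in> V" "g \<in> legs k s y" for y g
    proof -
      have "is_path k y (last (y # g i)) (g i)" if "i < s" for i
        using \<open>g \<in> legs k s y\<close> that
        by (auto simp: legs_def is_path_def paths_avoiding_def walks_def simp del: last.simps)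
      then show ?thesis using that by (simp add: legs_def is_spider_def del: last.simps)
    qed
    then show "Sigma V (legs k s) \<subseteq> {(y, g). is_spider (\<lambda>_. k) y g}" by blast
  qed
  finally show ?thesis by simp
qed

text \<open>The segment is a robust path. Given this path, the spider is recovered from
  \<open>a\<close> steps back to the centre, \<open>k - b\<close> steps on to the leaf, and the
  other \<open>s - 1\<close> legs.\<close>

lemma card_spiders_robust_segment:
  assumes i: "i < s" and ab: "a < b" "b \<le> k"
  shows "real (card {(y, g). is_spider (\<lambda>_. k) y g \<and> robust L (b - a) ((y # g i) ! a) ((y # g i) ! b)})
     \<le> D ^ (a + (k - b) + (s - 1) * k) * real (card (robust_paths L (b - a)))"
proof (rule card_le_fibers[where f = "\<lambda>(y, g). ((y # g i) ! a, take (b - a) (drop a (g i)))"])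
  let ?A = "{(y, g). is_spider (\<lambda>_. k) y g \<and> robust L (b - a) ((y # g i) ! a) ((y # g i) ! b)}"
  let ?f = "\<lambda>(y, g). ((y # g i) ! a, take (b - a) (drop a (g i)))"
  show finA: "finite ?A" by (rule finite_subset[OF _ finite_spiders[of "\<lambda>_. k"]]) auto
  show "finite (robust_paths L (b - a))" using ab by (intro finite_robust_paths) simp
  have seg: "is_path (b - a) ((y # g i) ! a) ((y # g i) ! b) (take (b - a) (drop a (g i)))"
    if "is_spider (\<lambda>_. k) y g" for y g
  proof -
    note p = is_spider_path[OF that i]
    have len: "length (g i) = k" using p by (simp add: is_path_def)
    have "is_path (k - a) ((y # g i) ! a) (last (y # g i)) (drop a (g i))"
      using ab by (intro is_path_take_drop(2)[OF p]) simp
    then have "is_path (b - a) ((y # g i) ! a) (((y # g i) ! a # drop a (g i)) ! (b - a)) (take (b - a) (drop a (g i)))"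
      using ab by (intro is_path_take_drop(1)) auto
    moreover have "((y # g i) ! a # drop a (g i)) ! (b - a) = (y # g i) ! b"
      using ab len by (simp add: Cons_nth_drop nth_drop)
    ultimately show ?thesis by simp
  qed
  show "?f ` ?A \<subseteq> robust_paths L (b - a)"
  proof
    fix z assume "z \<in> ?f ` ?A"
    then obtain w where w: "w \<in> ?A" "z = ?f w" by blast
    obtain y g where yg: "w = (y, g)" by (cases w)
    have sp: "is_spider (\<lambda>_. k) y g" "robust L (b - a) ((y # g i) ! a) ((y # g i) ! b)"
      using w yg by auto
    have "last ((y # g i) ! a # take (b - a) (drop a (g i))) = (y # g i) ! b"
      using seg[OF sp(1)] unfolding is_path_def by blast
    then show "z \<in> robust_paths L (b - a)"
      using seg[OF sp(1)] sp(2) w(2) unfolding yg robust_paths_def by simp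
  qed
  fix z assume "z \<in> robust_paths L (b - a)"
  obtain x p where z: "z = (x, p)" by (cases z)
  let ?F = "{w\<in>?A. ?f w = z}"
  \<comment> \<open>\<open>q\<close> is the walk from the start \<open>x\<close> of the segment back
    to the centre, which is therefore \<open>last (x # q)\<close>.\<close>
  let ?B = "Sigma (walks x a) (\<lambda>q. walks (last (x # p)) (k - b) \<times> PiE ({..<s} - {i}) (\<lambda>_. walks (last (x # q)) k))"
  let ?h = "\<lambda>(y, g). (rev (butlast (y # take a (g i))), drop b (g i), restrict g ({..<s} - {i}))"
  have bwd: "rev (x # rev (butlast (y # take a (g i)))) = y # take a (g i) \<and>
      rev (butlast (y # take a (g i))) \<in> walks x a \<and> last (x # rev (butlast (y # take a (g i)))) = y"
    if "(y, g) \<in> ?F" for y g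
  proof -
    have sp: "is_spider (\<lambda>_. k) y g" and x: "x = (y # g i) ! a" using that z by auto
    note p = is_spider_path[OF sp i]
    have "is_path a y x (take a (g i))" using is_path_take_drop(1)[OF p, of a] ab x by simp
    note rp = is_path_rev[OF this]
    have "last (y # take a (g i)) = x"
      using last_Cons_take[of a "g i" y] p ab x by (simp add: is_path_def)
    then have "y # take a (g i) = butlast (y # take a (g i)) @ [x]"
      by (metis append_butlast_last_id list.distinct(1))
    then have "rev (x # rev (butlast (y # take a (g i)))) = y # take a (g i)" by simp
    then show ?thesis using rp is_path_walks[OF rp] unfolding is_path_def by blast
  qed
  have "card ?F \<le> card ?B"
  proof (rule card_inj_on_le[of ?h])
    show "inj_on ?h ?F"
    proof (rule inj_onI)
      fix u v assume uv: "u \<in> ?F" "v \<in> ?F" and eq: "?h u = ?h v"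
      obtain y g y' g' where yg: "u = (y, g)" "v = (y', g')" by (cases u, cases v)
      have F: "(y, g) \<in> ?F" "(y', g') \<in> ?F" using uv unfolding yg .
      have "rev (butlast (y # take a (g i))) = rev (butlast (y' # take a (g' i)))"
        using eq unfolding yg split prod.inject by (rule conjunct1)
      then have "y # take a (g i) = y' # take a (g' i)"
        using bwd[OF F(1)] bwd[OF F(2)] by metis
      moreover have "take (b - a) (drop a (g i)) = take (b - a) (drop a (g' i))"
        using uv yg z by simp
      moreover have "drop b (g i) = drop b (g' i)" using eq yg by simp
      moreover have split: "q = take a q @ take (b - a) (drop a q) @ drop b q" for q :: "'a list"
        using ab by (metis append_take_drop_id drop_drop le_add_diff_inverse2 less_imp_le)
      ultimately have e: "y = y'" "g i = g' i"
        using split[of "g i"] split[of "g' i"] by auto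
      have r: "restrict g ({..<s} - {i}) = restrict g' ({..<s} - {i})" using eq yg by simp
      have "g j = g' j" if "j < s" for j
        using fun_cong[OF r, of j] that e by (cases "j = i") auto
      moreover have "g \<in> extensional {..<s}" "g' \<in> extensional {..<s}"
        using uv yg by (auto simp: is_spider_def)
      ultimately have "g = g'" by (intro extensionalityI) auto
      then show "u = v" using e yg by simp
    qed
    show "?h ` ?F \<subseteq> ?B"
    proof
      fix r assume "r \<in> ?h ` ?F"
      then obtain w where w: "w \<in> ?F" "r = ?h w" by blast
      obtain y g where yg: "w = (y, g)" by (cases w)
      have F: "(y, g) \<in> ?F" using w yg by simp
      then have sp: "is_spider (\<lambda>_. k) y g" and e: "x = (y # g i) ! a" "p = take (b - a) (drop a (g i))"
        using z by auto
      have "last (x # p) = (y # g i) ! b"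
        using seg[OF sp] unfolding e is_path_def by blast
      then have "drop b (g i) \<in> walks (last (x # p)) (k - b)"
        using walks_take_drop(2)[OF is_path_walks[OF is_spider_path[OF sp i]], of b] ab by simp
      moreover have "g j \<in> walks y k" if "j < s" for j
        using is_path_walks[OF is_spider_path[OF sp that]] by simp
      then have "restrict g ({..<s} - {i}) \<in> PiE ({..<s} - {i}) (\<lambda>_. walks y k)" by auto
      ultimately show "r \<in> ?B"
        using bwd[OF F] w(2) unfolding yg by (simp del: last.simps butlast.simps)
    qed
    show "finite ?B" by (intro finite_SigmaI finite_cartesian_product finite_walks finite_PiE_walks) simp
  qed
  also have "real (card ?B) = (\<Sum>q\<in>walks x a. real (card (walks (last (x # p)) (k - b))) *
      real (card (PiE ({..<s} - {i}) (\<lambda>_. walks (last (x # q)) k))))"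
    by (subst card_SigmaI) (auto simp: finite_walks card_cartesian_product finite_PiE_walks simp del: last.simps)
  also have "\<dots> \<le> (\<Sum>q\<in>walks x a. D ^ (k - b) * D ^ ((s - 1) * k))"
  proof (intro sum_mono mult_mono card_walks)
    fix q
    have "real (card (PiE ({..<s} - {i}) (\<lambda>_. walks (last (x # q)) k))) \<le> D ^ (\<Sum>j\<in>{..<s} - {i}. k)"
      by (rule card_PiE_walks) simp
    also have "(\<Sum>j\<in>{..<s} - {i}. k) = (s - 1) * k" using i by simp
    finally show "real (card (PiE ({..<s} - {i}) (\<lambda>_. walks (last (x # q)) k))) \<le> D ^ ((s - 1) * k)" .
  qed (use D_nonneg in auto)
  also have "\<dots> = real (card (walks x a)) * (D ^ (k - b) * D ^ ((s - 1) * k))" by simp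
  also have "\<dots> \<le> D ^ a * (D ^ (k - b) * D ^ ((s - 1) * k))"
    using D_nonneg by (intro mult_right_mono card_walks) auto
  also have "\<dots> = D ^ (a + (k - b) + (s - 1) * k)" by (simp add: power_add)
  finally show "real (card ?F) \<le> D ^ (a + (k - b) + (s - 1) * k)" by simp
qed

text \<open>Truncating the legs to the lengths \<open>l\<close> gives a robust spider; the parts cut
  off are walks from its leaves.\<close>

lemma card_spiders_robust_part:
  assumes l: "\<And>i. i < s \<Longrightarrow> l i \<le> k"
  shows "real (card {(y, g). is_spider (\<lambda>_. k) y g \<and> (\<forall>i<s. good_path L' y (g i)) \<and>
       robust_spider L l (\<lambda>i. (y # g i) ! l i)})
     \<le> D ^ (\<Sum>i<s. k - l i) * real (card (robust_spiders L' L l))"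
proof (rule card_le_fibers[where f = "\<lambda>(y, g). (y, \<lambda>i\<in>{..<s}. take (l i) (g i))"])
  let ?A = "{(y, g). is_spider (\<lambda>_. k) y g \<and> (\<forall>i<s. good_path L' y (g i)) \<and>
       robust_spider L l (\<lambda>i. (y # g i) ! l i)}"
  let ?f = "\<lambda>(y, g). (y, \<lambda>i\<in>{..<s}. take (l i) (g i))"
  show finA: "finite ?A" by (rule finite_subset[OF _ finite_spiders[of "\<lambda>_. k"]]) auto
  show "finite (robust_spiders L' L l)" by (rule finite_robust_spiders)
  show "?f ` ?A \<subseteq> robust_spiders L' L l"
  proof
    fix z assume "z \<in> ?f ` ?A"
    then obtain w where w: "w \<in> ?A" "z = ?f w" by blast
    obtain y g where yg: "w = (y, g)" by (cases w)
    have sp: "is_spider (\<lambda>_. k) y g" and good: "\<forall>i<s. good_path L' y (g i)"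
      and rob: "robust_spider L l (\<lambda>i. (y # g i) ! l i)"
      using w yg by auto
    define h where "h = (\<lambda>i\<in>{..<s}. take (l i) (g i))"
    have td: "is_path (l i) y ((y # g i) ! l i) (h i)" if "i < s" for i
      using is_path_take_drop(1)[OF is_spider_path[OF sp that] l[OF that]] that by (simp add: h_def)
    have lasts: "last (y # h i) = (y # g i) ! l i" if "i < s" for i
      using td[OF that] by (simp add: is_path_def)
    have sub: "set (h i) \<subseteq> set (g i)" if "i < s" for i
      using that by (auto simp: h_def dest: in_set_takeD)
    have "is_spider l y h"
      unfolding is_spider_def
    proof (intro conjI allI impI)
      show "y \<in> V" using sp by (simp add: is_spider_def)
      show "h \<in> extensional {..<s}" by (simp add: h_def)
      show "is_path (l i) y (last (y # h i)) (h i)" if "i < s" for i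
        unfolding lasts[OF that] by (rule td[OF that])
      fix i j assume ij: "i < s" "j < s" "i \<noteq> j"
      show "set (h i) \<inter> set (h j) = {}"
        using is_spider_disjoint[OF sp ij] sub[OF ij(1)] sub[OF ij(2)] by blast
    qed
    moreover have "good_path L' y (h i)" if "i < s" for i
    proof -
      have "length (g i) = k" using is_spider_path[OF sp that] by (simp add: is_path_def)
      then show ?thesis
        using good_path_take_drop(1)[of L' y "g i" "l i"] good that l[OF that] by (simp add: h_def)
    qed
    moreover have "robust_spider L l (\<lambda>i. last (y # h i))"
      using rob robust_spider_cong[of l l "\<lambda>i. last (y # h i)" "\<lambda>i. (y # g i) ! l i" L] lasts by simp
    ultimately have "(y, h) \<in> robust_spiders L' L l"
      unfolding robust_spiders_def mem_Collect_eq split by blast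
    then show "z \<in> robust_spiders L' L l" using w yg by (simp add: h_def)
  qed
  fix z assume "z \<in> robust_spiders L' L l"
  obtain y0 g0 where z: "z = (y0, g0)" by (cases z)
  let ?F = "{w\<in>?A. ?f w = z}"
  let ?B = "PiE {..<s} (\<lambda>i. walks (last (y0 # g0 i)) (k - l i))"
  let ?h = "\<lambda>(y, g). \<lambda>i\<in>{..<s}. drop (l i) (g i)"
  have det: "is_spider (\<lambda>_. k) y g \<and> y = y0 \<and> (\<forall>i<s. take (l i) (g i) = g0 i)" if "(y, g) \<in> ?F" for y g
  proof -
    have "is_spider (\<lambda>_. k) y g" "y = y0" and e: "(\<lambda>i\<in>{..<s}. take (l i) (g i)) = g0"
      using that z by auto
    moreover have "\<forall>i<s. take (l i) (g i) = g0 i" unfolding e[symmetric] by simp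
    ultimately show ?thesis by blast
  qed
  have "card ?F \<le> card ?B"
  proof (rule card_inj_on_le[of ?h])
    show "inj_on ?h ?F"
    proof (rule inj_onI)
      fix u v assume uv: "u \<in> ?F" "v \<in> ?F" and eq: "?h u = ?h v"
      obtain y g y' g' where yg: "u = (y, g)" "v = (y', g')" by (cases u, cases v)
      have F: "(y, g) \<in> ?F" "(y', g') \<in> ?F" using uv unfolding yg .
      have d: "is_spider (\<lambda>_. k) y g" "y = y0" "\<forall>i<s. take (l i) (g i) = g0 i"
        using det[OF F(1)] by blast+
      have d': "is_spider (\<lambda>_. k) y' g'" "y' = y0" "\<forall>i<s. take (l i) (g' i) = g0 i"
        using det[OF F(2)] by blast+
      have "g i = g' i" if "i < s" for i
      proof -
        have "drop (l i) (g i) = drop (l i) (g' i)" using fun_cong[OF eq, of i] that yg by simp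
        moreover have "take (l i) (g i) = take (l i) (g' i)" using d d' that by simp
        ultimately show ?thesis by (metis append_take_drop_id)
      qed
      moreover have "g \<in> extensional {..<s}" "g' \<in> extensional {..<s}"
        using d d' by (auto simp: is_spider_def)
      ultimately have "g = g'" by (intro extensionalityI) auto
      then show "u = v" using d d' yg by simp
    qed
    show "?h ` ?F \<subseteq> ?B"
    proof
      fix r assume "r \<in> ?h ` ?F"
      then obtain w where w: "w \<in> ?F" "r = ?h w" by blast
      obtain y g where yg: "w = (y, g)" by (cases w)
      have F: "(y, g) \<in> ?F" using w(1) unfolding yg .
      have d: "is_spider (\<lambda>_. k) y g" "y = y0" "\<forall>i<s. take (l i) (g i) = g0 i"
        using det[OF F] by blast+
      have "drop (l i) (g i) \<in> walks (last (y0 # g0 i)) (k - l i)" if "i < s" for i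
      proof -
        note p = is_spider_path[OF d(1) that]
        have "last (y0 # g0 i) = (y # g i) ! l i"
          using last_Cons_take[of "l i" "g i" y] p d that l[OF that] by (simp add: is_path_def)
        then show ?thesis using walks_take_drop(2)[OF is_path_walks[OF p] l[OF that]] by simp
      qed
      then show "r \<in> ?B" using w(2) yg by (simp del: last.simps)
    qed
    show "finite ?B" by (rule finite_PiE_walks) simp
  qed
  also have "real (card ?B) \<le> D ^ (\<Sum>i<s. k - l i)" by (rule card_PiE_walks) simp
  finally show "real (card ?F) \<le> D ^ (\<Sum>i<s. k - l i)" by simp
qed

text \<open>A spider has a robust segment on some leg, or good legs with a robust truncation, or it
  is a good spider on its own leaves. The coefficients count the triples (leg, start, end of
  segment) and the length vectors, and \<open>card V ^ s\<close> counts the leaf tuples.\<close>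

lemma card_spiders_le:
  assumes s: "s > 0" and k: "k \<ge> 1" and e: "\<epsilon> \<ge> 0"
    and paths: "\<And>m. 2 \<le> m \<Longrightarrow> m \<le> k \<Longrightarrow> real (card (robust_paths L' m)) \<le> \<epsilon> * real (card V) * D ^ m"
    and spiders: "\<And>l. l \<in> PiE {..<s} (\<lambda>_. {1..k}) \<Longrightarrow>
        real (card (robust_spiders L' L l)) \<le> \<epsilon> * real (card V) * D ^ (\<Sum>i<s. l i)"
  shows "real (card {(y, g). is_spider (\<lambda>_. k) y g}) \<le>
     real (s * Suc k * Suc k + k ^ s) * \<epsilon> * real (card V) * D ^ (s * k)
       + real (spider_bound L' L s k (s * k)) * real (card V) ^ s"
proof -
  define N where "N = \<epsilon> * real (card V) * D ^ (s * k)"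
  have N0: "N \<ge> 0" using e D_nonneg by (simp add: N_def)
  define A1 where "A1 = (\<lambda>(i, a, b). {(y, g). is_spider (\<lambda>_. k) y g \<and> a + 2 \<le> b \<and> b \<le> k \<and>
     robust L' (b - a) ((y # g i) ! a) ((y # g i) ! b)})"
  define A2 where "A2 = (\<lambda>l. {(y, g). is_spider (\<lambda>_. k) y g \<and> (\<forall>i<s. good_path L' y (g i)) \<and>
       robust_spider L l (\<lambda>i. (y # g i) ! l i)})"
  define I1 where "I1 = {..<s} \<times> {..k} \<times> {..k}"
  define I2 where "I2 = PiE {..<s} (\<lambda>_. {1..k})"
  define I3 where "I3 = PiE {..<s} (\<lambda>_. V)"
  have finI: "finite I1" "finite I2" "finite I3"
    by (auto simp: I1_def I2_def I3_def finite_V intro!: finite_PiE)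
  have finA: "finite (A1 w)" "finite (A2 l)" for w l
    by (rule finite_subset[OF _ finite_spiders[of "\<lambda>_. k"]], auto simp: A1_def A2_def)+
  have sub: "{(y, g). is_spider (\<lambda>_. k) y g} \<subseteq> (\<Union>w\<in>I1. A1 w) \<union> (\<Union>l\<in>I2. A2 l) \<union>
      (\<Union>X\<in>I3. good_spiders L' L (\<lambda>_. k) X)"
  proof
    fix z assume z: "z \<in> {(y, g). is_spider (\<lambda>_. k) y g}"
    obtain y g where yg: "z = (y, g)" by (cases z)
    have sp: "is_spider (\<lambda>_. k) y g" using z yg by simp
    have len: "length (g i) = k" if "i < s" for i
      using is_spider_path[OF sp that] by (simp add: is_path_def)
    show "z \<in> (\<Union>w\<in>I1. A1 w) \<union> (\<Union>l\<in>I2. A2 l) \<union> (\<Union>X\<in>I3. good_spiders L' L (\<lambda>_. k) X)"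
    proof (cases "\<forall>i<s. good_path L' y (g i)")
      case False
      then obtain i a b where i: "i < s" and ab: "a + 2 \<le> b" "b \<le> length (g i)"
        "robust L' (b - a) ((y # g i) ! a) ((y # g i) ! b)"
        unfolding good_path_def by blast
      then have "z \<in> A1 (i, a, b)" "(i, a, b) \<in> I1"
        using sp len[OF i] by (auto simp: A1_def I1_def yg)
      then show ?thesis by blast
    next
      case good: True
      show ?thesis
      proof (cases "\<exists>l. (\<forall>i<s. 1 \<le> l i \<and> l i \<le> k) \<and> robust_spider L l (\<lambda>i. (y # g i) ! l i)")
        case True
        then obtain l where l: "\<forall>i<s. 1 \<le> l i \<and> l i \<le> k" "robust_spider L l (\<lambda>i. (y # g i) ! l i)"
          by blast
        define l' where "l' = restrict l {..<s}"
        have "l' \<in> I2" using l by (simp add: l'_def I2_def)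
        moreover have "robust_spider L l' (\<lambda>i. (y # g i) ! l' i)"
          using l(2) robust_spider_cong[of l l' "\<lambda>i. (y # g i) ! l i" "\<lambda>i. (y # g i) ! l' i" L]
          by (simp add: l'_def)
        then have "z \<in> A2 l'" using sp good by (simp add: A2_def yg)
        ultimately show ?thesis by blast
      next
        case False
        define X where "X = (\<lambda>i\<in>{..<s}. last (y # g i))"
        have "last (y # g i) \<in> V" if "i < s" for i
        proof -
          have "g i \<noteq> []" using len[OF that] k by auto
          then have "last (g i) \<in> set (g i)" by simp
          moreover have "set (g i) \<subseteq> V"
            by (rule walks_subset_V[OF is_path_walks[OF is_spider_path[OF sp that]]])
          ultimately show ?thesis using \<open>g i \<noteq> []\<close> by auto
        qed
        then have "X \<in> I3" by (simp add: X_def I3_def del: last.simps)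
        moreover have "z \<in> good_spiders L' L (\<lambda>_. k) X"
        proof -
          have "\<forall>i<s. last (y # g i) = X i" by (simp add: X_def)
          moreover have "\<forall>l'. (\<forall>i<s. 1 \<le> l' i \<and> l' i \<le> k) \<longrightarrow> \<not> robust_spider L l' (\<lambda>i. (y # g i) ! l' i)"
            using False by blast
          ultimately show ?thesis
            unfolding yg good_spiders_def mem_Collect_eq split using sp good by (intro conjI)
        qed
        ultimately show ?thesis by blast
      qed
    qed
  qed
  have c1: "real (card (A1 w)) \<le> N" if w: "w \<in> I1" for w
  proof -
    obtain i a b where iab: "w = (i, a, b)" "i < s" using w by (auto simp: I1_def)
    show ?thesis
    proof (cases "a + 2 \<le> b \<and> b \<le> k")
      case True
      then have "A1 w = {(y, g). is_spider (\<lambda>_. k) y g \<and> robust L' (b - a) ((y # g i) ! a) ((y # g i) ! b)}"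
        by (simp add: A1_def iab)
      then have "real (card (A1 w)) \<le> D ^ (a + (k - b) + (s - 1) * k) * real (card (robust_paths L' (b - a)))"
        using card_spiders_robust_segment[OF iab(2), of a b k L'] True by simp
      also have "\<dots> \<le> D ^ (a + (k - b) + (s - 1) * k) * (\<epsilon> * real (card V) * D ^ (b - a))"
        using True D_nonneg by (intro mult_left_mono paths) auto
      also have "\<dots> = \<epsilon> * real (card V) * D ^ ((a + (k - b) + (s - 1) * k) + (b - a))"
        by (simp add: power_add)
      also have "(a + (k - b) + (s - 1) * k) + (b - a) = s * k"
        using True s by (cases s) auto
      finally show ?thesis by (simp add: N_def)
    next
      case False
      then have "A1 w = {}" by (auto simp: A1_def iab)
      then show ?thesis using N0 by simp
    qed
  qed
  have c2: "real (card (A2 l)) \<le> N" if l: "l \<in> I2" for l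
  proof -
    have le: "l i \<le> k" if "i < s" for i using l that by (auto simp: I2_def PiE_def Pi_def)
    have "real (card (A2 l)) \<le> D ^ (\<Sum>i<s. k - l i) * real (card (robust_spiders L' L l))"
      unfolding A2_def by (rule card_spiders_robust_part[OF le])
    also have "\<dots> \<le> D ^ (\<Sum>i<s. k - l i) * (\<epsilon> * real (card V) * D ^ (\<Sum>i<s. l i))"
      using l D_nonneg by (intro mult_left_mono spiders) (auto simp: I2_def)
    also have "\<dots> = \<epsilon> * real (card V) * D ^ ((\<Sum>i<s. k - l i) + (\<Sum>i<s. l i))"
      by (simp add: power_add)
    also have "(\<Sum>i<s. k - l i) + (\<Sum>i<s. l i) = (\<Sum>i<s. k)"
      unfolding sum.distrib[symmetric] using le by (intro sum.cong) auto
    finally show ?thesis by (simp add: N_def)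
  qed
  have c3: "card (good_spiders L' L (\<lambda>_. k) X) \<le> spider_bound L' L s k (s * k)" for X
    using card_good_spiders[OF s, of "\<lambda>_. k" k L' L X] k by simp
  have "card {(y, g). is_spider (\<lambda>_. k) y g} \<le> card ((\<Union>w\<in>I1. A1 w) \<union> (\<Union>l\<in>I2. A2 l) \<union>
      (\<Union>X\<in>I3. good_spiders L' L (\<lambda>_. k) X))"
    using finI finA finite_good_spiders by (intro card_mono[OF _ sub]) auto
  also have "\<dots> \<le> card (\<Union>w\<in>I1. A1 w) + card (\<Union>l\<in>I2. A2 l) + card (\<Union>X\<in>I3. good_spiders L' L (\<lambda>_. k) X)"
    using card_Un_le[of "(\<Union>w\<in>I1. A1 w) \<union> (\<Union>l\<in>I2. A2 l)" "\<Union>X\<in>I3. good_spiders L' L (\<lambda>_. k) X"]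
      card_Un_le[of "\<Union>w\<in>I1. A1 w" "\<Union>l\<in>I2. A2 l"] by linarith
  also have "\<dots> \<le> (\<Sum>w\<in>I1. card (A1 w)) + (\<Sum>l\<in>I2. card (A2 l)) + (\<Sum>X\<in>I3. card (good_spiders L' L (\<lambda>_. k) X))"
    by (intro add_mono card_UN_le finI)
  finally have "real (card {(y, g). is_spider (\<lambda>_. k) y g}) \<le>
      (\<Sum>w\<in>I1. real (card (A1 w))) + (\<Sum>l\<in>I2. real (card (A2 l))) + (\<Sum>X\<in>I3. real (card (good_spiders L' L (\<lambda>_. k) X)))"
    unfolding of_nat_sum[symmetric] of_nat_add[symmetric] of_nat_le_iff .
  also have "\<dots> \<le> (\<Sum>w\<in>I1. N) + (\<Sum>l\<in>I2. N) + (\<Sum>X\<in>I3. real (spider_bound L' L s k (s * k)))"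
    using c1 c2 c3 by (intro add_mono sum_mono) (auto simp only: of_nat_le_iff)
  also have "\<dots> = real (card I1) * N + real (card I2) * N + real (card I3) * real (spider_bound L' L s k (s * k))"
    by simp
  also have "card I1 = s * Suc k * Suc k" by (simp add: I1_def card_cartesian_product algebra_simps)
  also have "card I2 = k ^ s" by (simp add: I2_def card_PiE)
  also have "card I3 = card V ^ s" by (simp add: I3_def card_PiE)
  finally show ?thesis by (simp add: N_def algebra_simps)
qed

end

section \<open>Choice of the tolerances and the degree threshold\<close>

section \<open>Few robust paths and spiders\<close>

text \<open>Maxima over finitely many cases. The degree threshold precedes the quantifier over
  \<open>L\<close>, so it serves all large tolerances at once.\<close>

lemma uniform_thresholds:
  fixes Q :: "'c \<Rightarrow> nat \<Rightarrow> real \<Rightarrow> bool"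
  assumes "finite A" "\<And>a. a \<in> A \<Longrightarrow> \<exists>L1 D1. \<forall>L\<ge>L1. \<forall>D\<ge>D1. Q a L D"
  shows "\<exists>L1 D1. \<forall>a\<in>A. \<forall>L\<ge>L1. \<forall>D\<ge>D1. Q a L D"
  using assms
proof (induction A)
  case (insert a A)
  from insert obtain L1 D1 where 1: "\<forall>a\<in>A. \<forall>L\<ge>L1. \<forall>D\<ge>D1. Q a L D" by auto
  from insert.prems[of a] obtain L2 D2 where 2: "\<forall>L\<ge>L2. \<forall>D\<ge>D2. Q a L D" by auto
  show ?case
    by (rule exI[of _ "max L1 L2"], rule exI[of _ "max D1 D2"]) (use 1 2 in auto)
qed auto

lemma mult_ge_of_ge_divide: "a > 0 \<Longrightarrow> D \<ge> b / a \<Longrightarrow> a * D \<ge> (b::real)"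
  by (simp add: pos_divide_le_eq mult.commute)

text \<open>The contrapositive form of the constructions from dense robust paths. The graph is
  quantified after the thresholds, which therefore depend only on \<open>s\<close>,
  \<open>k\<close>, \<open>L0\<close>, \<open>m\<close> and \<epsilon>.\<close>

lemma few_robust_paths:
  fixes s k L0 m :: nat and \<epsilon> :: real
  assumes s: "s > 0" and k: "k \<in> {3, 4}" and m: "2 \<le> m" "m \<le> k" and e: "\<epsilon> > 0"
  shows "\<exists>L1 D1. \<forall>L\<ge>L1. \<forall>D\<ge>D1. \<forall>(V :: 'a set) adj.
     bounded_graph V adj D \<and> V \<noteq> {} \<and> \<not> (\<exists>X. bounded_graph.robust_spider V adj s L0 (\<lambda>_. k) X) \<longrightarrow>
     real (card (bounded_graph.robust_paths adj L m)) \<le> \<epsilon> * real (card V) * D ^ m"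
proof -
  consider "m = k" | "m = 2" "k = 4" | "m = 3" "k = 4" | "m = 2" "k = 3"
    using m k by force
  then show ?thesis
  proof cases
    case 1
    define c where "c = (\<epsilon> / 4) ^ s * (\<epsilon> / 2)"
    have c: "c > 0" using e by (simp add: c_def)
    show ?thesis
    proof (rule exI[of _ "L0 + s + 1 + s * m"], rule exI[of _ "max (real s / (\<epsilon> / 4)) (real (L0 + s + 1) / c)"],
        intro allI impI, elim conjE)
      fix L D and V :: "'a set" and adj
      assume L: "L \<ge> L0 + s + 1 + s * m" and D: "D \<ge> max (real s / (\<epsilon> / 4)) (real (L0 + s + 1) / c)"
        and G: "bounded_graph V adj D" "V \<noteq> {}"
        and none: "\<not> (\<exists>X. bounded_graph.robust_spider V adj s L0 (\<lambda>_. k) X)"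
      interpret bounded_graph V adj D s by (rule G(1))
      have D1: "\<epsilon> / 4 * D \<ge> real s" using D e by (intro mult_ge_of_ge_divide) auto
      have "c * D \<ge> real (L0 + s + 1)" using D c by (intro mult_ge_of_ge_divide) auto
      then have D2: "(\<epsilon> / 4) ^ s * (\<epsilon> / 2) * D > real (L0 + s)" unfolding c_def by simp
      show "real (card (robust_paths L m)) \<le> \<epsilon> * real (card V) * D ^ m"
      proof (rule ccontr)
        assume "\<not> ?thesis"
        then have big: "real (card (robust_paths L m)) \<ge> \<epsilon> * real (card V) * D ^ m" by simp
        have "\<exists>X. robust_spider L0 (\<lambda>_. m) X" by (rule robust_spider_of_paths_eq[OF G(2) m(1) s e big L D1 D2])
        then show False using none 1 by simp
      qed
    qed
  next
    case 2
    define r where "r = s + (L0 + s + 1)"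
    define L' where "L' = L0 + s + 1 + s * 4"
    define c where "c = (\<epsilon> / 4) ^ r * (\<epsilon> / 2)"
    have c: "c > 0" using e by (simp add: c_def)
    show ?thesis
    proof (rule exI[of _ "L' + 4"], rule exI[of _ "max (real r / (\<epsilon> / 4)) (real (L' + 3) / c)"],
        intro allI impI, elim conjE)
      fix L D and V :: "'a set" and adj
      assume L: "L \<ge> L' + 4" and D: "D \<ge> max (real r / (\<epsilon> / 4)) (real (L' + 3) / c)"
        and G: "bounded_graph V adj D" "V \<noteq> {}"
        and none: "\<not> (\<exists>X. bounded_graph.robust_spider V adj s L0 (\<lambda>_. k) X)"
      interpret bounded_graph V adj D s by (rule G(1))
      have D1: "\<epsilon> / 4 * D \<ge> real r" using D e by (intro mult_ge_of_ge_divide) auto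
      have "c * D \<ge> real (L' + 3)" using D c by (intro mult_ge_of_ge_divide) auto
      then have D2: "(\<epsilon> / 4) ^ r * (\<epsilon> / 2) * D > real (L' + 2)" unfolding c_def by simp
      show "real (card (robust_paths L m)) \<le> \<epsilon> * real (card V) * D ^ m"
      proof (rule ccontr)
        assume "\<not> ?thesis"
        with 2 have big: "real (card (robust_paths L 2)) \<ge> \<epsilon> * real (card V) * D ^ 2" by simp
        have "\<exists>X. robust_spider L0 (\<lambda>_. 4) X" by (rule robust_spider_of_paths_4_2[OF G(2) s e big r_def L'_def L D1 D2])
        then show False using none 2 by simp
      qed
    qed
  next
    case 3
    define L' where "L' = L0 + s + 1 + s * 4"
    define c where "c = (\<epsilon> / 4) ^ s * (\<epsilon> / 2)"
    have c: "c / 2 > 0" using e by (simp add: c_def)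
    show ?thesis
    proof (rule exI[of _ "L' + 5"],
        rule exI[of _ "max (real s / (\<epsilon> / 4)) (max (real (L' + 3) / (c / 2)) (real (L0 + s + s + 1) / (c / 2)))"],
        intro allI impI, elim conjE)
      fix L D and V :: "'a set" and adj
      assume L: "L \<ge> L' + 5"
        and D: "D \<ge> max (real s / (\<epsilon> / 4)) (max (real (L' + 3) / (c / 2)) (real (L0 + s + s + 1) / (c / 2)))"
        and G: "bounded_graph V adj D" "V \<noteq> {}"
        and none: "\<not> (\<exists>X. bounded_graph.robust_spider V adj s L0 (\<lambda>_. k) X)"
      interpret bounded_graph V adj D s by (rule G(1))
      have D1: "\<epsilon> / 4 * D \<ge> real s" using D e by (intro mult_ge_of_ge_divide) auto
      have "c / 2 * D \<ge> real (L' + 3)" by (rule mult_ge_of_ge_divide[OF c]) (use D in simp)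
      then have D2: "c / 2 * D > real (L' + 2)" by linarith
      have "c / 2 * D \<ge> real (L0 + s + s + 1)" by (rule mult_ge_of_ge_divide[OF c]) (use D in simp)
      then have D3: "c / 2 * D > real (L0 + s + s)" by linarith
      show "real (card (robust_paths L m)) \<le> \<epsilon> * real (card V) * D ^ m"
      proof (rule ccontr)
        assume "\<not> ?thesis"
        with 3 have big: "real (card (robust_paths L 3)) \<ge> \<epsilon> * real (card V) * D ^ 3" by simp
        have "\<exists>X. robust_spider L0 (\<lambda>_. 4) X" by (rule robust_spider_of_paths_4_3[OF G(2) s e big L'_def L c_def D1 D2 D3])
        then show False using none 3 by simp
      qed
    qed
  next
    case 4
    define L' where "L' = L0 + s + 1 + s * 3"
    define f where "f = real (L' + 3) / (\<epsilon> / 4)"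
    define c where "c = (\<epsilon> / 8) ^ s"
    \<comment> \<open>\<open>B\<close> is the number of candidate centres from which a proportion
      \<open>c\<close> still leaves enough; \<open>M\<close> then makes the tolerance large enough
      to provide that many. In this case the tolerance, and not only the degree, has to absorb
      \<epsilon>.\<close>
    define B where "B = max (real (L0 + s + s + 1) / c) 1"
    define M where "M = nat \<lceil>(B + f) / (\<epsilon>\<^sup>2 / 4)\<rceil>"
    have c: "c > 0" using e by (simp add: c_def)
    show ?thesis
    proof (rule exI[of _ "max (L' + 4) M"], rule exI[of _ "real s / (\<epsilon> / 8)"], intro allI impI, elim conjE)
      fix L D and V :: "'a set" and adj
      assume L: "L \<ge> max (L' + 4) M" and D: "D \<ge> real s / (\<epsilon> / 8)"
        and G: "bounded_graph V adj D" "V \<noteq> {}"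
        and none: "\<not> (\<exists>X. bounded_graph.robust_spider V adj s L0 (\<lambda>_. k) X)"
      interpret bounded_graph V adj D s by (rule G(1))
      have 1: "\<epsilon> / 8 * D \<ge> real s" using D e by (intro mult_ge_of_ge_divide) auto
      have 2: "\<epsilon> / 4 * f \<ge> real (L' + 3)" using e by (simp add: f_def)
      have "(B + f) / (\<epsilon>\<^sup>2 / 4) \<le> real M" unfolding M_def by (rule real_nat_ceiling_ge)
      also have "real M \<le> real L" using L by simp
      finally have "\<epsilon>\<^sup>2 / 4 * real L \<ge> B + f" using e by (intro mult_ge_of_ge_divide) auto
      then have Lf: "real L * \<epsilon>\<^sup>2 / 4 - f \<ge> B" by (simp add: mult.commute)
      then have 3: "real L * \<epsilon>\<^sup>2 / 4 > f" by (simp add: B_def)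
      have "real L * \<epsilon>\<^sup>2 / 4 - f \<ge> real (L0 + s + s + 1) / c" using Lf by (simp add: B_def)
      then have "c * (real L * \<epsilon>\<^sup>2 / 4 - f) \<ge> real (L0 + s + s + 1)"
        by (rule mult_ge_of_ge_divide[OF c])
      then have 4: "(\<epsilon> / 8) ^ s * (real L * \<epsilon>\<^sup>2 / 4 - f) > real (L0 + s + s)"
        unfolding c_def by linarith
      have L4: "L \<ge> L' + 4" using L by simp
      show "real (card (robust_paths L m)) \<le> \<epsilon> * real (card V) * D ^ m"
      proof (rule ccontr)
        assume "\<not> ?thesis"
        with \<open>m = 2\<close> have big: "real (card (robust_paths L 2)) \<ge> \<epsilon> * real (card V) * D ^ 2" by simp
        have "\<exists>X. robust_spider L0 (\<lambda>_. 3) X" by (rule robust_spider_of_paths_3_2[OF G(2) s e big L'_def L4 2 4 3 1])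
        then show False using none \<open>k = 3\<close> by simp
      qed
    qed
  qed
qed

context bounded_graph
begin

lemma robust_spiders_cong:
  "(\<And>i. i < s \<Longrightarrow> l i = l' i) \<Longrightarrow> robust_spiders L' L l = robust_spiders L' L l'"
  using robust_spider_cong[of l l'] by (simp add: robust_spiders_def is_spider_def)

end

text \<open>A pair of legs of total length at most \<open>k\<close> reduces the claim to robust
  paths; otherwise the legs are all of length at least k / 2, or one of them is shorter. In the last
  case the degree threshold involves the number of good legs between given ends, so
  \<open>L'\<close> must be fixed beforehand.\<close>

lemma few_robust_spiders:
  fixes s k L0 L' :: nat and \<epsilon> :: real
  assumes s: "s > 0" and k: "k \<in> {3, 4}" and l: "\<And>i. i < s \<Longrightarrow> 1 \<le> l i \<and> l i \<le> k" and e: "\<epsilon> > 0"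
  shows "\<exists>L1 D1. \<forall>L\<ge>L1. \<forall>D\<ge>D1. \<forall>(V :: 'a set) adj.
     bounded_graph V adj D \<and> V \<noteq> {} \<and> \<not> (\<exists>X. bounded_graph.robust_spider V adj s L0 (\<lambda>_. k) X) \<longrightarrow>
     real (card (bounded_graph.robust_spiders V adj s L' L l)) \<le> \<epsilon> * real (card V) * D ^ (\<Sum>i<s. l i)"
proof -
  consider (short) i j where "i < s" "j < s" "i \<noteq> j" "l i + l j \<le> k"
    | (long) "\<forall>i<s. \<forall>j<s. i \<noteq> j \<longrightarrow> l i + l j > k" "\<forall>i<s. k \<le> 2 * l i"
    | (one) i0 where "\<forall>i<s. \<forall>j<s. i \<noteq> j \<longrightarrow> l i + l j > k" "i0 < s" "2 * l i0 < k"
    by (meson leI)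
  then show ?thesis
  proof cases
    case short
    have lij: "l i \<ge> 1" "l j \<ge> 1" using l short by auto
    have "\<exists>L1 D1. \<forall>L\<ge>L1. \<forall>D\<ge>D1. \<forall>(V :: 'a set) adj.
       bounded_graph V adj D \<and> V \<noteq> {} \<and> \<not> (\<exists>X. bounded_graph.robust_spider V adj s L0 (\<lambda>_. k) X) \<longrightarrow>
       real (card (bounded_graph.robust_paths adj L (l i + l j))) \<le> \<epsilon> * real (card V) * D ^ (l i + l j)"
      using lij short by (intro few_robust_paths[OF s k _ _ e]) auto
    then obtain L1 D1 where P: "\<forall>L\<ge>L1. \<forall>D\<ge>D1. \<forall>(V :: 'a set) adj.
       bounded_graph V adj D \<and> V \<noteq> {} \<and> \<not> (\<exists>X. bounded_graph.robust_spider V adj s L0 (\<lambda>_. k) X) \<longrightarrow>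
       real (card (bounded_graph.robust_paths adj L (l i + l j))) \<le> \<epsilon> * real (card V) * D ^ (l i + l j)"
      by (elim exE)
    show ?thesis
    proof (rule exI[of _ L1], rule exI[of _ D1], intro allI impI, elim conjE)
      fix L D and V :: "'a set" and adj
      assume L: "L \<ge> L1" and D: "D \<ge> D1" and G: "bounded_graph V adj D" "V \<noteq> {}"
        and none: "\<not> (\<exists>X. bounded_graph.robust_spider V adj s L0 (\<lambda>_. k) X)"
      interpret bounded_graph V adj D s by (rule G(1))
      have "real (card (robust_spiders L' L l)) \<le>
         D ^ (\<Sum>h\<in>{..<s} - {i, j}. l h) * real (card (robust_paths L (l i + l j)))"
        by (rule card_robust_spiders_le_paths[where i = i and j = j and l = l, OF short(1,2,3) lij])
      also have "\<dots> \<le> D ^ (\<Sum>h\<in>{..<s} - {i, j}. l h) * (\<epsilon> * real (card V) * D ^ (l i + l j))"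
        using P[rule_format, OF L D] G none D_nonneg by (intro mult_left_mono) auto
      also have "\<dots> = \<epsilon> * real (card V) * D ^ ((\<Sum>h\<in>{..<s} - {i, j}. l h) + (l i + l j))"
        by (simp add: power_add)
      also have "(\<Sum>h\<in>{..<s} - {i, j}. l h) + (l i + l j) = (\<Sum>h<s. l h)"
      proof -
        have "(\<Sum>h<s. l h) = (\<Sum>h\<in>{..<s} - {i, j}. l h) + (\<Sum>h\<in>{i, j}. l h)"
          using short by (intro sum.subset_diff) auto
        then show ?thesis using short by simp
      qed
      finally show "real (card (robust_spiders L' L l)) \<le> \<epsilon> * real (card V) * D ^ (\<Sum>h<s. l h)" .
    qed
  next
    case long
    show ?thesis
    proof (rule exI[of _ "L0 + s * (k + 1)"], rule exI[of _ "(real (s * k * L0) + 1) / \<epsilon>"], intro allI impI, elim conjE)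
      fix L D and V :: "'a set" and adj
      assume L: "L \<ge> L0 + s * (k + 1)" and D: "D \<ge> (real (s * k * L0) + 1) / \<epsilon>"
        and G: "bounded_graph V adj D" "V \<noteq> {}"
        and none: "\<not> (\<exists>X. bounded_graph.robust_spider V adj s L0 (\<lambda>_. k) X)"
      interpret bounded_graph V adj D s by (rule G(1))
      have "\<epsilon> * D \<ge> real (s * k * L0) + 1" by (rule mult_ge_of_ge_divide[OF e D])
      then have D': "\<epsilon> * D > real (s * k * L0)" by simp
      have k1: "k \<ge> 1" using k by auto
      show "real (card (robust_spiders L' L l)) \<le> \<epsilon> * real (card V) * D ^ (\<Sum>h<s. l h)"
      proof (rule ccontr)
        assume "\<not> ?thesis"
        then have "\<exists>X. robust_spider L0 (\<lambda>_. k) X"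
          using long l by (intro robust_spider_of_long_legs[OF s G(2) k1 e _ _ _ L D', where l = l and L' = L']) auto
        with none show False by blast
      qed
    qed
  next
    case one
    \<comment> \<open>From 2 * l i0 < k \<le> 4; since every pair of legs has total length more than
      \<open>k\<close>, all other legs then have length \<open>k\<close>.\<close>
    have li0: "l i0 = 1" using one(3) l[OF one(2)] k by auto
    have lk: "l j = k" if "j < s" "j \<noteq> i0" for j
      using one(1)[rule_format, OF one(2) that(1)] l[OF that(1)] that li0 by auto
    define T where "T = L0 + s + k + 1"
    define c where "c = (2 + real T * real (path_bound L' k ^ s)) * real T"
    show ?thesis
    proof (rule exI[of _ T], rule exI[of _ "c / \<epsilon>"], intro allI impI, elim conjE)
      fix L D and V :: "'a set" and adj
      assume L: "L \<ge> T" and D: "D \<ge> c / \<epsilon>"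
        and G: "bounded_graph V adj D" "V \<noteq> {}"
        and none: "\<not> (\<exists>X. bounded_graph.robust_spider V adj s L0 (\<lambda>_. k) X)"
      interpret bounded_graph V adj D s by (rule G(1))
      have "robust_spiders L' L l = robust_spiders L' L ((\<lambda>_. k)(i0 := 1))"
        by (rule robust_spiders_cong) (use li0 lk in auto)
      then have "real (card (robust_spiders L' L l)) \<le> c * (real (card V) * D ^ ((s - 1) * k))"
        using card_robust_spiders_short_leg[OF one(2) k none T_def L, of L'] by (simp add: c_def)
      also have "\<dots> \<le> (\<epsilon> * D) * (real (card V) * D ^ ((s - 1) * k))"
        using mult_ge_of_ge_divide[OF e D] D_nonneg by (intro mult_right_mono) auto
      also have "\<dots> = \<epsilon> * real (card V) * D ^ (1 + (s - 1) * k)" by simp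
      also have "1 + (s - 1) * k = (\<Sum>i<s. l i)"
      proof -
        have "(\<Sum>i<s. l i) = l i0 + (\<Sum>i\<in>{..<s} - {i0}. l i)"
          using one(2) by (intro sum.remove) auto
        also have "(\<Sum>i\<in>{..<s} - {i0}. l i) = (\<Sum>i\<in>{..<s} - {i0}. k)"
          by (intro sum.cong) (auto simp: lk)
        finally show ?thesis using one(2) li0 by simp
      qed
      finally show "real (card (robust_spiders L' L l)) \<le> \<epsilon> * real (card V) * D ^ (\<Sum>h<s. l h)" .
    qed
  qed
qed

text \<open>There are at least n * (\<delta> / 2) ^ (s * k) spiders, with n the number of vertices.
  Without a robust tuple the rare classes contain at most half of this number, and the remaining
  spiders are boundedly many for each of the n ^ s leaf tuples, so \<delta> ^ (s * k) = O(n ^ (s -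
  1)).\<close>

lemma exists_robust_spider:
  fixes s k L0 :: nat and \<kappa> :: real
  assumes s: "s > 0" and k: "k \<in> {3, 4}" and \<kappa>: "\<kappa> \<ge> 1"
  shows "\<exists>C \<delta>0. C > 0 \<and> \<delta>0 > 0 \<and> (\<forall>(V :: 'a set) adj \<delta>.
     bounded_graph V adj (\<kappa> * \<delta>) \<and> V \<noteq> {} \<and> (\<forall>v\<in>V. real (card {u. adj v u}) \<ge> \<delta>) \<and> \<delta> \<ge> \<delta>0 \<and>
       \<delta> ^ (s * k) > C * real (card V) ^ (s - 1) \<longrightarrow>
     (\<exists>X. bounded_graph.robust_spider V adj s L0 (\<lambda>_. k) X))"
proof -
  define N where "N = real (s * Suc k * Suc k + k ^ s)"
  \<comment> \<open>With \<open>N\<close> rare classes and D = \<kappa> * \<delta>, this makes their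
    total exactly half of n * (\<delta> / 2) ^ (s * k).\<close>
  define \<epsilon> where "\<epsilon> = 1 / (2 * N * (2 * \<kappa>) ^ (s * k))"
  have N: "N > 0" using k by (auto simp: N_def simp del: of_nat_add of_nat_mult)
  have e: "\<epsilon> > 0" using N \<kappa> by (simp add: \<epsilon>_def)
  have k1: "k \<ge> 1" using k by auto
  let ?ok = "\<lambda>(V :: 'a set) adj D. bounded_graph V adj D \<and> V \<noteq> {} \<and>
      \<not> (\<exists>X. bounded_graph.robust_spider V adj s L0 (\<lambda>_. k) X)"
  have "\<exists>L1 D1. \<forall>m\<in>{2..k}. \<forall>L\<ge>L1. \<forall>D\<ge>D1. \<forall>V adj. ?ok V adj D \<longrightarrow>
     real (card (bounded_graph.robust_paths adj L m)) \<le> \<epsilon> * real (card V) * D ^ m"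
    by (intro uniform_thresholds few_robust_paths[OF s k _ _ e]) auto
  then obtain L1 D1 where P: "\<forall>m\<in>{2..k}. \<forall>L\<ge>L1. \<forall>D\<ge>D1. \<forall>V adj. ?ok V adj D \<longrightarrow>
     real (card (bounded_graph.robust_paths adj L m)) \<le> \<epsilon> * real (card V) * D ^ m"
    by (elim exE)
  \<comment> \<open>The tolerance \<open>L1\<close> for paths now defines good legs;
    \<open>L2\<close> is chosen after it.\<close>
  have "\<exists>L2 D2. \<forall>l\<in>PiE {..<s} (\<lambda>_. {1..k}). \<forall>L\<ge>L2. \<forall>D\<ge>D2. \<forall>V adj. ?ok V adj D \<longrightarrow>
     real (card (bounded_graph.robust_spiders V adj s L1 L l)) \<le> \<epsilon> * real (card V) * D ^ (\<Sum>i<s. l i)"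
    by (intro uniform_thresholds few_robust_spiders[OF s k _ e] finite_PiE) (auto simp: PiE_def Pi_def)
  then obtain L2 D2 where Q: "\<forall>l\<in>PiE {..<s} (\<lambda>_. {1..k}). \<forall>L\<ge>L2. \<forall>D\<ge>D2. \<forall>V adj. ?ok V adj D \<longrightarrow>
     real (card (bounded_graph.robust_spiders V adj s L1 L l)) \<le> \<epsilon> * real (card V) * D ^ (\<Sum>i<s. l i)"
    by (elim exE)
  define M where "M = real (spider_bound L1 L2 s k (s * k))"
  define c where "c = s * k + k + 1"
  define C where "C = 2 * M * 2 ^ (s * k) + 1"
  \<comment> \<open>The entry \<open>2 * real c\<close> gives \<delta> - c \<ge> \<delta> / 2 in the
    lower bound for the number of spiders.\<close>
  define \<delta>0 where "\<delta>0 = max 1 (max (2 * real c) (max D1 D2))"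
  have M0: "M \<ge> 0" by (simp add: M_def)
  have "\<exists>X. bounded_graph.robust_spider V adj s L0 (\<lambda>_. k) X"
    if G: "bounded_graph V adj (\<kappa> * \<delta>)" "V \<noteq> {}" and deg: "\<forall>v\<in>V. real (card {u. adj v u}) \<ge> \<delta>"
      and d: "\<delta> \<ge> \<delta>0" "\<delta> ^ (s * k) > C * real (card V) ^ (s - 1)"
    for V :: "'a set" and adj \<delta>
  proof (rule ccontr)
    assume none: "\<not> ?thesis"
    interpret bounded_graph V adj "\<kappa> * \<delta>" s by (rule G(1))
    let ?D = "\<kappa> * \<delta>" and ?n = "real (card V)"
    have ok: "?ok V adj ?D" using G none by simp
    have d0: "\<delta> \<ge> 1" "\<delta> \<ge> 2 * real c" "\<delta> \<ge> D1" "\<delta> \<ge> D2" using d(1) by (auto simp: \<delta>0_def)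
    have "\<delta> \<le> ?D" using \<kappa> d0 by (simp add: mult_le_cancel_right1)
    then have D: "?D \<ge> D1" "?D \<ge> D2" using d0 by linarith+
    have n: "?n > 0" using G finite_V by (simp add: card_gt_0_iff)
    have "?n * (\<delta> / 2) ^ (s * k) \<le> ?n * ((\<delta> - real c) ^ k) ^ s"
    proof -
      have "(\<delta> / 2) ^ (s * k) \<le> (\<delta> - real c) ^ (s * k)" using d0 by (intro power_mono) auto
      then show ?thesis by (simp add: power_mult[symmetric] mult.commute mult_left_mono)
    qed
    also have "\<dots> \<le> real (card {(y, g). is_spider (\<lambda>_. k) y g})"
      using deg d0 by (intro card_spiders_ge) (auto simp: nb_def c_def)
    also have "\<dots> \<le> real (s * Suc k * Suc k + k ^ s) * \<epsilon> * ?n * ?D ^ (s * k)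
        + real (spider_bound L1 L2 s k (s * k)) * ?n ^ s"
    proof (rule card_spiders_le[OF s k1])
      show "\<epsilon> \<ge> 0" using e by simp
      show "real (card (robust_paths L1 m)) \<le> \<epsilon> * ?n * ?D ^ m" if "2 \<le> m" "m \<le> k" for m
        using P ok D(1) that by simp
      show "real (card (robust_spiders L1 L2 l)) \<le> \<epsilon> * ?n * ?D ^ (\<Sum>i<s. l i)"
        if "l \<in> PiE {..<s} (\<lambda>_. {1..k})" for l
        using Q[rule_format, OF that order_refl D(2) ok] .
    qed
    also have "real (s * Suc k * Suc k + k ^ s) * \<epsilon> * ?n * ?D ^ (s * k) = ?n * (\<delta> / 2) ^ (s * k) / 2"
    proof -
      have "N * \<epsilon> * (\<kappa> * \<delta>) ^ (s * k) = (\<delta> / 2) ^ (s * k) / 2"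
        using N \<kappa> by (simp add: \<epsilon>_def power_mult_distrib power_divide)
      then show ?thesis unfolding N_def[symmetric] by (metis mult.assoc mult.commute times_divide_eq_right)
    qed
    finally have "?n * (\<delta> / 2) ^ (s * k) / 2 \<le> M * ?n ^ s" by (simp add: M_def)
    also have "?n ^ s = ?n * ?n ^ (s - 1)" using s by (cases s) auto
    finally have "?n * ((\<delta> / 2) ^ (s * k) / 2) \<le> ?n * (M * ?n ^ (s - 1))" by (simp add: mult_ac)
    then have "(\<delta> / 2) ^ (s * k) / 2 \<le> M * ?n ^ (s - 1)" using n by (simp only: mult_le_cancel_left_pos)
    then have "\<delta> ^ (s * k) \<le> (2 * M * 2 ^ (s * k)) * ?n ^ (s - 1)"
      by (simp add: power_divide pos_divide_le_eq mult_ac)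
    also have "\<dots> \<le> C * ?n ^ (s - 1)" by (intro mult_right_mono) (auto simp: C_def)
    finally show False using d(2) by simp
  qed
  moreover have "C > 0" "\<delta>0 > 0" using M0 by (auto simp: C_def \<delta>0_def add_nonneg_pos)
  ultimately show ?thesis by blast
qed

section \<open>Embedding the subdivision and passing to an almost regular subgraph\<close>

section \<open>Subdivisions and almost regular subgraphs\<close>

context bounded_graph
begin

text \<open>The leaves become the left branch vertices and the centres of \<open>t\<close> greedily
  chosen spiders the right ones. Apart from its leaves a spider has at most \<open>s * k + 1\<close>
  vertices, whence the tolerance.\<close>

lemma contains_copy_of_robust_spider:
  assumes rob: "robust_spider (t * (s * k + 1)) (\<lambda>_. k) X"
    and k: "k \<ge> 1" and s: "s > 0" and t: "t > 0"
    and V: "V \<subseteq> verts G" and E: "\<And>u v. adj u v \<Longrightarrow> {u, v} \<in> edges G"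
  shows "contains_copy G (subdivided_K s t k)"
proof -
  let ?P = "\<lambda>_ z. is_spider (\<lambda>_. k) (fst z) (snd z) \<and> (\<forall>i<s. last (fst z # snd z i) = X i)"
  let ?core = "\<lambda>z. insert (fst z) (\<Union>i<s. set (butlast (snd z i)))"
  have "\<exists>z. (\<forall>j<t. ?P j (z j) \<and> ?core (z j) \<inter> {} = {}) \<and>
             (\<forall>j<t. \<forall>j'<t. j \<noteq> j' \<longrightarrow> ?core (z j) \<inter> ?core (z j') = {})"
  proof (rule greedy_disjoint[where B = "t * (s * k + 1)" and c = "s * k + 1"])
    fix T :: "'a set" assume "finite T" "card T \<le> t * (s * k + 1)"
    then have "\<exists>y g. is_spider (\<lambda>_. k) y g \<and> (\<forall>i<s. last (y # g i) = X i) \<and> y \<notin> T \<and>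
              (\<forall>i<s. set (butlast (g i)) \<inter> T = {})"
      using rob by (simp only: robust_spider_def simp_thms)
    then obtain y g where g: "is_spider (\<lambda>_. k) y g" "\<forall>i<s. last (y # g i) = X i" "y \<notin> T"
              "\<forall>i<s. set (butlast (g i)) \<inter> T = {}" by (elim exE conjE)
    have "?core (y, g) \<inter> T = {}" using g(3,4) by auto
    with g(1,2) show "\<exists>z. ?P i z \<and> ?core z \<inter> T = {}" for i :: nat
      by (intro exI[of _ "(y, g)"] conjI) simp_all
  next
    fix z :: "'a \<times> (nat \<Rightarrow> 'a list)" assume z: "?P i z" for i :: nat
    have "card (\<Union>i<s. set (butlast (snd z i))) \<le> (\<Sum>i<s. card (set (butlast (snd z i))))"
      by (rule card_UN_le) simp
    also have "\<dots> \<le> (\<Sum>i<s. k)"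
    proof (rule sum_mono)
      fix i assume "i \<in> {..<s}"
      then have "length (snd z i) = k"
        using z is_spider_path[of "\<lambda>_. k" "fst z" "snd z" i] by (simp add: is_path_def)
      then show "card (set (butlast (snd z i))) \<le> k" using card_length[of "butlast (snd z i)"] by simp
    qed
    finally show "finite (?core z) \<and> card (?core z) \<le> s * k + 1"
      using card_insert_le_m1[of "Suc (s * k)" "\<Union>i<s. set (butlast (snd z i))" "fst z"] by simp
  qed auto
  then obtain z where z: "\<forall>j<t. ?P j (z j) \<and> ?core (z j) \<inter> {} = {}"
     "\<forall>j<t. \<forall>j'<t. j \<noteq> j' \<longrightarrow> ?core (z j) \<inter> ?core (z j') = {}"
    by (elim exE conjE)
  define Y where "Y j = fst (z j)" for j
  define g where "g j = snd (z j)" for j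
  have sp: "is_spider (\<lambda>_. k) (Y j) (g j)" if "j < t" for j
    using z(1) that by (simp add: Y_def g_def)
  have path: "is_path k (Y j) (X i) (g j i)" if "i < s" "j < t" for i j
  proof -
    have "last (Y j # g j i) = X i" using z(1) that unfolding Y_def g_def by blast
    with is_spider_path[OF sp[OF that(2)] that(1)] show ?thesis by (simp only:)
  qed
  have len: "length (g j i) = k" if "i < s" "j < t" for i j
    using path[OF that] by (simp add: is_path_def)
  have Ynot: "Y j \<notin> set (g j i)" and Xin: "X i \<in> set (g j i)" and Xnot: "X i \<notin> set (butlast (g j i))"
    if "i < s" "j < t" for i j
    using is_path_set[OF path[OF that] k] by auto
  have legs: "set (g j i) \<inter> set (g j i') = {}" if "j < t" "i < s" "i' < s" "i \<noteq> i'" for i i' j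
    by (rule is_spider_disjoint[OF sp[OF that(1)] that(2-4)])
  have cores: "?core (z j) \<inter> ?core (z j') = {}" if "j < t" "j' < t" "j \<noteq> j'" for j j'
    using z(2) that by blast
  have Ycore: "Y j \<in> ?core (z j)" for j by (simp add: Y_def)
  \<comment> \<open>Legs run from the centre, the image of \<open>Right j\<close>, while
    \<open>path_vertex\<close> counts from \<open>Left i\<close>; so the index is reversed to
    \<open>k - m\<close>.\<close>
  define f where "f = (\<lambda>x. case x of Left i \<Rightarrow> X i | Right j \<Rightarrow> Y j | Inner i j m \<Rightarrow> (Y j # g j i) ! (k - m))"
  have fpv: "f (path_vertex k i j m) = (Y j # g j i) ! (k - m)" if "i < s" "j < t" "m \<le> k" for i j m
  proof -
    have "(Y j # g j i) ! k = last (Y j # g j i)"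
      using last_conv_nth[of "Y j # g j i"] len[OF that(1,2)] by simp
    also have "\<dots> = X i" using path[OF that(1,2)] by (simp add: is_path_def)
    finally show ?thesis using k by (auto simp: f_def path_vertex_def)
  qed
  have inner: "f (Inner i j m) = g j i ! (k - m - 1) \<and> k - m - 1 < k - 1 \<and>
      f (Inner i j m) \<in> set (butlast (g j i)) \<and> f (Inner i j m) \<in> set (g j i) \<and> f (Inner i j m) \<in> ?core (z j)"
    if "i < s" "j < t" "0 < m" "m < k" for i j m
  proof -
    have 1: "f (Inner i j m) = g j i ! (k - m - 1)" using that by (simp add: f_def)
    have 2: "k - m - 1 < k - 1" using that by simp
    have "butlast (g j i) ! (k - m - 1) = g j i ! (k - m - 1)"
      using 2 len[OF that(1,2)] by (intro nth_butlast) simp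
    then have 3: "f (Inner i j m) \<in> set (butlast (g j i))"
      using 1 2 len[OF that(1,2)] by (metis length_butlast nth_mem)
    then have "f (Inner i j m) \<in> set (g j i)" by (rule in_set_butlastD)
    moreover have "f (Inner i j m) \<in> ?core (z j)" using 3 that(1) by (auto simp: g_def)
    ultimately show ?thesis using 1 2 3 by blast
  qed
  let ?H = "subdivided_K s t k"
  have LL: "i = i'" if "i < s" "i' < s" "X i = X i'" for i i'
    using legs[OF t that(1,2)] Xin[OF that(1) t] Xin[OF that(2) t] that(3) by (metis disjoint_iff)
  have RR: "j = j'" if "j < t" "j' < t" "Y j = Y j'" for j j'
    using cores[OF that(1,2)] Ycore[of j] Ycore[of j'] that(3) by (metis disjoint_iff)
  have LR: "X i \<noteq> Y j" if "i < s" "j < t" for i j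
    using Ynot[OF that] Xin[OF that] by auto
  have LI: "X i' \<noteq> f (Inner i j m)" if "i' < s" "i < s" "j < t" "0 < m" "m < k" for i i' j m
  proof (cases "i = i'")
    case True
    then show ?thesis using inner[OF that(2-5)] Xnot[OF that(2,3)] by metis
  next
    case False
    then show ?thesis
      using inner[OF that(2-5)] Xin[OF that(1,3)] legs[OF that(3,2,1)] by (metis disjoint_iff)
  qed
  have RI: "Y j' \<noteq> f (Inner i j m)" if "j' < t" "i < s" "j < t" "0 < m" "m < k" for i j j' m
  proof (cases "j = j'")
    case True
    then show ?thesis using inner[OF that(2-5)] Ynot[OF that(2,3)] by metis
  next
    case False
    then show ?thesis
      using inner[OF that(2-5)] Ycore[of j'] cores[OF that(3,1)] by (metis disjoint_iff)
  qed
  have II: "i = i' \<and> j = j' \<and> m = m'"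
    if "i < s" "j < t" "0 < m" "m < k" "i' < s" "j' < t" "0 < m'" "m' < k" "f (Inner i j m) = f (Inner i' j' m')"
    for i j m i' j' m'
  proof -
    note a = inner[OF that(1-4)] and b = inner[OF that(5-8)]
    have j: "j = j'"
      using cores[OF that(2,6)] a b that(9) by (metis disjoint_iff)
    have i: "i = i'"
      using legs[OF that(2,1,5)] a b that(9) j by (metis disjoint_iff)
    have "distinct (g j i)" using path[OF that(1,2)] by (simp add: is_path_def)
    moreover have "g j i ! (k - m - 1) = g j i ! (k - m' - 1)" using a b that(9) i j by simp
    ultimately have "k - m - 1 = k - m' - 1"
      using len[OF that(1,2)] that by (subst (asm) nth_eq_iff_index_eq) auto
    then show ?thesis using i j that by simp
  qed
  have vH: "verts ?H = Left ` {..<s} \<union> Right ` {..<t} \<union> {Inner i j m | i j m. i < s \<and> j < t \<and> 0 < m \<and> m < k}"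
    by (simp add: subdivided_K_def verts_def)
  have fL: "f (Left i) = X i" and fR: "f (Right j) = Y j" for i j by (simp_all add: f_def)
  have "inj_on f (verts ?H)"
  proof (rule inj_onI)
    fix a b assume a: "a \<in> verts ?H" and b: "b \<in> verts ?H" and eq: "f a = f b"
    show "a = b"
    proof (cases a)
      case (Left i)
      then have i: "i < s" using a by (auto simp: vH)
      show ?thesis
      proof (cases b)
        case (Left i')
        then show ?thesis using \<open>a = Left i\<close> LL[of i i'] i b eq by (auto simp: vH fL)
      next
        case (Right j)
        then show ?thesis using \<open>a = Left i\<close> LR[of i j] i b eq by (auto simp: vH fL fR)
      next
        case (Inner i' j m)
        then show ?thesis using \<open>a = Left i\<close> LI[of i i' j m] i b eq by (auto simp: vH fL)
      qed
    next
      case (Right j)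
      then have j: "j < t" using a by (auto simp: vH)
      show ?thesis
      proof (cases b)
        case (Left i)
        then show ?thesis using \<open>a = Right j\<close> LR[of i j] j b eq by (auto simp: vH fL fR)
      next
        case (Right j')
        then show ?thesis using \<open>a = Right j\<close> RR[of j j'] j b eq by (auto simp: vH fR)
      next
        case (Inner i j' m)
        then show ?thesis using \<open>a = Right j\<close> RI[of j i j' m] j b eq by (auto simp: vH fR)
      qed
    next
      case (Inner i j m)
      then have ijm: "i < s" "j < t" "0 < m" "m < k" using a by (auto simp: vH)
      show ?thesis
      proof (cases b)
        case (Left i')
        then show ?thesis using \<open>a = Inner i j m\<close> LI[of i' i j m] ijm b eq by (auto simp: vH fL)
      next
        case (Right j')
        then show ?thesis using \<open>a = Inner i j m\<close> RI[of j' i j m] ijm b eq by (auto simp: vH fR)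
      next
        case (Inner i' j' m')
        then have "i' < s" "j' < t" "0 < m'" "m' < k" using b by (auto simp: vH)
        then show ?thesis
          using II[of i j m i' j' m'] ijm eq \<open>a = Inner i j m\<close> Inner by simp
      qed
    qed
  qed
  moreover have "f ` verts ?H \<subseteq> verts G"
  proof -
    have YV: "Y j \<in> V" if "j < t" for j using sp[OF that] by (simp add: is_spider_def)
    have gV: "set (g j i) \<subseteq> V" if "i < s" "j < t" for i j
      by (rule walks_subset_V[OF is_path_walks[OF path[OF that]]])
    have "f x \<in> V" if x: "x \<in> verts ?H" for x
    proof (cases x)
      case (Left i)
      then have "i < s" using x by (auto simp: vH)
      then show ?thesis using Left Xin[of i 0] gV[of i 0] t by (auto simp: fL)
    next
      case (Right j)
      then show ?thesis using x YV by (auto simp: vH fR)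
    next
      case (Inner i j m)
      then have "i < s" "j < t" "0 < m" "m < k" using x by (auto simp: vH)
      then show ?thesis using Inner inner[of i j m] gV[of i j] by blast
    qed
    then show ?thesis using V by blast
  qed
  moreover have "f ` e \<in> edges G" if e: "e \<in> edges ?H" for e
  proof -
    obtain i j m where ijm: "e = {path_vertex k i j m, path_vertex k i j (Suc m)}" "i < s" "j < t" "m < k"
      using e by (auto simp: subdivided_K_def edges_def)
    define q where "q = k - Suc m"
    have q: "k - m = Suc q" "q < k" using ijm by (auto simp: q_def)
    have "walk_from adj (Y j) (g j i)" using path[OF ijm(2,3)] by (simp add: is_path_def)
    then have "adj ((Y j # g j i) ! q) (g j i ! q)"
      using q len[OF ijm(2,3)] by (simp add: walk_from_nth)
    then have "{(Y j # g j i) ! q, (Y j # g j i) ! (k - m)} \<in> edges G"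
      using E q by simp
    moreover have "f ` e = {(Y j # g j i) ! (k - m), (Y j # g j i) ! q}"
      using ijm by (simp add: fpv q_def)
    ultimately show ?thesis by (simp add: insert_commute)
  qed
  ultimately show ?thesis unfolding contains_copy_def by blast
qed

end

section \<open>Almost regular subgraphs\<close>

lemma exists_maximal:
  fixes f :: "'b \<Rightarrow> real"
  assumes "finite A" "A \<noteq> {}"
  shows "\<exists>a\<in>A. \<forall>b\<in>A. f b \<le> f a"
proof -
  have "Max (f ` A) \<in> f ` A" using assms by (intro Max_in) auto
  then obtain a where "a \<in> A" "f a = Max (f ` A)" by auto
  then show ?thesis using assms by (intro bexI[of _ a]) auto
qed

text \<open>Number the elements of \<open>S\<close> and take residues modulo \<open>K\<close>;
  within one class the quotient by \<open>K\<close> determines the element.\<close>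

lemma balanced_partition:
  assumes "finite S" "K > 0"
  shows "\<exists>h. \<forall>i. card {v\<in>S. h v mod K = i} \<le> card S div K + (1::nat)"
proof -
  obtain h where h: "bij_betw h S {0..<card S}"
    using ex_bij_betw_finite_nat[OF assms(1)] by blast
  have "card {v\<in>S. h v mod K = i} \<le> card S div K + 1" for i
  proof -
    have "card {v\<in>S. h v mod K = i} \<le> card {..card S div K}"
    proof (rule card_inj_on_le[of "\<lambda>v. h v div K"])
      show "inj_on (\<lambda>v. h v div K) {v\<in>S. h v mod K = i}"
      proof (rule inj_onI)
        fix u v assume "u \<in> {v\<in>S. h v mod K = i}" "v \<in> {v\<in>S. h v mod K = i}" "h u div K = h v div K"
        then have "h u mod K = h v mod K" "h u div K = h v div K" "u \<in> S" "v \<in> S" by simp_all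
        then have "h u = h v" "u \<in> S" "v \<in> S" by (metis div_mult_mod_eq)+
        then show "u = v" using h by (auto simp: bij_betw_def inj_on_def)
      qed
      show "(\<lambda>v. h v div K) ` {v\<in>S. h v mod K = i} \<subseteq> {..card S div K}"
      proof
        fix x assume "x \<in> (\<lambda>v. h v div K) ` {v\<in>S. h v mod K = i}"
        then obtain v where "v \<in> S" "x = h v div K" by auto
        moreover from this have "h v < card S" using h by (auto simp: bij_betw_def)
        ultimately show "x \<in> {..card S div K}" by (simp add: div_le_mono)
      qed
    qed simp
    then show ?thesis by simp
  qed
  then show ?thesis by blast
qed

text \<open>The first step maximises \<open>e(S) / |S| powr (1 + \<alpha>)\<close>; then the vertices of large degree
  carry at most half of the edges, since otherwise joining them to one class of a balanced partition
  would give a denser set.\<close>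

lemma almost_regular_subgraph:
  fixes E :: "'a set set" and V :: "'a set" and \<alpha> C :: real and K :: nat
  assumes fin: "finite V" and E: "\<And>e. e \<in> E \<Longrightarrow> e \<subseteq> V \<and> card e = 2" and V: "V \<noteq> {}"
    and \<alpha>: "\<alpha> > 0" and K: "K > 0" "real K powr \<alpha> > 2 * 3 powr (1 + \<alpha>)"
    and C: "C \<ge> real K"
    and big: "real (card E) \<ge> C * real (card V) powr (1 + \<alpha>)"
  shows "\<exists>T \<delta>. T \<subseteq> V \<and> T \<noteq> {} \<and> \<delta> \<ge> C / 4 * real (card T) powr \<alpha> \<and>
     (\<forall>v\<in>T. \<delta> \<le> real (card {e\<in>E. v \<in> e \<and> e \<subseteq> T}) \<and> real (card {e\<in>E. v \<in> e \<and> e \<subseteq> T}) \<le> 8 * real K * \<delta>)"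
proof -
  have finE: "finite E" using E fin by (intro finite_subset[of E "Pow V"]) auto
  define eT where "eT S = card {e\<in>E. e \<subseteq> S}" for S
  define \<rho> where "\<rho> S = real (eT S) / real (card S) powr (1 + \<alpha>)" for S
  have "\<exists>S\<in>Pow V - {{}}. \<forall>T\<in>Pow V - {{}}. \<rho> T \<le> \<rho> S"
    using fin V by (intro exists_maximal) auto
  then obtain S where S: "S \<subseteq> V" "S \<noteq> {}" and max: "\<And>T. T \<subseteq> V \<Longrightarrow> T \<noteq> {} \<Longrightarrow> \<rho> T \<le> \<rho> S"
    by auto
  define m where "m = real (card S)"
  define e where "e = real (eT S)"
  have eT_empty: "eT {} = 0"
  proof -
    have "{f\<in>E. f \<subseteq> {}} = {}" using E by fastforce
    then show ?thesis by (simp only: eT_def card.empty)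
  qed
  have finS: "finite S" using S fin finite_subset by blast
  have m1: "m \<ge> 1" using S finS by (simp add: m_def Suc_le_eq card_gt_0_iff)
  have C0: "C > 0" using C K by linarith
  have eV: "eT V = card E" unfolding eT_def using E by (metis (mono_tags, lifting) Collect_cong Collect_mem_eq)
  have "C \<le> \<rho> V"
    using big fin V unfolding \<rho>_def eV by (subst pos_le_divide_eq) (auto simp: card_gt_0_iff)
  also have "\<dots> \<le> \<rho> S" using V by (intro max) auto
  finally have Cr: "C \<le> \<rho> S" .
  then have e_ge: "e \<ge> C * m powr (1 + \<alpha>)"
    using m1 unfolding \<rho>_def e_def[symmetric] m_def[symmetric] by (simp add: pos_le_divide_eq)
  have e0: "e > 0" using e_ge C0 m1 by (smt (verit) mult_pos_pos powr_gt_zero)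
  \<comment> \<open>Needed so that rounding up the size of a class costs at most another m /
    K.\<close>
  have mK: "m \<ge> real K"
  proof -
    have "{f\<in>E. f \<subseteq> S} \<subseteq> (\<lambda>(u, v). {u, v}) ` (S \<times> S)"
    proof
      fix f assume f: "f \<in> {f\<in>E. f \<subseteq> S}"
      then have "card f = 2" using E by auto
      then obtain u v where "f = {u, v}" by (auto simp: card_2_iff)
      then show "f \<in> (\<lambda>(u, v). {u, v}) ` (S \<times> S)" using f by auto
    qed
    then have "eT S \<le> card (S \<times> S)"
      unfolding eT_def using finS by (intro surj_card_le) auto
    then have "e \<le> m * m" by (simp add: e_def m_def card_cartesian_product flip: of_nat_mult)
    moreover have "C * m \<le> e"
    proof -
      have "m powr 1 \<le> m powr (1 + \<alpha>)" using m1 \<alpha> by (intro powr_mono) auto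
      then have "C * m \<le> C * m powr (1 + \<alpha>)" using m1 C0 by simp
      then show ?thesis using e_ge by linarith
    qed
    ultimately have "m * C \<le> m * m" by (simp add: mult.commute)
    then show ?thesis using m1 C by simp
  qed
  define deg where "deg v = real (card {f\<in>E. v \<in> f \<and> f \<subseteq> S})" for v
  have handshake: "(\<Sum>v\<in>S. deg v) = 2 * e"
  proof -
    have "(\<Sum>v\<in>S. deg v) = (\<Sum>v\<in>S. real (card {f\<in>{f\<in>E. f \<subseteq> S}. v \<in> f}))"
      by (simp add: deg_def conj_ac)
    also have "\<dots> = (\<Sum>f\<in>{f\<in>E. f \<subseteq> S}. real (card {v\<in>S. v \<in> f}))"
      by (rule double_count) (auto simp: finE finS)
    also have "\<dots> = (\<Sum>f\<in>{f\<in>E. f \<subseteq> S}. 2)"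
    proof (rule sum.cong[OF refl])
      fix f assume f: "f \<in> {f\<in>E. f \<subseteq> S}"
      then have "{v\<in>S. v \<in> f} = f" by auto
      then show "real (card {v\<in>S. v \<in> f}) = 2" using E f by simp
    qed
    finally show ?thesis by (simp add: e_def eT_def)
  qed
  \<comment> \<open>The threshold is \<open>K\<close> times the average degree 2 * e / m, so
    \<open>A\<close> contains at most m / K vertices.\<close>
  define A where "A = {v\<in>S. deg v > 2 * real K * e / m}"
  have finA: "finite A" by (simp add: A_def finS)
  have cA: "real (card A) \<le> m / real K"
  proof -
    have "real (card A) * (2 * real K * e / m) = (\<Sum>v\<in>A. 2 * real K * e / m)" by simp
    also have "\<dots> \<le> (\<Sum>v\<in>A. deg v)" by (intro sum_mono) (auto simp: A_def)
    also have "\<dots> \<le> (\<Sum>v\<in>S. deg v)" by (intro sum_mono2) (auto simp: A_def finS deg_def)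
    also have "\<dots> = 2 * e" by (rule handshake)
    finally show ?thesis using e0 m1 K by (simp add: field_simps)
  qed
  have EA: "real (card {f\<in>E. f \<subseteq> S \<and> f \<inter> A \<noteq> {}}) \<le> e / 2"
  proof -
    obtain h where h: "\<And>i. card {v\<in>S. h v mod K = i} \<le> card S div K + 1"
      using balanced_partition[OF finS K(1)] by blast
    \<comment> \<open>An edge meeting \<open>A\<close> has its other end in one of the classes,
      hence lies inside some \<open>B i\<close>. As \<open>B i\<close> has at most 3 * m / K
      vertices, the maximality of \<open>S\<close> leaves it at most e * (3 / K) powr (1 + \<alpha>)
      edges, and summing over \<open>K\<close> classes still gains a factor K powr \<alpha>.\<close>
    define B where "B i = A \<union> {v\<in>S. h v mod K = i}" for i
    have "{f\<in>E. f \<subseteq> S \<and> f \<inter> A \<noteq> {}} \<subseteq> (\<Union>i<K. {f\<in>E. f \<subseteq> B i})"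
    proof
      fix f assume f: "f \<in> {f\<in>E. f \<subseteq> S \<and> f \<inter> A \<noteq> {}}"
      then have "card f = 2" using E by auto
      then obtain u v where uv: "f = {u, v}" by (auto simp: card_2_iff)
      then have "\<exists>a b. f = {a, b} \<and> a \<in> A" using f by auto
      then obtain a b where ab: "f = {a, b}" "a \<in> A" by blast
      then have "f \<subseteq> B (h b mod K)" using f by (auto simp: B_def)
      moreover have "h b mod K < K" using K by simp
      ultimately show "f \<in> (\<Union>i<K. {f\<in>E. f \<subseteq> B i})" using f by blast
    qed
    then have "card {f\<in>E. f \<subseteq> S \<and> f \<inter> A \<noteq> {}} \<le> card (\<Union>i<K. {f\<in>E. f \<subseteq> B i})"
      using finE by (intro card_mono) auto
    also have "\<dots> \<le> (\<Sum>i<K. card {f\<in>E. f \<subseteq> B i})" by (rule card_UN_le) simp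
    finally have "real (card {f\<in>E. f \<subseteq> S \<and> f \<inter> A \<noteq> {}}) \<le> (\<Sum>i<K. real (eT (B i)))"
      by (simp add: eT_def flip: of_nat_sum)
    also have "\<dots> \<le> (\<Sum>i<K. e * (3 / real K) powr (1 + \<alpha>))"
    proof (rule sum_mono)
      fix i
      have BS: "B i \<subseteq> S" by (auto simp: B_def A_def)
      have "real (card (B i)) \<le> real (card A) + real (card {v\<in>S. h v mod K = i})"
        unfolding B_def of_nat_add[symmetric] of_nat_le_iff by (rule card_Un_le)
      also have "\<dots> \<le> m / real K + (m / real K + 1)"
      proof -
        have "real (card S div K) \<le> m / real K" unfolding m_def by (rule of_nat_div_le_of_nat)
        then show ?thesis using cA h[of i] by linarith
      qed
      also have "\<dots> \<le> 3 * m / real K"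
        using mK K by (simp add: field_simps)
      finally have cB: "real (card (B i)) \<le> 3 * m / real K" .
      show "real (eT (B i)) \<le> e * (3 / real K) powr (1 + \<alpha>)"
      proof (cases "B i = {}")
        case True
        then show ?thesis using e0 eT_empty by simp
      next
        case False
        have pos: "real (card (B i)) > 0"
          using False BS finS finite_subset by (auto simp: card_gt_0_iff)
        have "\<rho> (B i) \<le> \<rho> S" using False BS S by (intro max) auto
        then have "real (eT (B i)) \<le> \<rho> S * real (card (B i)) powr (1 + \<alpha>)"
          using pos by (simp add: \<rho>_def[of "B i"] pos_divide_le_eq)
        also have "\<dots> \<le> \<rho> S * (3 * m / real K) powr (1 + \<alpha>)"
          using cB Cr C0 \<alpha> by (intro mult_left_mono powr_mono2) auto
        also have "(3 * m / real K) powr (1 + \<alpha>) = m powr (1 + \<alpha>) * (3 / real K) powr (1 + \<alpha>)"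
          using m1 K by (simp add: powr_mult[symmetric] mult.commute)
        also have "\<rho> S * (m powr (1 + \<alpha>) * (3 / real K) powr (1 + \<alpha>)) = e * (3 / real K) powr (1 + \<alpha>)"
          using m1 by (simp add: \<rho>_def e_def m_def)
        finally show ?thesis .
      qed
    qed
    also have "\<dots> = e * (3 powr (1 + \<alpha>) / real K powr \<alpha>)"
      using K by (simp add: powr_divide powr_add)
    also have "\<dots> \<le> e * (1 / 2)"
      using e0 K by (intro mult_left_mono) (auto simp: pos_divide_le_eq)
    finally show ?thesis by simp
  qed
  define S' where "S' = S - A"
  have eS': "real (eT S') \<ge> e / 2"
  proof -
    have "{f\<in>E. f \<subseteq> S} \<subseteq> {f\<in>E. f \<subseteq> S'} \<union> {f\<in>E. f \<subseteq> S \<and> f \<inter> A \<noteq> {}}"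
      by (auto simp: S'_def)
    then have "eT S \<le> card ({f\<in>E. f \<subseteq> S'} \<union> {f\<in>E. f \<subseteq> S \<and> f \<inter> A \<noteq> {}})"
      unfolding eT_def using finE by (intro card_mono) auto
    also have "\<dots> \<le> eT S' + card {f\<in>E. f \<subseteq> S \<and> f \<inter> A \<noteq> {}}"
      unfolding eT_def by (rule card_Un_le)
    finally show ?thesis using EA unfolding e_def by linarith
  qed
  \<comment> \<open>Subtracting \<delta> for each vertex of \<open>S'\<close> costs at most e / 4 of
    its e / 2 edges, so \<phi> is positive there and its maximiser is nonempty. The degree bound 2 *
    K * e / m becomes 8 * K * \<delta>.\<close>
  define \<delta> where "\<delta> = e / (4 * m)"
  have \<delta>0: "\<delta> > 0" using e0 m1 by (simp add: \<delta>_def)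
  \<comment> \<open>A maximiser has minimum degree at least \<delta>: deleting a vertex of smaller
    degree would increase \<phi>.\<close>
  define \<phi> where "\<phi> T = real (eT T) - \<delta> * real (card T)" for T
  have finS': "finite S'" by (simp add: S'_def finS)
  have "\<exists>T\<in>Pow S'. \<forall>R\<in>Pow S'. \<phi> R \<le> \<phi> T"
    using finS' by (intro exists_maximal) auto
  then obtain T where T: "T \<subseteq> S'" and Tmax: "\<And>R. R \<subseteq> S' \<Longrightarrow> \<phi> R \<le> \<phi> T" by auto
  have "\<delta> * real (card S') \<le> \<delta> * m"
  proof (rule mult_left_mono)
    show "real (card S') \<le> m" unfolding m_def S'_def using finS by (simp add: card_mono)
  qed (use \<delta>0 in simp)
  also have "\<delta> * m = e / 4" using m1 by (simp add: \<delta>_def)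
  finally have "\<phi> S' > 0" using eS' e0 unfolding \<phi>_def by linarith
  then have \<phi>T: "\<phi> T > 0" using Tmax[of S'] by simp
  have Tne: "T \<noteq> {}"
  proof
    assume "T = {}"
    then show False using \<phi>T eT_empty by (simp add: \<phi>_def)
  qed
  have finT: "finite T" using T finS' finite_subset by blast
  have TS: "T \<subseteq> S" using T by (auto simp: S'_def)
  have deg_ge: "\<delta> \<le> real (card {f\<in>E. v \<in> f \<and> f \<subseteq> T})" if v: "v \<in> T" for v
  proof -
    have "\<phi> (T - {v}) \<le> \<phi> T" using T by (intro Tmax) auto
    moreover have "eT T = eT (T - {v}) + card {f\<in>E. v \<in> f \<and> f \<subseteq> T}"
    proof -
      have "{f\<in>E. f \<subseteq> T} = {f\<in>E. f \<subseteq> T - {v}} \<union> {f\<in>E. v \<in> f \<and> f \<subseteq> T}" by auto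
      then show ?thesis
        unfolding eT_def using finE by (simp only:) (rule card_Un_disjoint; auto)
    qed
    moreover have "real (card T) = real (card (T - {v})) + 1"
      using card.remove[OF finT v] by simp
    ultimately show ?thesis by (simp add: \<phi>_def algebra_simps)
  qed
  have deg_le: "real (card {f\<in>E. v \<in> f \<and> f \<subseteq> T}) \<le> 8 * real K * \<delta>" if v: "v \<in> T" for v
  proof -
    have "card {f\<in>E. v \<in> f \<and> f \<subseteq> T} \<le> card {f\<in>E. v \<in> f \<and> f \<subseteq> S}"
      using TS finE by (intro card_mono) auto
    then have "real (card {f\<in>E. v \<in> f \<and> f \<subseteq> T}) \<le> deg v" by (simp add: deg_def)
    also have "\<dots> \<le> 2 * real K * e / m" using v T by (auto simp: S'_def A_def)
    also have "\<dots> = 8 * real K * \<delta>" using m1 by (simp add: \<delta>_def)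
    finally show ?thesis .
  qed
  have "\<delta> \<ge> C / 4 * real (card T) powr \<alpha>"
  proof -
    have "real (card T) \<le> m" unfolding m_def using TS finS by (simp add: card_mono)
    then have "C / 4 * real (card T) powr \<alpha> \<le> C / 4 * m powr \<alpha>"
      using \<alpha> C0 by (intro mult_left_mono powr_mono2) auto
    also have "\<dots> = C * m powr (1 + \<alpha>) / (4 * m)" using m1 by (simp add: powr_add)
    also have "\<dots> \<le> \<delta>" unfolding \<delta>_def using e_ge m1 by (intro divide_right_mono) auto
    finally show ?thesis .
  qed
  moreover have "T \<subseteq> V" using TS S by blast
  ultimately show ?thesis using Tne deg_ge deg_le by blast
qed

text \<open>The exponent is chosen such that \<alpha> * s * k = s - 1. In an almost regular subgraph
  on \<open>T\<close> the bound \<delta> \<ge> c * card T powr \<alpha> thus becomes \<delta> ^ (s *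
  k) \<ge> c ^ (s * k) * card T ^ (s - 1), which forces a robust tuple for a large constant
  c.\<close>

lemma card_edges_le:
  fixes s t k :: nat
  assumes s: "s \<ge> 2" and t: "t \<ge> 2" and k: "k \<in> {3, 4}"
  defines "\<alpha> \<equiv> (real s - 1) / (real s * real k)"
  shows "\<exists>C. \<forall>G :: 'a graph. simple_graph G \<longrightarrow> verts G \<noteq> {} \<longrightarrow> \<not> contains_copy G (subdivided_K s t k) \<longrightarrow>
      real (card (edges G)) \<le> C * real (card (verts G)) powr (1 + \<alpha>)"
proof -
  have \<alpha>: "\<alpha> > 0" using s k by (auto simp: \<alpha>_def)
  define K where "K = nat \<lceil>(2 * 3 powr (1 + \<alpha>) + 1) powr (1 / \<alpha>)\<rceil>"
  have "(2 * 3 powr (1 + \<alpha>) + 1) powr (1 / \<alpha>) \<le> real K" unfolding K_def by (rule real_nat_ceiling_ge)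
  then have "((2 * 3 powr (1 + \<alpha>) + 1) powr (1 / \<alpha>)) powr \<alpha> \<le> real K powr \<alpha>"
    using \<alpha> by (intro powr_mono2) auto
  then have "2 * 3 powr (1 + \<alpha>) + 1 \<le> real K powr \<alpha>"
    using \<alpha> by (simp add: powr_powr add_nonneg_nonneg)
  then have K2: "real K powr \<alpha> > 2 * 3 powr (1 + \<alpha>)" by linarith
  have K1: "K > 0"
  proof (rule ccontr)
    assume "\<not> K > 0"
    then have "real K powr \<alpha> = 0" by simp
    with K2 show False by (smt (verit) powr_ge_zero)
  qed
  have "8 * real K \<ge> 1" "s > 0" using K1 s by auto
  from exists_robust_spider[OF this(2) k this(1), where ?L0.0 = "t * (s * k + 1)"]
  obtain C0 \<delta>0 where C0: "C0 > 0" "\<delta>0 > 0" and main: "\<forall>(V :: 'a set) adj \<delta>.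
     bounded_graph V adj (8 * real K * \<delta>) \<and> V \<noteq> {} \<and> (\<forall>v\<in>V. real (card {u. adj v u}) \<ge> \<delta>) \<and> \<delta> \<ge> \<delta>0 \<and>
       \<delta> ^ (s * k) > C0 * real (card V) ^ (s - 1) \<longrightarrow>
     (\<exists>X. bounded_graph.robust_spider V adj s (t * (s * k + 1)) (\<lambda>_. k) X)"
    by (elim exE conjE)
  \<comment> \<open>Since \<open>T\<close> is nonempty, \<delta> \<ge> c \<ge> \<delta>0; and c ^ (s
    * k) \<ge> c > C0.\<close>
  define c where "c = \<delta>0 + C0 + 1"
  define C where "C = max (real K) (4 * c)"
  have "real (card (edges G)) \<le> C * real (card (verts G)) powr (1 + \<alpha>)"
    if G: "simple_graph G" "verts G \<noteq> {}" "\<not> contains_copy G (subdivided_K s t k)" for G :: "'a graph"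
  proof (rule ccontr)
    assume "\<not> ?thesis"
    then have big: "real (card (edges G)) \<ge> C * real (card (verts G)) powr (1 + \<alpha>)" by simp
    have fin: "finite (verts G)" and E: "\<And>e. e \<in> edges G \<Longrightarrow> e \<subseteq> verts G \<and> card e = 2"
      using G(1) by (auto simp: simple_graph_def)
    have CK: "C \<ge> real K" by (simp add: C_def)
    from almost_regular_subgraph[OF fin E G(2) \<alpha> K1 K2 CK big]
    obtain T \<delta> where T: "T \<subseteq> verts G" "T \<noteq> {}" and \<delta>: "\<delta> \<ge> C / 4 * real (card T) powr \<alpha>"
      and deg: "\<forall>v\<in>T. \<delta> \<le> real (card {e\<in>edges G. v \<in> e \<and> e \<subseteq> T}) \<and>
        real (card {e\<in>edges G. v \<in> e \<and> e \<subseteq> T}) \<le> 8 * real K * \<delta>"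
      by blast
    define adj where "adj u v \<longleftrightarrow> u \<in> T \<and> v \<in> T \<and> {u, v} \<in> edges G" for u v
    have finT: "finite T" using T fin finite_subset by blast
    have card_adj: "card {u. adj v u} = card {e\<in>edges G. v \<in> e \<and> e \<subseteq> T}" if v: "v \<in> T" for v
    proof (rule bij_betw_same_card[of "\<lambda>u. {v, u}"], unfold bij_betw_def, intro conjI)
      show "inj_on (\<lambda>u. {v, u}) {u. adj v u}"
        by (auto simp: inj_on_def doubleton_eq_iff)
      show "(\<lambda>u. {v, u}) ` {u. adj v u} = {e\<in>edges G. v \<in> e \<and> e \<subseteq> T}"
      proof (intro equalityI subsetI)
        fix e assume e: "e \<in> {e\<in>edges G. v \<in> e \<and> e \<subseteq> T}"
        then have "card e = 2" using E by auto
        then obtain a b where "e = {a, b}" by (auto simp: card_2_iff)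
        then have "\<exists>u. e = {v, u}" using e by auto
        then obtain u where "e = {v, u}" by blast
        then show "e \<in> (\<lambda>u. {v, u}) ` {u. adj v u}" using e by (auto simp: adj_def)
      qed (use v in \<open>auto simp: adj_def\<close>)
    qed
    have n1: "real (card T) \<ge> 1" using T finT by (simp add: Suc_le_eq card_gt_0_iff)
    have c1: "c \<ge> 1" using C0 by (simp add: c_def)
    have \<delta>c: "\<delta> \<ge> c * real (card T) powr \<alpha>"
    proof -
      have "c * real (card T) powr \<alpha> \<le> C / 4 * real (card T) powr \<alpha>"
        by (intro mult_right_mono) (auto simp: C_def)
      then show ?thesis using \<delta> by linarith
    qed
    have "real (card T) powr \<alpha> \<ge> 1" using n1 \<alpha> by (intro ge_one_powr_ge_zero) auto
    then have "c * 1 \<le> c * real (card T) powr \<alpha>" using c1 by (intro mult_left_mono) auto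
    then have \<delta>c1: "\<delta> \<ge> c" using \<delta>c by linarith
    then have \<delta>_pos: "\<delta> \<ge> 1" "\<delta> \<ge> \<delta>0" using c1 C0 by (auto simp: c_def)
    have "1 * 1 \<le> (8 * real K) * \<delta>" using K1 \<delta>_pos by (intro mult_mono) auto
    then have D1: "8 * real K * \<delta> \<ge> 1" by simp
    have bg: "bounded_graph T adj (8 * real K * \<delta>)"
    proof
      show "finite T" by (rule finT)
      show "adj v u" if "adj u v" for u v using that by (auto simp: adj_def insert_commute)
      show "\<not> adj v v" for v using E by (fastforce simp: adj_def)
      show "u \<in> T" if "adj u v" for u v using that by (simp add: adj_def)
      show "real (card {u. adj v u}) \<le> 8 * real K * \<delta>" for v
      proof (cases "v \<in> T")
        case True
        then show ?thesis using deg card_adj by simp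
      next
        case False
        then have "card {u. adj v u} = 0" by (simp add: adj_def)
        then show ?thesis using D1 by linarith
      qed
      show "1 \<le> 8 * real K * \<delta>" by (rule D1)
    qed
    have pw: "\<delta> ^ (s * k) > C0 * real (card T) ^ (s - 1)"
    proof -
      have "(real (card T) powr \<alpha>) ^ (s * k) = real (card T) powr (\<alpha> * real (s * k))"
        using n1 by (simp add: powr_realpow[symmetric] powr_powr)
      also have "\<alpha> * real (s * k) = real (s - 1)" using s k by (auto simp: \<alpha>_def of_nat_diff)
      also have "real (card T) powr real (s - 1) = real (card T) ^ (s - 1)" using n1 by (intro powr_realpow) simp
      finally have e: "(c * real (card T) powr \<alpha>) ^ (s * k) = c ^ (s * k) * real (card T) ^ (s - 1)"
        by (simp add: power_mult_distrib)
      have "s * k \<ge> 1" using s k by auto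
      then have "c ^ 1 \<le> c ^ (s * k)" using c1 by (intro power_increasing) auto
      then have "C0 < c ^ (s * k)" using C0 by (simp add: c_def)
      then have "C0 * real (card T) ^ (s - 1) < c ^ (s * k) * real (card T) ^ (s - 1)"
        using n1 by (intro mult_strict_right_mono) auto
      also have "\<dots> \<le> \<delta> ^ (s * k)"
        unfolding e[symmetric] using \<delta>c c1 by (intro power_mono) auto
      finally show ?thesis .
    qed
    have dT: "\<forall>v\<in>T. real (card {u. adj v u}) \<ge> \<delta>" using deg card_adj by simp
    obtain X where X: "bounded_graph.robust_spider T adj s (t * (s * k + 1)) (\<lambda>_. k) X"
      using main bg T(2) dT \<delta>_pos(2) pw by blast
    interpret bounded_graph T adj "8 * real K * \<delta>" s by (rule bg)
    have "contains_copy G (subdivided_K s t k)"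
      using s t k T(1) by (intro contains_copy_of_robust_spider[OF X]) (auto simp: adj_def)
    with G(3) show False by blast
  qed
  then show ?thesis by blast
qed

theorem theorem1p2:
  fixes s t k :: nat
  assumes "s \<ge> 2" and "t \<ge> 2" and "k \<in> {3, 4}"
  shows "(\<lambda>n :: nat. real (extremal_number n (subdivided_K s t k)))
           \<in> O(\<lambda>n. real n powr (1 + 1 / real k - 1 / (real s * real k)))"
proof -
  define \<alpha> where "\<alpha> = (real s - 1) / (real s * real k)"
  have \<alpha>: "1 + 1 / real k - 1 / (real s * real k) = 1 + \<alpha>"
    using assms by (auto simp: \<alpha>_def field_simps)
  let ?H = "subdivided_K s t k"
  obtain C where C: "\<And>G :: nat graph. simple_graph G \<Longrightarrow> verts G \<noteq> {} \<Longrightarrow> \<not> contains_copy G ?H \<Longrightarrow>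
      real (card (edges G)) \<le> C * real (card (verts G)) powr (1 + \<alpha>)"
    using card_edges_le[OF assms, where 'a = nat] unfolding \<alpha>_def by blast
  have "real (extremal_number n ?H) \<le> C * real n powr (1 + \<alpha>)" if n: "n \<ge> 1" for n
  proof -
    let ?M = "{card (edges G) | G :: nat graph. simple_graph G \<and> card (verts G) = n \<and> \<not> contains_copy G ?H}"
    \<comment> \<open>The pattern has an edge, so the edgeless graph on \<open>n\<close> vertices
      avoids it and the maximum is attained by some graph.\<close>
    have "0 < s" "0 < t" "0 < k" using assms by auto
    then have "{path_vertex k 0 0 0, path_vertex k 0 0 (Suc 0)} \<in> edges ?H"
      unfolding subdivided_K_def edges_def snd_conv by blast
    then have "\<not> contains_copy ({..<n}, {}) ?H"
      by (auto simp: contains_copy_def edges_def)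
    then have "card (edges ({..<n}, {})) \<in> ?M"
      by (intro CollectI exI[of _ "({..<n}, {})"]) (auto simp: simple_graph_def edges_def verts_def)
    then have "Max ?M \<in> ?M" by (intro Max_in finite_edge_counts) auto
    then obtain G :: "nat graph" where G: "extremal_number n ?H = card (edges G)"
      "simple_graph G" "card (verts G) = n" "\<not> contains_copy G ?H"
      unfolding extremal_number_def by blast
    have "verts G \<noteq> {}" using G(3) n by auto
    then show ?thesis using C[OF G(2) _ G(4)] G(1,3) by simp
  qed
  then have "eventually (\<lambda>n. norm (real (extremal_number n ?H)) \<le> C * norm (real n powr (1 + \<alpha>))) at_top"
    by (intro eventually_at_top_linorderI[of 1]) simp
  then show ?thesis unfolding \<alpha> by (rule bigoI)
qed

end
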